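(* Let $\mathcal T$ be a face-connected $n$-dimensional finite triangulation in $\mathbb R^n$ and let the domain $\Omega$ be the interior of the underlying set of $\mathcal T$. Let $1\le p,q\le\infty$ with $1=1/p+1/q$. Then for any $u\in W^{1,p}(\Omega)$ there exists $w\in W^{1,p}(\Omega)$ with $\nabla w=\nabla u$ such that the following holds. 1. There exists an $n$-simplex $T_0\in\mathcal T$ with $\|w\|_{L^p(T_0)}\le C_{\mathrm{PF},T_0,p}\,\|\nabla u\|_{L^p(T_0)}$. 2. For any $n$-simplex $T_M\in\mathcal T$ there exists a face path $T_0,T_1,\dots,T_M$ in $\mathcal T$ such that for all $1\le m\le M$, writing $F_m:=T_m\cap T_{m-1}$ and $U_{F_m}:=T_m\cup T_{m-1}$, we have the two recursive estimates $$\|w\|_{L^p(T_m)}\le A_m\|w\|_{L^p(T_{m-1})}+B'_m\|\nabla u\|_{L^p(T_m)}+B''_m\|\nabla u\|_{L^p(T_{m-1})},$$ $$\|w\|_{L^p(T_m)}\le A_m\|w\|_{L^p(T_{m-1})}+B^\star_m\|\nabla u\|_{L^p(U_{F_m})},$$ with constants satisfying $$A_m\le C_\rho(\mathcal T)^{1/p},\quad B'_m\le C_{\mathrm{PF},T_m,F_m,p},\quad B''_m\le C_{\mathrm{PF},T_m,F_m,p}\,C_\rho(\mathcal T)^{1/p}\,C_\xi(\mathcal T),\quad B^\star_m\le\left(1+C_\rho(\mathcal T)^{q/p}\right)^{1/q}C_{\mathrm{PF},U_{F_m},p}.$$ (The factor $(1+C_\rho(\mathcal T)^{q/p})^{1/q}$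 is read as $\max(1,C_\rho(\mathcal T))$ if $p=1$ and as $2$ if $p=\infty$; $C_\rho(\mathcal T)^{1/p}=1$ if $p=\infty$.)
   Context: A triangulation (simplicial complex) is a finite family of simplices containing all subsimplices of its members and such that any non-empty intersection of two members is a common subsimplex of both. It is $n$-dimensional if every member is contained in an $n$-dimensional member. Its underlying set is the union of its members. A face of an $n$-simplex is an $(n-1)$-dimensional subsimplex. Two $n$-simplices of $\mathcal T$ are face-neighboring if their intersection is a common face of both. A face path is a sequence of $n$-simplices of $\mathcal T$ in which consecutive ones are face-neighboring; $\mathcal T$ is face-connected if any two of its $n$-simplices are joined by a face path. $\|\nabla u\|_{L^p}$ is the $L^p$ norm of the pointwise Euclidean norm. $\delta(T)$ is the diameter and $\mathrm{vol}(T)$ the $n$-dimensional volume. $C_\rho(\mathcal T)=\sup \mathrm{vol}(T)/\mathrm{vol}(T')$, the supremum over all ordered pairs of face-neighboring $n$-simplices $T,T'$ of $\mathcal T$. For face-neighboring $n$-simplices $T,T'$, let $\Xi_{T,T'}:T\to T'$ be the affine diffeomorphism that is the identity on $T\cap T'$; $C_\xi(\mathcal T)$ is the supremum over all such pairs of the Euclidean operator norm of the Jacobian of $\Xi_{T,T'}$. For a set $X$ that is an $n$-simplex or a union of two face-neighboring $n$-simplices, $C_{\mathrm{PF},X,p}$ is the Poincaré–Friedrichs constant of (the interior of) $X$: the smallest constant $C$ with $\min_{c\in\mathbb R}\|v-c\|_{L^p(X)}\le C\|\nabla v\|_{L^p(X)}$ for all $v\in W^{1,p}(X)$. For an $n$-simplex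 $T$ with face $F$, $C_{\mathrm{PF},T,F,p}=p^{-1/p}\delta(T)$ if $p<\infty$ and $C_{\mathrm{PF},T,F,\infty}=\delta(T)$. *)

theory Defs
  imports "HOL-Analysis.Analysis" "HOL-Probability.Essential_Supremum"
begin

section \<open>Triangulations of full dimension\<close>

text \<open>
  The library's \<^const>\<open>simplicial_complex\<close> is closed under all faces, including the empty one.
  Here the members are nonempty simplices, so the empty face is adjoined before that notion is used.
\<close>

definition finite_triangulation :: "(real^'n) set set \<Rightarrow> bool" where
  "finite_triangulation \<T> \<longleftrightarrow> {} \<notin> \<T> \<and> simplicial_complex (insert {} \<T>)"

definition top_simplices :: "(real^'n) set set \<Rightarrow> (real^'n) set set" where
  "top_simplices \<T> = {T \<in> \<T>. int CARD('n) simplex T}"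

definition full_dimensional :: "(real^'n) set set \<Rightarrow> bool" where
  "full_dimensional \<T> \<longleftrightarrow> (\<forall>S\<in>\<T>. \<exists>T\<in>top_simplices \<T>. S \<subseteq> T)"

definition face_neighboring :: "(real^'n) set \<Rightarrow> (real^'n) set \<Rightarrow> bool" where
  "face_neighboring T T' \<longleftrightarrow> (T \<inter> T') facet_of T \<and> (T \<inter> T') facet_of T'"

text \<open>The face path \<open>P 0, \<dots>, P M\<close>; the values of \<open>P\<close> beyond \<open>M\<close> are irrelevant.\<close>

definition face_path :: "(real^'n) set set \<Rightarrow> nat \<Rightarrow> (nat \<Rightarrow> (real^'n) set) \<Rightarrow> bool" where
  "face_path \<T> M P \<longleftrightarrow>
     (\<forall>m\<le>M. P m \<in> top_simplices \<T>) \<and> (\<forall>m<M. face_neighboring (P m) (P (Suc m)))"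

definition face_connected :: "(real^'n) set set \<Rightarrow> bool" where
  "face_connected \<T> \<longleftrightarrow>
     (\<forall>T\<in>top_simplices \<T>. \<forall>T'\<in>top_simplices \<T>. \<exists>M P. face_path \<T> M P \<and> P 0 = T \<and> P M = T')"


section \<open>Lebesgue and Sobolev spaces\<close>

text \<open>
  Exponents range over \<^typ>\<open>ennreal\<close>. Functions are total on \<open>real^'n\<close>, but only their values on the
  set \<open>X\<close> matter. For vector-valued \<open>f\<close> the pointwise norm is the Euclidean one.
\<close>

definition mem_Lp :: "ennreal \<Rightarrow> (real^'n) set \<Rightarrow> (real^'n \<Rightarrow> 'b::euclidean_space) \<Rightarrow> bool" where
  "mem_Lp p X f \<longleftrightarrow>
     f \<in> borel_measurable (lebesgue_on X) \<and>
     (if p = \<infinity> then esssup (lebesgue_on X) (\<lambda>x. ereal (norm (f x))) < \<infinity>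
      else integrable (lebesgue_on X) (\<lambda>x. norm (f x) powr enn2real p))"

definition Lp_norm :: "ennreal \<Rightarrow> (real^'n) set \<Rightarrow> (real^'n \<Rightarrow> 'b::euclidean_space) \<Rightarrow> real" where
  "Lp_norm p X f =
     (if p = \<infinity> then real_of_ereal (esssup (lebesgue_on X) (\<lambda>x. ereal (norm (f x))))
      else (LINT x|lebesgue_on X. norm (f x) powr enn2real p) powr (1 / enn2real p))"

definition partial_derivative :: "'n \<Rightarrow> (real^'n \<Rightarrow> real) \<Rightarrow> real^'n \<Rightarrow> real" where
  "partial_derivative i f x = frechet_derivative f (at x) (axis i 1)"

primrec C_times :: "nat \<Rightarrow> (real^'n \<Rightarrow> real) \<Rightarrow> bool" where
  "C_times 0 f \<longleftrightarrow> continuous_on UNIV f"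
| "C_times (Suc k) f \<longleftrightarrow>
     (\<forall>x. f differentiable (at x)) \<and> (\<forall>i. C_times k (partial_derivative i f))"

definition test_functions :: "(real^'n) set \<Rightarrow> (real^'n \<Rightarrow> real) set" where
  "test_functions \<Omega> =
     {\<phi>. (\<forall>k. C_times k \<phi>) \<and> compact (closure {x. \<phi> x \<noteq> 0}) \<and> closure {x. \<phi> x \<noteq> 0} \<subseteq> \<Omega>}"

definition locally_integrable ::
  "(real^'n) set \<Rightarrow> (real^'n \<Rightarrow> 'b::euclidean_space) \<Rightarrow> bool" where
  "locally_integrable \<Omega> f \<longleftrightarrow> (\<forall>K. compact K \<and> K \<subseteq> \<Omega> \<longrightarrow> integrable (lebesgue_on K) f)"

definition has_weak_gradient ::
  "(real^'n) set \<Rightarrow> (real^'n \<Rightarrow> real) \<Rightarrow> (real^'n \<Rightarrow> real^'n) \<Rightarrow> bool" where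
  "has_weak_gradient \<Omega> v Dv \<longleftrightarrow>
     locally_integrable \<Omega> v \<and> locally_integrable \<Omega> Dv \<and>
     (\<forall>\<phi>\<in>test_functions \<Omega>. \<forall>i.
        (LINT x|lebesgue_on \<Omega>. v x * partial_derivative i \<phi> x)
        = - (LINT x|lebesgue_on \<Omega>. Dv x $ i * \<phi> x))"

text \<open>
  \<open>W1p p \<Omega> v Dv\<close> means that \<open>v\<close> is in the Sobolev space \<open>W\<^sup>1\<^sup>,\<^sup>p(\<Omega>)\<close> and that \<open>Dv\<close> is (a representative
  of) its weak gradient. In particular \<open>W1p p \<Omega> v D\<close> and \<open>W1p p \<Omega> w D\<close> together express
  that \<open>v\<close> and \<open>w\<close> are in the Sobolev space and have the same gradient.
\<close>

definition W1p ::
  "ennreal \<Rightarrow> (real^'n) set \<Rightarrow> (real^'n \<Rightarrow> real) \<Rightarrow> (real^'n \<Rightarrow> real^'n) \<Rightarrow> bool" where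
  "W1p p \<Omega> v Dv \<longleftrightarrow> mem_Lp p \<Omega> v \<and> mem_Lp p \<Omega> Dv \<and> has_weak_gradient \<Omega> v Dv"


section \<open>Constants\<close>

text \<open>
  The suprema below are over finite sets, nonempty as soon as some pair of face-neighboring simplices
  exists; the constants are only used in that case.
\<close>

definition C_rho :: "(real^'n) set set \<Rightarrow> real" where
  "C_rho \<T> = Sup {measure lebesgue T / measure lebesgue T' | T T'.
     T \<in> top_simplices \<T> \<and> T' \<in> top_simplices \<T> \<and> face_neighboring T T'}"

text \<open>\<open>J\<close> is the Jacobian of the affine bijection from \<open>T\<close> onto \<open>T'\<close> that fixes \<open>T \<inter> T'\<close> pointwise.\<close>

definition transition_jacobian ::
  "(real^'n) set \<Rightarrow> (real^'n) set \<Rightarrow> real^'n^'n \<Rightarrow> bool" where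
  "transition_jacobian T T' J \<longleftrightarrow>
     (\<exists>b. bij_betw (\<lambda>x. J *v x + b) T T' \<and> (\<forall>x \<in> T \<inter> T'. J *v x + b = x))"

definition C_xi :: "(real^'n) set set \<Rightarrow> real" where
  "C_xi \<T> = Sup {onorm ((*v) J) | T T' J.
     T \<in> top_simplices \<T> \<and> T' \<in> top_simplices \<T> \<and> face_neighboring T T' \<and> transition_jacobian T T' J}"

text \<open>
  The best constant in the Poincare-Friedrichs inequality on the interior of \<open>X\<close>. It is applied to
  \<open>n\<close>-simplices and unions of two face-neighboring \<open>n\<close>-simplices, whose boundaries are null sets.
\<close>

definition C_PF :: "ennreal \<Rightarrow> (real^'n) set \<Rightarrow> real" where
  "C_PF p X = Inf {C. 0 \<le> C \<and>
     (\<forall>v Dv. W1p p (interior X) v Dv \<longrightarrow>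
        (INF c. Lp_norm p X (\<lambda>x. v x - c)) \<le> C * Lp_norm p X Dv)}"

text \<open>The value depends on the simplex only, not on the face \<open>F\<close>.\<close>

definition C_PF_face :: "ennreal \<Rightarrow> (real^'n) set \<Rightarrow> (real^'n) set \<Rightarrow> real" where
  "C_PF_face p T F =
     (if p = \<infinity> then diameter T else enn2real p powr (- 1 / enn2real p) * diameter T)"

definition root_factor :: "ennreal \<Rightarrow> real \<Rightarrow> real" where
  "root_factor p C = (if p = \<infinity> then 1 else C powr (1 / enn2real p))"

text \<open>\<open>(1 + C\<^sup>q\<^sup>/\<^sup>p)\<^sup>1\<^sup>/\<^sup>q\<close> for conjugate exponents \<open>p\<close> and \<open>q\<close>, with its limit values at the endpoints.\<close>

definition dual_factor :: "ennreal \<Rightarrow> ennreal \<Rightarrow> real \<Rightarrow> real" where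
  "dual_factor p q C =
     (if p = 1 then max 1 C
      else if p = \<infinity> then 2
      else (1 + C powr (enn2real q / enn2real p)) powr (1 / enn2real q))"

end

theory Submission
  imports Defs
begin

text \<open>
  Take \<open>w = u - c\<close> with the best constant \<open>c\<close> on an arbitrary simplex \<open>T\<^sub>0\<close>; the numbers \<open>A\<close>, \<open>B'\<close>, \<open>B''\<close>, \<open>B\<^sup>*\<close>
  can be taken equal to their bounds, so that only one step across a face matters.

  For the first estimate let \<open>\<Xi>\<close> fold \<open>S = T\<^sub>m\<close> onto \<open>R = T\<^sub>m\<^sub>-\<^sub>1\<close>. For \<open>x\<close> in \<open>S\<close> let \<open>y\<close> be the point of the common
  face reached from \<open>x\<close> in the direction of an edge. Integrating the gradient along the broken line
  \<open>x, y, \<Xi> x\<close> bounds \<open>w x - w (\<Xi> x)\<close> by two integrals over the segment from \<open>y\<close> to \<open>x\<close>, and a Hardy inequality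
  along these segments gives the factor \<open>p\<^sup>-\<^sup>1\<^sup>/\<^sup>p\<close> times the diameter. For Sobolev functions the pointwise bound
  is obtained almost everywhere by mollification.

  For the second estimate subtract the best constant on \<open>S \<union> R\<close>, compare the \<open>L\<^sup>p\<close> norms of this constant on
  \<open>S\<close> and on \<open>R\<close>, and apply Hoelder's inequality for two terms. This requires that the Poincare-Friedrichs
  constants are infima of nonempty sets: on a simplex one averages over all segments, and on \<open>S \<union> R\<close> the
  inequality on \<open>R\<close> is carried over to \<open>S\<close> by the first estimate.
\<close>

section \<open>Test functions\<close>

text \<open>The constant p^(-1/p) is the p-th root of the integral of s^(p-1) over [0,1]: Jensen
  along a segment of parameter length s costs s^(p-1), and Tonelli lets this weight be integrated
  over the barycentric coordinate s. The second leg of the broken line is the fold of the first, so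
  once the gradient on \<open>R\<close> is pulled back to \<open>S\<close> the same inequality
  applies to it. The pull back produces the volume ratio to the power 1/p, the folded edge produces
  the operator norm, and the diameter remains that of \<open>S\<close>. The delicate geometric point
  is that the broken line must stay in the interior of the union, where test functions live; it
  crosses the face at such a point because two simplices that meet exactly in a common face lie on
  opposite sides of it. Traces on the face are never formed: the value at the crossing point cancels
  while the functions are still mollified, and the limit is harmless because rays, segment means and
  folding are bounded in L^1.\<close>

definition flat_exp :: "nat \<Rightarrow> real \<Rightarrow> real" where
  "flat_exp j t = (if t \<le> 0 then 0 else exp (- 1 / t) / t ^ j)"

lemma flat_exp_nonneg: "0 \<le> flat_exp j t"
  by (simp add: flat_exp_def)

lemma power_div_fact_le_exp:
  assumes "0 \<le> (x::real)"
  shows "x ^ k / fact k \<le> exp x"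
proof -
  have "(\<Sum>n\<in>{k}. x ^ n /\<^sub>R fact n) \<le> (\<Sum>n. x ^ n /\<^sub>R fact n)"
    using assms by (intro sum_le_suminf summable_exp_generic) auto
  then show ?thesis by (simp add: exp_def divide_inverse mult.commute)
qed

text \<open>The exponential series gives exp(1/t) >= t^(-(j+2)) / (j+2)!, and dividing by t^j uses
  up \<open>j\<close> of these powers. Two powers remain, one more than continuity at 0 would need,
  so that the difference quotient at 0 tends to 0.\<close>

lemma flat_exp_quadratic_bound: "\<bar>flat_exp j t\<bar> \<le> fact (j + 2) * t\<^sup>2"
proof (cases "t \<le> 0")
  case False
  have "(1 / t) ^ (j + 2) / fact (j + 2) \<le> exp (1 / t)"
    by (rule power_div_fact_le_exp) (use False in simp)
  then have "1 \<le> fact (j + 2) * (t ^ (j + 2) * exp (1 / t))"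
    using False by (simp add: power_one_over divide_le_eq mult_ac del: fact_Suc add_2_eq_Suc' add_2_eq_Suc)
  then have "flat_exp j t \<le> fact (j + 2) * t\<^sup>2"
    using False by (simp only: flat_exp_def exp_minus divide_minus_left power_add if_False)
      (simp add: divide_simps mult_ac del: fact_Suc add_2_eq_Suc' add_2_eq_Suc)
  then show ?thesis by (simp add: flat_exp_nonneg)
qed (simp add: flat_exp_def)

text \<open>The exponent \<open>j\<close> makes the family closed under differentiation up to linear
  combinations: differentiating exp(-1/t) contributes 1/t^2 and raises \<open>j\<close> by 2,
  differentiating t^(-j) raises it by 1. At t = 0 the difference quotient is controlled by
  \<open>flat_exp_quadratic_bound\<close>.\<close>

lemma flat_exp_has_derivative:
  "(flat_exp j has_real_derivative (flat_exp (j + 2) t - real j * flat_exp (Suc j) t)) (at t)"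
proof -
  consider "t < 0" | "t = 0" | "0 < t" by linarith
  then show ?thesis
  proof cases
    case 1
    have "((\<lambda>_. 0) has_real_derivative 0) (at t)" by simp
    then have "(flat_exp j has_real_derivative 0) (at t)"
      by (rule DERIV_cong_ev[THEN iffD1, rotated -1, OF _ refl _ refl])
        (use 1 in \<open>auto simp: flat_exp_def intro!: eventually_mono[OF eventually_nhds_in_open[of "{..<0}" t]]\<close>)
    then show ?thesis using 1 by (simp add: flat_exp_def)
  next
    case 2
    have "((\<lambda>h. flat_exp j h / h) \<longlongrightarrow> 0) (at 0)"
    proof (rule Lim_null_comparison)
      show "\<forall>\<^sub>F h in at 0. norm (flat_exp j h / h) \<le> fact (j + 2) * \<bar>h\<bar>"
        using flat_exp_quadratic_bound[of j]
        by (auto simp: eventually_at_filter divide_le_eq power2_eq_square abs_mult mult.assoc abs_mult_self_eq)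
      show "((\<lambda>h::real. fact (j + 2) * \<bar>h\<bar>) \<longlongrightarrow> 0) (at 0)"
        by (auto intro!: tendsto_eq_intros)
    qed
    then show ?thesis using 2 by (simp add: DERIV_def flat_exp_def)
  next
    case 3
    have "((\<lambda>t. exp (- 1 / t) / t ^ j) has_real_derivative
        (exp (- 1 / t) * (1 / t\<^sup>2) * t ^ j - exp (- 1 / t) * (real j * t ^ (j - 1))) / (t ^ j * t ^ j)) (at t)"
      using 3 by (auto intro!: derivative_eq_intros simp: power2_eq_square)
    also have "(exp (- 1 / t) * (1 / t\<^sup>2) * t ^ j - exp (- 1 / t) * (real j * t ^ (j - 1))) / (t ^ j * t ^ j)
        = flat_exp (j + 2) t - real j * flat_exp (Suc j) t"
      using 3 by (cases j) (simp_all add: flat_exp_def field_simps power2_eq_square)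
    finally have "((\<lambda>t. exp (- 1 / t) / t ^ j) has_real_derivative
        (flat_exp (j + 2) t - real j * flat_exp (Suc j) t)) (at t)" .
    then show ?thesis
      by (rule DERIV_cong_ev[THEN iffD1, rotated -1, OF _ refl _ refl])
        (use 3 in \<open>auto simp: flat_exp_def intro!: eventually_mono[OF eventually_nhds_in_open[of "{0<..}" t]]\<close>)
  qed
qed

text \<open>\<open>C_times k\<close> for every \<open>k\<close> asks for iterated partial
  derivatives of all orders. Instead of tracking them, smoothness is read off from a class of
  functions that is stable under partial differentiation; the coordinate functions enter through the
  inner derivative of the squared norm.\<close>

inductive_set bump_algebra :: "(real^'n \<Rightarrow> real) set" where
  const: "(\<lambda>_. c) \<in> bump_algebra"
| coord: "(\<lambda>x. x $ i) \<in> bump_algebra"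
| bump: "(\<lambda>x. flat_exp j (r - (norm (x - a))\<^sup>2)) \<in> bump_algebra"
| add: "f \<in> bump_algebra \<Longrightarrow> g \<in> bump_algebra \<Longrightarrow> (\<lambda>x. f x + g x) \<in> bump_algebra"
| mult: "f \<in> bump_algebra \<Longrightarrow> g \<in> bump_algebra \<Longrightarrow> (\<lambda>x. f x * g x) \<in> bump_algebra"

lemma partial_derivativeI:
  "(f has_derivative f') (at x) \<Longrightarrow> partial_derivative i f x = f' (axis i 1)"
  unfolding partial_derivative_def using frechet_derivative_at by metis

lemma bump_has_derivative:
  fixes a :: "real^'n"
  shows "((\<lambda>x. flat_exp j (r - (norm (x - a))\<^sup>2)) has_derivative
    (\<lambda>h. (flat_exp (j + 2) (r - (norm (x - a))\<^sup>2) - real j * flat_exp (Suc j) (r - (norm (x - a))\<^sup>2))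
        * (- 2 * ((x - a) \<bullet> h)))) (at x)"
proof -
  have "((\<lambda>x. r - (norm (x - a))\<^sup>2) has_derivative (\<lambda>h. - 2 * ((x - a) \<bullet> h))) (at x)"
    unfolding power2_norm_eq_inner
    by (auto intro!: derivative_eq_intros simp: inner_commute algebra_simps)
  from has_derivative_compose[OF this flat_exp_has_derivative[unfolded has_field_derivative_def]]
  show ?thesis by simp
qed

lemma bump_algebra_derivative:
  assumes "f \<in> bump_algebra"
  shows "(\<forall>x. f differentiable (at x)) \<and> (\<forall>i. partial_derivative i f \<in> bump_algebra)"
  using assms
proof induction
  case (const c)
  have "partial_derivative i (\<lambda>_. c) = (\<lambda>_. 0)" for i :: 'a
    by (rule ext, subst partial_derivativeI[OF has_derivative_const]) simp
  then show ?case using bump_algebra.const[of 0] by simp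
next
  case (coord k)
  have d: "((\<lambda>x. x $ k) has_derivative (\<lambda>h. h $ k)) (at x)" for x :: "real^'a"
    by (rule bounded_linear_imp_has_derivative) (rule bounded_linear_vec_nth)
  have "partial_derivative i (\<lambda>x::real^'a. x $ k) = (\<lambda>_. axis i 1 $ k)" for i
    by (rule ext, subst partial_derivativeI[OF d]) simp
  then show ?case using d bump_algebra.const unfolding differentiable_def by metis
next
  case (bump j r a)
  let ?n = "\<lambda>j x. flat_exp j (r - (norm (x - a))\<^sup>2)"
  have "partial_derivative i (?n j) \<in> bump_algebra" for i
  proof -
    \<comment> \<open>Differences appear as sums with negated terms because the closure rules are
      those of sums and products.\<close>
    have "partial_derivative i (?n j) = (\<lambda>x. (?n (j + 2) x + (- real j) * ?n (Suc j) x) * ((- 2) * (x $ i + (- (a $ i)))))"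
      by (rule ext, subst partial_derivativeI[OF bump_has_derivative]) (simp add: inner_axis algebra_simps)
    also have "\<dots> \<in> bump_algebra" by (intro bump_algebra.intros)
    finally show ?thesis .
  qed
  then show ?case using bump_has_derivative unfolding differentiable_def by blast
next
  case (add f g)
  then have "(f has_derivative frechet_derivative f (at x)) (at x)"
    "(g has_derivative frechet_derivative g (at x)) (at x)" for x
    using frechet_derivative_works by blast+
  note d = has_derivative_add[OF this]
  have "partial_derivative i (\<lambda>x. f x + g x) = (\<lambda>x. partial_derivative i f x + partial_derivative i g x)" for i
    by (rule ext, subst partial_derivativeI[OF d]) (simp add: partial_derivative_def)
  then show ?case using d bump_algebra.add add unfolding differentiable_def by metis
next
  case (mult f g)
  then have "(f has_derivative frechet_derivative f (at x)) (at x)"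
    "(g has_derivative frechet_derivative g (at x)) (at x)" for x
    using frechet_derivative_works by blast+
  note d = has_derivative_mult[OF this]
  have "partial_derivative i (\<lambda>x. f x * g x) =
      (\<lambda>x. f x * partial_derivative i g x + partial_derivative i f x * g x)" for i
    by (rule ext, subst partial_derivativeI[OF d]) (simp add: partial_derivative_def)
  then have "partial_derivative i (\<lambda>x. f x * g x) \<in> bump_algebra" for i
    using mult by (auto intro!: bump_algebra.intros)
  then show ?case using d unfolding differentiable_def by blast
qed

lemma C_times_bump_algebra: "f \<in> bump_algebra \<Longrightarrow> C_times k f"
proof (induction k arbitrary: f)
  case 0
  then show ?case
    using bump_algebra_derivative differentiable_imp_continuous_within
    by (fastforce simp: continuous_on_eq_continuous_at)
qed (use bump_algebra_derivative in auto)

text \<open>The squared norm is used because it is smooth at \<open>a\<close>; comparing it with r^2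
  makes the open ball of radius \<open>r\<close> the exact set of positivity for positive
  \<open>r\<close>. The normalisation is left to \<open>bump_mass\<close>.\<close>

definition bump :: "real \<Rightarrow> real^'n \<Rightarrow> real^'n \<Rightarrow> real" where
  "bump r a x = flat_exp 0 (r\<^sup>2 - (norm (x - a))\<^sup>2)"

lemma bump_nonneg: "0 \<le> bump r a x"
  by (simp add: bump_def flat_exp_nonneg)

lemma bump_pos_iff: "0 < r \<Longrightarrow> 0 < bump r a x \<longleftrightarrow> dist a x < r"
  by (auto simp: bump_def flat_exp_def dist_norm norm_minus_commute not_le abs_square_less_1
      intro: power_strict_mono dest: power_less_imp_less_base)

lemma bump_test_function:
  assumes "0 < r" "cball a r \<subseteq> \<Omega>"
  shows "bump r a \<in> test_functions \<Omega>"
proof -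
  have "{x. bump r a x \<noteq> 0} \<subseteq> cball a r"
    using bump_pos_iff[OF assms(1), of a] bump_nonneg[of r a] by (force simp: less_le)
  then have "closure {x. bump r a x \<noteq> 0} \<subseteq> cball a r"
    by (rule closure_minimal) simp
  moreover have "bump r a \<in> bump_algebra"
    unfolding bump_def[abs_def] by (rule bump_algebra.bump)
  ultimately show ?thesis
    using assms(2) bounded_subset[OF bounded_cball, of "closure {x. bump r a x \<noteq> 0}" a r]
    by (auto simp: test_functions_def C_times_bump_algebra compact_eq_bounded_closed)
qed

section \<open>Mollification\<close>

lemma nn_integral_lborel_translation:
  fixes c :: "'a::euclidean_space"
  assumes "f \<in> borel_measurable borel"
  shows "(\<integral>\<^sup>+x. f (c + x) \<partial>lborel) = (\<integral>\<^sup>+x. f x \<partial>lborel)"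
proof -
  have "(\<integral>\<^sup>+x. f x \<partial>lborel) = (\<integral>\<^sup>+x. f x \<partial>distr lborel borel ((+) c))"
    by (simp add: lborel_distr_plus)
  also have "\<dots> = (\<integral>\<^sup>+x. f (c + x) \<partial>lborel)"
    by (rule nn_integral_distr) (use assms in auto)
  finally show ?thesis by simp
qed

lemma nn_integral_lborel_scale:
  fixes t :: "'a::euclidean_space"
  assumes "f \<in> borel_measurable borel" "c \<noteq> 0"
  shows "(\<integral>\<^sup>+x. f x \<partial>lborel) = ennreal (\<bar>c\<bar> ^ DIM('a)) * (\<integral>\<^sup>+x. f (t + c *\<^sub>R x) \<partial>lborel)"
proof -
  have "(\<integral>\<^sup>+x. f x \<partial>lborel)
      = (\<integral>\<^sup>+x. f x \<partial>density (distr lborel borel (\<lambda>x. t + c *\<^sub>R x)) (\<lambda>_. ennreal (\<bar>c\<bar> ^ DIM('a))))"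
    using lborel_affine[OF assms(2), of t] by (simp add: ennreal_power)
  also have "\<dots> = ennreal (\<bar>c\<bar> ^ DIM('a)) * (\<integral>\<^sup>+x. f (t + c *\<^sub>R x) \<partial>lborel)"
    using assms(1) by (simp add: nn_integral_density nn_integral_distr nn_integral_cmult)
  finally show ?thesis .
qed

lemma nn_integral_lborel_reflection:
  fixes t :: "'a::euclidean_space"
  assumes "f \<in> borel_measurable borel"
  shows "(\<integral>\<^sup>+x. f (t - x) \<partial>lborel) = (\<integral>\<^sup>+x. f x \<partial>lborel)"
  using nn_integral_lborel_scale[OF assms, of "-1" t] by simp

lemma integral_lborel_reflection:
  fixes t :: "'a::euclidean_space" and f :: "'a \<Rightarrow> real"
  assumes [measurable]: "f \<in> borel_measurable borel"
  shows "(LINT x|lborel. f (t - x)) = (LINT x|lborel. f x)"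
proof -
  have "(LINT x|lborel. f x)
      = (LINT x|density (distr lborel borel (\<lambda>x. t + (-1) *\<^sub>R x)) (\<lambda>_. ennreal (\<bar>-1\<bar> ^ DIM('a))). f x)"
    using lborel_affine[of "-1" t] by simp
  also have "\<dots> = (LINT x|lborel. f (t - x))"
    by (simp add: density_1 integral_distr)
  finally show ?thesis by simp
qed

text \<open>Induction over integrable functions. For the indicator of \<open>A\<close>, a compact
  set inside and an open set outside \<open>A\<close> are chosen with small difference; a
  translation shorter than their distance changes the indicator only on this difference and on its
  translate. Sums and limits split the error by the triangle inequality.\<close>

lemma continuous_translation_L1:
  fixes f :: "'a::euclidean_space \<Rightarrow> 'b::{banach, second_countable_topology}"
  assumes "integrable lborel f" "0 < e"
  shows "\<exists>d>0. \<forall>z. norm z < d \<longrightarrow> (\<integral>\<^sup>+x. norm (f (x - z) - f x) \<partial>lborel) \<le> ennreal e"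
  using assms
proof (induction arbitrary: e rule: integrable_induct)
  case (base A c)
  then have [measurable]: "A \<in> sets borel" by simp
  \<comment> \<open>The difference \<open>U - K\<close> has measure at most 3 \<open>e'\<close> and
    is counted twice, once translated, hence 6; the added 1 covers c = 0.\<close>
  define e' where "e' = e / (6 * (norm c + 1))"
  have e': "0 < e'" using base(3) by (auto simp: e'_def intro!: divide_pos_pos add_nonneg_pos)
  have Al: "A \<in> sets lebesgue" by simp
  obtain U where U: "open U" "A \<subseteq> U" "U - A \<in> lmeasurable" "emeasure lebesgue (U - A) < ennreal e'"
    by (rule sets_lebesgue_outer_open[OF Al e'])
  obtain C where C: "closed C" "C \<subseteq> A" "A - C \<in> lmeasurable" "emeasure lebesgue (A - C) < ennreal e'"
    by (rule sets_lebesgue_inner_closed[OF Al e'])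
  have [measurable]: "U \<in> sets borel" "C \<in> sets borel" using U C by auto
  \<comment> \<open>The inner approximation \<open>C\<close> is only closed. Since it has finite
    measure, cutting it off by a large ball gives a compact \<open>K\<close> at the cost of another
    \<open>e'\<close>.\<close>
  have "emeasure lborel C < \<infinity>"
    using emeasure_mono[OF C(2), of lborel] base(2) by auto
  then have fin: "emeasure lborel (C - cball 0 (real n)) \<noteq> \<infinity>" for n
    using emeasure_mono[of "C - cball 0 (real n)" C lborel] by (auto simp: less_top top_unique)
  have "(\<lambda>n. emeasure lborel (C - cball 0 (real n))) \<longlonglongrightarrow> emeasure lborel (\<Inter>n. C - cball 0 (real n))"
    using fin by (intro Lim_emeasure_decseq) (auto simp: decseq_def)
  also have "(\<Inter>n. C - cball 0 (real n)) = {}"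
    using real_arch_simple by (auto simp: not_le)
  finally obtain n where n: "emeasure lborel (C - cball 0 (real n)) < ennreal e'"
    using order_tendstoD(2)[of _ 0 sequentially "ennreal e'"] e' by (auto simp: eventually_sequentially)
  define K where "K = C \<inter> cball 0 (real n)"
  have K: "compact K" "K \<subseteq> A" and [measurable]: "K \<in> sets borel"
    using C by (auto simp: K_def closed_Int_compact)
  obtain d where d: "d > 0" "(\<Union>x\<in>K. ball x d) \<subseteq> U"
    using compact_subset_open_imp_ball_epsilon_subset[OF K(1) U(1)] K(2) U(2) by auto
  have "emeasure lborel (U - K) \<le> emeasure lborel ((U - A) \<union> ((A - C) \<union> (C - cball 0 (real n))))"
    by (rule emeasure_mono) (auto simp: K_def)
  also have "\<dots> \<le> emeasure lborel (U - A) + (emeasure lborel (A - C) + emeasure lborel (C - cball 0 (real n)))"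
    by (intro order_trans[OF emeasure_subadditive] add_mono order_refl) auto
  also have "\<dots> \<le> ennreal e' + (ennreal e' + ennreal e')"
    using U(4) C(4) n by (intro add_mono) auto
  also have "\<dots> = ennreal (3 * e')" using e' by (simp flip: ennreal_plus)
  finally have m: "emeasure lborel (U - K) \<le> ennreal (3 * e')" .
  show ?case
  proof (intro exI conjI allI impI)
    show "0 < d" by fact
    fix z :: 'a assume z: "norm z < d"
    have "(\<integral>\<^sup>+x. norm (indicator A (x - z) *\<^sub>R c - indicator A x *\<^sub>R c) \<partial>lborel)
        \<le> (\<integral>\<^sup>+x. ennreal (norm c) * (indicator (U - K) x + indicator (U - K) (- z + x)) \<partial>lborel)"
    proof (rule nn_integral_mono)
      fix x
      have "x \<in> K \<Longrightarrow> x - z \<in> U" "x - z \<in> K \<Longrightarrow> x \<in> U"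
        using d(2) z by (force simp: dist_norm norm_minus_commute)+
      then show "ennreal (norm (indicator A (x - z) *\<^sub>R c - indicator A x *\<^sub>R c))
          \<le> ennreal (norm c) * (indicator (U - K) x + indicator (U - K) (- z + x))"
        using K(2) U(2) mult_left_mono[of 1 2 "ennreal (norm c)"] by (auto simp: indicator_def)
    qed
    also have "\<dots> = ennreal (norm c) * (emeasure lborel (U - K) + emeasure lborel (U - K))"
      using nn_integral_lborel_translation[of "indicator (U - K)" "- z"]
      by (simp add: nn_integral_cmult nn_integral_add)
    also have "\<dots> \<le> ennreal (norm c) * (ennreal (3 * e') + ennreal (3 * e'))"
      by (intro mult_left_mono add_mono m) auto
    also have "\<dots> = ennreal (norm c * (6 * e'))"
      using e' by (simp only: ennreal_plus[symmetric] ennreal_mult'[symmetric] norm_ge_zero) simp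
    also have "norm c * (6 * e') \<le> e"
      using base(3) by (simp add: e'_def divide_le_eq add_nonneg_pos)
    finally show "(\<integral>\<^sup>+x. norm (indicator A (x - z) *\<^sub>R c - indicator A x *\<^sub>R c) \<partial>lborel) \<le> ennreal e"
      by (simp add: ennreal_leI)
  qed
next
  case (add f g)
  then have [measurable]: "f \<in> borel_measurable borel" "g \<in> borel_measurable borel" by auto
  obtain d1 d2 where d: "d1 > 0" "d2 > 0"
    "\<And>z. norm z < d1 \<Longrightarrow> (\<integral>\<^sup>+x. norm (f (x - z) - f x) \<partial>lborel) \<le> ennreal (e / 2)"
    "\<And>z. norm z < d2 \<Longrightarrow> (\<integral>\<^sup>+x. norm (g (x - z) - g x) \<partial>lborel) \<le> ennreal (e / 2)"
    using add.IH[of "e / 2"] add.prems by (meson half_gt_zero)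
  show ?case
  proof (intro exI[of _ "min d1 d2"] conjI allI impI)
    fix z :: 'a assume z: "norm z < min d1 d2"
    have "(\<integral>\<^sup>+x. norm (f (x - z) + g (x - z) - (f x + g x)) \<partial>lborel)
        \<le> (\<integral>\<^sup>+x. ennreal (norm (f (x - z) - f x)) + ennreal (norm (g (x - z) - g x)) \<partial>lborel)"
      by (intro nn_integral_mono) (simp add: norm_diff_triangle_ineq flip: ennreal_plus)
    also have "\<dots> = (\<integral>\<^sup>+x. norm (f (x - z) - f x) \<partial>lborel) + (\<integral>\<^sup>+x. norm (g (x - z) - g x) \<partial>lborel)"
      by (simp add: nn_integral_add)
    also have "\<dots> \<le> ennreal (e / 2) + ennreal (e / 2)"
      using d z by (intro add_mono) auto
    finally show "(\<integral>\<^sup>+x. norm (f (x - z) + g (x - z) - (f x + g x)) \<partial>lborel) \<le> ennreal e"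
      using add.prems by (simp flip: ennreal_plus)
  qed (use d in auto)
next
  case (lim f s)
  then have [measurable]: "\<And>i. s i \<in> borel_measurable borel" "f \<in> borel_measurable borel" by auto
  have "(\<lambda>i. \<integral>\<^sup>+x. norm (f x - s i x) \<partial>lborel) \<longlonglongrightarrow> 0"
  proof (rule nn_integral_dominated_convergence_norm[where w = "\<lambda>x. 2 * norm (f x)"])
    show "(\<integral>\<^sup>+ x. ennreal (2 * norm (f x)) \<partial>lborel) < \<infinity>"
      using lim.hyps(4) by (simp add: ennreal_mult nn_integral_cmult integrable_iff_bounded ennreal_mult_less_top)
    show "AE x in lborel. norm (s i x) \<le> 2 * norm (f x)" for i
      using lim.hyps(3) by (intro AE_I2) simp
    show "AE x in lborel. (\<lambda>i. s i x) \<longlonglongrightarrow> f x"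
      using lim.hyps(2) by (intro AE_I2) simp
  qed measurable
  from order_tendstoD(2)[OF this, of "ennreal (e / 3)"] lim.prems
  obtain i where i: "(\<integral>\<^sup>+x. norm (s i x - f x) \<partial>lborel) < ennreal (e / 3)"
    by (auto simp: eventually_sequentially norm_minus_commute)
  obtain d where d: "d > 0" "\<And>z. norm z < d \<Longrightarrow> (\<integral>\<^sup>+x. norm (s i (x - z) - s i x) \<partial>lborel) \<le> ennreal (e / 3)"
    using lim.IH[of "e / 3" i] lim.prems by auto
  show ?case
  proof (intro exI[of _ d] conjI allI impI)
    fix z :: 'a assume z: "norm z < d"
    have "(\<integral>\<^sup>+x. norm (f (x - z) - f x) \<partial>lborel)
        \<le> (\<integral>\<^sup>+x. ennreal (norm (s i (- z + x) - f (- z + x))) + (ennreal (norm (s i (x - z) - s i x))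
            + ennreal (norm (s i x - f x))) \<partial>lborel)"
    proof (intro nn_integral_mono)
      fix x
      have "f (x - z) - f x = (s i x - f x) + (s i (x - z) - s i x) - (s i (x - z) - f (x - z))" by simp
      then have "norm (f (x - z) - f x) \<le> norm (s i (x - z) - f (x - z)) + (norm (s i (x - z) - s i x) + norm (s i x - f x))"
        by (smt (verit, del_insts) norm_triangle_ineq norm_triangle_ineq4)
      then show "ennreal (norm (f (x - z) - f x)) \<le> ennreal (norm (s i (- z + x) - f (- z + x)))
          + (ennreal (norm (s i (x - z) - s i x)) + ennreal (norm (s i x - f x)))"
        by (simp flip: ennreal_plus)
    qed
    also have "\<dots> = (\<integral>\<^sup>+x. norm (s i x - f x) \<partial>lborel) + ((\<integral>\<^sup>+x. norm (s i (x - z) - s i x) \<partial>lborel)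
        + (\<integral>\<^sup>+x. norm (s i x - f x) \<partial>lborel))"
      using nn_integral_lborel_translation[of "\<lambda>x. ennreal (norm (s i x - f x))" "- z"]
      by (simp add: nn_integral_add)
    also have "\<dots> \<le> ennreal (e / 3) + (ennreal (e / 3) + ennreal (e / 3))"
      using d z i by (intro add_mono) auto
    finally show "(\<integral>\<^sup>+x. norm (f (x - z) - f x) \<partial>lborel) \<le> ennreal e"
      using lim.prems by (simp flip: ennreal_plus)
  qed (use d in auto)
qed

section \<open>Gradients of test functions and differences along segments\<close>

definition grad :: "(real^'n \<Rightarrow> real) \<Rightarrow> real^'n \<Rightarrow> real^'n" where
  "grad f x = (\<chi> i. partial_derivative i f x)"

lemma linear_eq_inner_axis:
  fixes f :: "real^'n \<Rightarrow> real"
  assumes "linear f"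
  shows "f h = (\<chi> i. f (axis i 1)) \<bullet> h"
proof -
  have "f h = f (\<Sum>i\<in>UNIV. h $ i *\<^sub>R axis i 1)"
    using basis_expansion[of h] by (simp add: scalar_mult_eq_scaleR)
  also have "\<dots> = (\<Sum>i\<in>UNIV. h $ i * f (axis i 1))"
    using assms by (simp add: linear_sum linear_scale)
  finally show ?thesis by (simp add: inner_vec_def mult.commute)
qed

lemma C_times_has_derivative_grad:
  assumes "C_times (Suc k) f"
  shows "(f has_derivative (\<lambda>h. grad f x \<bullet> h)) (at x)"
proof -
  have d: "(f has_derivative frechet_derivative f (at x)) (at x)"
    using assms frechet_derivative_works by auto
  then have "linear (frechet_derivative f (at x))"
    by (rule has_derivative_linear)
  then have "frechet_derivative f (at x) = (\<lambda>h. grad f x \<bullet> h)"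
    unfolding grad_def partial_derivative_def by (intro ext linear_eq_inner_axis)
  with d show ?thesis by simp
qed

lemma continuous_grad:
  assumes "C_times 1 f" shows "continuous_on UNIV (grad f)"
  using assms unfolding grad_def[abs_def] by (auto intro!: continuous_on_vec_lambda)

lemma test_function_grad_zero:
  assumes "\<phi> \<in> test_functions \<Omega>" "x \<notin> closure {x. \<phi> x \<noteq> 0}"
  shows "grad \<phi> x = 0"
proof -
  let ?S = "- closure {x. \<phi> x \<noteq> 0}"
  have z: "\<phi> y = 0" if "y \<in> ?S" for y
    using that closure_subset[of "{x. \<phi> x \<noteq> 0}"] by blast
  have "C_times (Suc 0) \<phi>" using assms(1) unfolding test_functions_def by blast
  from C_times_has_derivative_grad[OF this]
  have "((\<lambda>_. 0) has_derivative (\<lambda>h. grad \<phi> x \<bullet> h)) (at x)"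
  proof (rule has_derivative_transform_within_open)
    show "open ?S" "x \<in> ?S" using assms(2) by (auto simp: open_Compl)
  qed (rule z)
  then have "(\<lambda>h. grad \<phi> x \<bullet> h) = (\<lambda>_. 0)"
    using has_derivative_unique has_derivative_const by blast
  then show ?thesis by (metis inner_eq_zero_iff)
qed

lemma test_function_grad_bounded:
  assumes "\<phi> \<in> test_functions \<Omega>"
  shows "\<exists>B>0. \<forall>x. norm (grad \<phi> x) \<le> B \<and> \<bar>\<phi> x\<bar> \<le> B"
proof -
  let ?K = "closure {x. \<phi> x \<noteq> 0}"
  have C: "C_times 0 \<phi>" "C_times 1 \<phi>" and K: "compact ?K"
    using assms unfolding test_functions_def by blast+
  have "bounded (grad \<phi> ` ?K)" "bounded (\<phi> ` ?K)"
    by (auto intro!: compact_imp_bounded compact_continuous_image K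
        continuous_on_subset[OF continuous_grad[OF C(2)]] continuous_on_subset[OF C(1)[unfolded C_times.simps]])
  then obtain B1 B2 where B: "\<And>x. x \<in> ?K \<Longrightarrow> norm (grad \<phi> x) \<le> B1" "\<And>x. x \<in> ?K \<Longrightarrow> norm (\<phi> x) \<le> B2"
    unfolding bounded_iff by blast
  show ?thesis
  proof (intro exI conjI allI)
    show "0 < 1 + \<bar>B1\<bar> + \<bar>B2\<bar>" by simp
    fix x
    show "norm (grad \<phi> x) \<le> 1 + \<bar>B1\<bar> + \<bar>B2\<bar>"
    proof (cases "x \<in> ?K")
      case True
      then show ?thesis using B(1) by fastforce
    next
      case False
      show ?thesis unfolding test_function_grad_zero[OF assms False] by simp
    qed
    show "\<bar>\<phi> x\<bar> \<le> 1 + \<bar>B1\<bar> + \<bar>B2\<bar>"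
    proof (cases "x \<in> ?K")
      case True
      then show ?thesis using B(2) by fastforce
    next
      case False
      then have "\<phi> x = 0" using closure_subset[of "{x. \<phi> x \<noteq> 0}"] by blast
      then show ?thesis by simp
    qed
  qed
qed

lemma test_function_FTC:
  assumes "\<phi> \<in> test_functions \<Omega>"
  shows "(LINT t|lborel. indicator {0..1} t * (grad \<phi> (x + t *\<^sub>R h) \<bullet> h)) = \<phi> (x + h) - \<phi> x"
proof -
  have C: "C_times 1 \<phi>" using assms unfolding test_functions_def by blast
  have "(LINT t|lborel. indicator {0..1} t *\<^sub>R (grad \<phi> (x + t *\<^sub>R h) \<bullet> h))
      = \<phi> (x + 1 *\<^sub>R h) - \<phi> (x + 0 *\<^sub>R h)"
  proof (rule integral_FTC_Icc)
    show "continuous_on {0..1} (\<lambda>t. grad \<phi> (x + t *\<^sub>R h) \<bullet> h)"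
      by (intro continuous_intros continuous_on_compose2[OF continuous_grad[OF C]]) auto
    fix t :: real
    have "((\<lambda>t. x + t *\<^sub>R h) has_derivative (\<lambda>s. s *\<^sub>R h)) (at t within {0..1})"
      by (auto intro!: derivative_eq_intros)
    from has_derivative_compose[OF this C_times_has_derivative_grad[of 0 \<phi>]]
    show "((\<lambda>t. \<phi> (x + t *\<^sub>R h)) has_vector_derivative grad \<phi> (x + t *\<^sub>R h) \<bullet> h) (at t within {0..1})"
      using C by (simp add: has_vector_derivative_def)
  qed simp
  then show ?thesis by simp
qed

text \<open>The fundamental theorem of calculus acts on the smooth kernel \<phi> alone, and Fubini
  then moves the integral along the segment outside. All regularity is thus taken from \<phi> and
  none from \<open>W\<close>.\<close>

lemma convolution_difference:
  fixes W :: "real^'n \<Rightarrow> real"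
  assumes W: "integrable lborel W" and \<phi>: "\<phi> \<in> test_functions \<Omega>"
  shows "(LINT y|lborel. W y * (\<phi> (x + h - y) - \<phi> (x - y)))
    = (LINT t|lborel. indicator {0..1} t * (LINT y|lborel. W y * (grad \<phi> (x + t *\<^sub>R h - y) \<bullet> h)))"
proof -
  obtain B where B: "0 < B" "\<And>x. norm (grad \<phi> x) \<le> B" "\<And>x. \<bar>\<phi> x\<bar> \<le> B"
    using test_function_grad_bounded[OF \<phi>] by blast
  have C: "C_times 1 \<phi>" using \<phi> unfolding test_functions_def by blast
  have [measurable]: "W \<in> borel_measurable borel" "grad \<phi> \<in> borel_measurable borel"
    using W continuous_grad[OF C] by (auto intro: borel_measurable_continuous_onI)
  let ?F = "\<lambda>t y. indicator {0..1} t * (W y * (grad \<phi> (x + t *\<^sub>R h - y) \<bullet> h))"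
  have bd: "\<bar>W y * (grad \<phi> z \<bullet> h)\<bar> \<le> (B * norm h) * norm (W y)" for y z
  proof -
    have "\<bar>grad \<phi> z \<bullet> h\<bar> \<le> B * norm h"
      using Cauchy_Schwarz_ineq2 B(2) by (meson mult_right_mono norm_ge_zero order_trans)
    then show ?thesis by (simp add: abs_mult mult.commute[of _ "\<bar>W y\<bar>"] mult_left_mono)
  qed
  have iy: "integrable lborel (\<lambda>y. W y * (grad \<phi> (z - y) \<bullet> h))" for z
    by (rule Bochner_Integration.integrable_bound[where f = "\<lambda>y. (B * norm h) * norm (W y)"])
      (use W B bd in auto)
  have "integrable (lborel \<Otimes>\<^sub>M lborel) (\<lambda>(t, y). ?F t y)"
  proof (rule lborel_pair.Fubini_integrable)
    have "integrable lborel (\<lambda>t. indicator {0..1::real} t * ((B * norm h) * (LINT y|lborel. norm (W y))))"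
      by (intro integrable_mult_left integrable_real_indicator) auto
    then show "integrable lborel (\<lambda>t. LINT y|lborel. norm (case (t, y) of (t, y) \<Rightarrow> ?F t y))"
    proof (rule Bochner_Integration.integrable_bound)
      have "(LINT y|lborel. norm (?F t y)) \<le> indicator {0..1} t * ((B * norm h) * (LINT y|lborel. norm (W y)))" for t
      proof -
        have "(LINT y|lborel. norm (W y * (grad \<phi> (x + t *\<^sub>R h - y) \<bullet> h))) \<le> (LINT y|lborel. (B * norm h) * norm (W y))"
          using iy bd W by (intro integral_mono integrable_norm) auto
        then show ?thesis by (simp add: abs_mult mult_left_mono)
      qed
      then show "AE t in lborel. norm (LINT y|lborel. norm (case (t, y) of (t, y) \<Rightarrow> ?F t y))
          \<le> norm (indicator {0..1} t * ((B * norm h) * (LINT y|lborel. norm (W y))))"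
        by (intro AE_I2) (auto intro: order_trans[OF _ abs_ge_self])
    qed measurable
  qed (use iy in auto)
  from lborel_pair.Fubini_integral[OF this]
  have "(LINT t|lborel. LINT y|lborel. ?F t y) = (LINT y|lborel. LINT t|lborel. ?F t y)"
    by simp
  also have "\<dots> = (LINT y|lborel. W y * (\<phi> (x + h - y) - \<phi> (x - y)))"
  proof (intro Bochner_Integration.integral_cong refl)
    fix y :: "real^'n"
    have "(LINT t|lborel. ?F t y) = W y * (LINT t|lborel. indicator {0..1} t * (grad \<phi> ((x - y) + t *\<^sub>R h) \<bullet> h))"
      by (simp add: mult.left_commute[of _ "W y"] algebra_simps flip: integral_mult_right_zero)
    then show "(LINT t|lborel. ?F t y) = W y * (\<phi> (x + h - y) - \<phi> (x - y))"
      unfolding test_function_FTC[OF \<phi>] by (simp add: algebra_simps)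
  qed
  finally show ?thesis by simp
qed

text \<open>The difference of \<phi> and its unit translate in direction \<open>i\<close> integrates
  to 0; by \<open>convolution_difference\<close> the same number is the integral of the partial
  derivative. This is what gives constants the weak gradient 0 in
  \<open>W1p_minus_const\<close>.\<close>

lemma integral_partial_derivative_zero:
  fixes \<phi> :: "real^'n \<Rightarrow> real"
  assumes \<phi>: "\<phi> \<in> test_functions \<Omega>"
  shows "(LINT x|lborel. partial_derivative i \<phi> x) = 0"
proof -
  let ?K = "closure {x. \<phi> x \<noteq> 0}"
  have C: "C_times 0 \<phi>" "C_times 1 \<phi>" and "compact ?K" using \<phi> unfolding test_functions_def by blast+
  have [measurable]: "\<phi> \<in> borel_measurable borel" "grad \<phi> \<in> borel_measurable borel"
    using C continuous_grad[OF C(2)] by (auto intro: borel_measurable_continuous_onI)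
  obtain R where R: "?K \<subseteq> ball 0 R"
    using \<open>compact ?K\<close> bounded_subset_ballD compact_imp_bounded by metis
  \<comment> \<open>an integrable stand-in for the constant 1 near the support of \<open>\<phi>\<close>\<close>
  let ?W = "indicator (ball 0 (R + 1)) :: real^'n \<Rightarrow> real"
  let ?h = "axis i (1::real)"
  have out: "z \<in> ball 0 R" if "\<phi> z \<noteq> 0 \<or> grad \<phi> z \<noteq> 0" for z
    using that R closure_subset[of "{x. \<phi> x \<noteq> 0}"] test_function_grad_zero[OF \<phi>, of z] by blast
  have W: "?W y = 1" if "t *\<^sub>R ?h - y \<in> ball 0 R" "t \<in> {0..1}" for y t
  proof -
    have "norm y \<le> norm (t *\<^sub>R ?h) + norm (t *\<^sub>R ?h - y)"
      using norm_triangle_ineq4[of "t *\<^sub>R ?h" "t *\<^sub>R ?h - y"] by simp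
    also have "\<dots> < 1 + R" using that by (intro add_le_less_mono) auto
    finally show ?thesis by simp
  qed
  have "(LINT y|lborel. ?W y * (\<phi> (0 + ?h - y) - \<phi> (0 - y)))
    = (LINT t|lborel. indicator {0..1} t * (LINT y|lborel. ?W y * (grad \<phi> (0 + t *\<^sub>R ?h - y) \<bullet> ?h)))"
    using emeasure_bounded_finite[of "ball 0 (R + 1)"]
    by (intro convolution_difference[OF _ \<phi>] integrable_real_indicator) auto
  also have "\<dots> = (LINT t|lborel. indicator {0..1::real} t * (LINT x|lborel. partial_derivative i \<phi> x))"
  proof (intro Bochner_Integration.integral_cong refl)
    fix t :: real
    have "(LINT y|lborel. ?W y * (grad \<phi> (0 + t *\<^sub>R ?h - y) \<bullet> ?h)) = (LINT y|lborel. partial_derivative i \<phi> (t *\<^sub>R ?h - y))"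
      if "t \<in> {0..1}"
    proof (intro Bochner_Integration.integral_cong refl)
      fix y
      show "?W y * (grad \<phi> (0 + t *\<^sub>R ?h - y) \<bullet> ?h) = partial_derivative i \<phi> (t *\<^sub>R ?h - y)"
        using out[of "t *\<^sub>R ?h - y"] W[of t y] that by (auto simp: inner_axis grad_def vec_eq_iff)
    qed
    also have "(LINT y|lborel. partial_derivative i \<phi> (t *\<^sub>R ?h - y)) = (LINT x|lborel. partial_derivative i \<phi> x)"
      using C by (intro integral_lborel_reflection borel_measurable_continuous_onI) simp
    finally show "indicator {0..1} t * (LINT y|lborel. ?W y * (grad \<phi> (0 + t *\<^sub>R ?h - y) \<bullet> ?h))
        = indicator {0..1} t * (LINT x|lborel. partial_derivative i \<phi> x)"
      by (auto simp: indicator_def)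
  qed
  also have "\<dots> = (LINT x|lborel. partial_derivative i \<phi> x)" by simp
  finally have "(LINT x|lborel. partial_derivative i \<phi> x) = (LINT y|lborel. ?W y * (\<phi> (0 + ?h - y) - \<phi> (0 - y)))" ..
  also have "\<dots> = (LINT y|lborel. \<phi> (?h - y) - \<phi> (0 - y))"
  proof (intro Bochner_Integration.integral_cong refl)
    fix y :: "real^'n"
    show "?W y * (\<phi> (0 + ?h - y) - \<phi> (0 - y)) = \<phi> (?h - y) - \<phi> (0 - y)"
    proof (cases "?h - y \<in> ball 0 R \<or> 0 - y \<in> ball 0 R")
      case True
      then have "?W y = 1" using W[of 1 y] W[of 0 y] by fastforce
      then show ?thesis by simp
    next
      case False
      then have "\<phi> (?h - y) = 0" "\<phi> (0 - y) = 0" using out by blast+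
      then show ?thesis by simp
    qed
  qed
  also have "\<dots> = (LINT y|lborel. \<phi> (?h - y)) - (LINT y|lborel. \<phi> (0 - y))"
  proof -
    obtain B where "0 < B" "\<And>x. norm (grad \<phi> x) \<le> B" and B: "\<And>x. \<bar>\<phi> x\<bar> \<le> B"
      using test_function_grad_bounded[OF \<phi>] by blast
    have "integrable lborel (\<lambda>y. \<phi> (z - y))" for z
    proof (rule Bochner_Integration.integrable_bound[where f = "\<lambda>y. B * indicator (ball z R) y"])
      show "integrable lborel (\<lambda>y. B * indicator (ball z R) y)"
        using emeasure_bounded_finite[of "ball z R"] by auto
      show "AE y in lborel. norm (\<phi> (z - y)) \<le> norm (B * indicator (ball z R) y)"
      proof (rule AE_I2)
        fix y
        show "norm (\<phi> (z - y)) \<le> norm (B * indicator (ball z R) y)"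
          using out[of "z - y"] order_trans[OF B abs_ge_self, of "z - y"]
          by (cases "\<phi> (z - y) = 0") (auto simp: dist_norm norm_minus_commute)
      qed
    qed measurable
    from Bochner_Integration.integral_diff[OF this this] show ?thesis .
  qed
  also have "\<dots> = 0" by (simp add: integral_lborel_reflection del: diff_0)
  finally show ?thesis .
qed

section \<open>Mollifiers and their convergence in L^1\<close>

definition bump_mass :: "'n::finite itself \<Rightarrow> real \<Rightarrow> real" where
  "bump_mass _ r = (LINT x|lborel. bump r 0 (x :: real^'n))"

text \<open>The kernel is centred at \<open>x\<close> and integrated in \<open>y\<close>, so for
  fixed \<open>x\<close> it is, up to the factor \<open>bump_mass\<close>, the very test function
  \<open>bump r x\<close> that is inserted into the weak gradient identity.\<close>

definition mollify :: "real \<Rightarrow> (real^'n \<Rightarrow> 'b::euclidean_space) \<Rightarrow> real^'n \<Rightarrow> 'b" where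
  "mollify r f x = (LINT y|lborel. (bump r x y / bump_mass TYPE('n) r) *\<^sub>R f y)"

lemma bump_shift: "bump r x y = bump r 0 (x - y)"
  by (simp add: bump_def norm_minus_commute)

lemma bump_measurable [measurable]: "(\<lambda>z :: (real^'n) \<times> (real^'n). bump r (fst z) (snd z)) \<in> borel_measurable (borel \<Otimes>\<^sub>M borel)"
  "bump r (x :: real^'n) \<in> borel_measurable borel"
proof -
  have c: "continuous_on UNIV (flat_exp 0)"
    using DERIV_isCont[OF flat_exp_has_derivative] by (auto simp: continuous_on_eq_continuous_at)
  have "continuous_on UNIV (\<lambda>z :: (real^'n) \<times> (real^'n). bump r (fst z) (snd z))" for r
    unfolding bump_def by (intro continuous_on_compose2[OF c] continuous_intros) auto
  then show "(\<lambda>z :: (real^'n) \<times> (real^'n). bump r (fst z) (snd z)) \<in> borel_measurable (borel \<Otimes>\<^sub>M borel)"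
    by (simp add: borel_prod borel_measurable_continuous_onI)
  from measurable_compose[OF _ this, of "\<lambda>y. (x, y)" borel]
  show "bump r (x :: real^'n) \<in> borel_measurable borel" by simp
qed

lemma bump_le_1: "bump r x y \<le> 1"
  by (auto simp: bump_def flat_exp_def)

lemma bump_integrable:
  assumes "0 < r" shows "integrable lborel (bump r (a :: real^'n))"
proof (rule Bochner_Integration.integrable_bound[where f = "indicator (ball a r) :: _ \<Rightarrow> real"])
  show "integrable lborel (indicator (ball a r) :: _ \<Rightarrow> real)"
    using emeasure_bounded_finite[of "ball a r"] by (intro integrable_real_indicator) auto
  show "AE x in lborel. norm (bump r a x) \<le> norm (indicator (ball a r) x :: real)"
    using bump_pos_iff[OF assms, of a] bump_nonneg[of r a] bump_le_1[of r a]
    by (intro AE_I2) (force simp: indicator_def less_le)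
qed measurable

lemma bump_mass_pos:
  assumes "0 < r" shows "0 < bump_mass TYPE('n::finite) r"
proof -
  let ?b = "bump r (0 :: real^'n)"
  have "bump_mass TYPE('n) r \<noteq> 0"
  proof
    assume "bump_mass TYPE('n) r = 0"
    moreover have "AE x in lborel. 0 \<le> ?b x" by (simp add: bump_nonneg)
    ultimately have "AE x in lborel. ?b x = 0"
      using integral_nonneg_eq_0_iff_AE[OF bump_integrable[OF assms]] unfolding bump_mass_def by blast
    then have "AE x in lborel. x \<notin> ball (0::real^'n) r"
      by eventually_elim (use bump_pos_iff[OF assms, of "0::real^'n"] in force)
    then have "emeasure lborel (ball (0::real^'n) r) = 0"
      by (subst (asm) AE_iff_measurable[OF _ refl]) (auto simp: ball_def)
    moreover have "emeasure lborel (ball (0::real^'n) r) \<noteq> 0"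
    proof -
      have "unit_ball_vol (real CARD('n)) \<noteq> 0"
        using unit_ball_vol_pos[of "real CARD('n)"] by linarith
      then show ?thesis using assms by (simp add: emeasure_ball)
    qed
    ultimately show False by simp
  qed
  moreover have "0 \<le> bump_mass TYPE('n) r"
    unfolding bump_mass_def by (simp add: bump_nonneg)
  ultimately show ?thesis by simp
qed

lemma nn_integral_bump:
  assumes "0 < r"
  shows "(\<integral>\<^sup>+y. ennreal (bump r x y / bump_mass TYPE('n::finite) r) \<partial>(lborel :: (real^'n) measure)) = 1"
proof -
  have "(\<integral>\<^sup>+y. ennreal (bump r x y / bump_mass TYPE('n) r) \<partial>(lborel :: (real^'n) measure))
     = ennreal (LINT y|lborel. bump r x y / bump_mass TYPE('n) r)"
    using bump_integrable[OF assms, of x] bump_mass_pos[OF assms, where 'n = 'n]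
    by (intro nn_integral_eq_integral) (auto simp: bump_nonneg)
  also have "(LINT y|lborel. bump r x y) = bump_mass TYPE('n) r"
    unfolding bump_shift[of r x] bump_mass_def by (rule integral_lborel_reflection) measurable
  ultimately show ?thesis
    using bump_mass_pos[OF assms, where 'n = 'n] by simp
qed

lemma mollify_integrable:
  fixes f :: "real^'n \<Rightarrow> 'b::euclidean_space"
  assumes "0 < r" "integrable lborel f"
  shows "integrable lborel (\<lambda>y. (bump r x y / bump_mass TYPE('n) r) *\<^sub>R f y)"
proof (rule Bochner_Integration.integrable_bound[where f = "\<lambda>y. (1 / bump_mass TYPE('n) r) *\<^sub>R norm (f y)"])
  have [measurable]: "f \<in> borel_measurable borel" using assms(2) by simp
  show "(\<lambda>y. (bump r x y / bump_mass TYPE('n) r) *\<^sub>R f y) \<in> borel_measurable lborel" by measurable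
  show "AE y in lborel. norm ((bump r x y / bump_mass TYPE('n) r) *\<^sub>R f y)
      \<le> norm ((1 / bump_mass TYPE('n) r) *\<^sub>R norm (f y))"
    using bump_mass_pos[OF assms(1), where 'n = 'n] bump_nonneg[of r x] bump_le_1[of r x]
    by (intro AE_I2) (auto simp: abs_mult divide_simps mult_left_le_one_le)
qed (use assms in auto)

lemma mollify_measurable [measurable]:
  fixes f :: "real^'n \<Rightarrow> 'b::euclidean_space"
  assumes [measurable]: "f \<in> borel_measurable borel"
  shows "mollify r f \<in> borel_measurable borel"
  unfolding mollify_def[abs_def] by measurable

text \<open>\<open>mollify r f x - f x\<close> is the mean of \<open>f (x - z) - f x\<close> against
  the kernel in \<open>z\<close>, which lives on \<open>norm z < r\<close>. Tonelli puts the
  integral over \<open>x\<close> inside, where \<open>e\<close> bounds it for each such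
  \<open>z\<close>.\<close>

lemma mollify_L1:
  fixes f :: "real^'n \<Rightarrow> 'b::euclidean_space"
  assumes r: "0 < r" and f: "integrable lborel f"
    and e: "\<And>z. norm z < r \<Longrightarrow> (\<integral>\<^sup>+x. norm (f (x - z) - f x) \<partial>lborel) \<le> ennreal e"
  shows "(\<integral>\<^sup>+x. norm (mollify r f x - f x) \<partial>lborel) \<le> ennreal e"
proof -
  have [measurable]: "f \<in> borel_measurable borel" using f by simp
  let ?\<rho> = "\<lambda>x y :: real^'n. bump r x y / bump_mass TYPE('n) r"
  have \<rho>: "0 \<le> ?\<rho> x y" for x y
    using bump_mass_pos[OF r, where 'n = 'n] by (simp add: bump_nonneg)
  have i: "integrable lborel (?\<rho> x)" for x
    unfolding divide_inverse by (intro integrable_mult_left bump_integrable[OF r])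
  have "norm (mollify r f x - f x) \<le> (\<integral>\<^sup>+z. ennreal (?\<rho> 0 z * norm (f (x - z) - f x)) \<partial>lborel)" for x
  proof -
    have "ennreal (LINT y|lborel. ?\<rho> x y) = 1"
      using nn_integral_bump[OF r, of x] nn_integral_eq_integral[OF i AE_I2[OF \<rho>], of x] by simp
    then have "(LINT y|lborel. ?\<rho> x y) = 1" by (simp add: ennreal_eq_1)
    then have "f x = (LINT y|lborel. ?\<rho> x y *\<^sub>R f x)"
      using i by simp
    then have "mollify r f x - f x = (LINT y|lborel. ?\<rho> x y *\<^sub>R f y - ?\<rho> x y *\<^sub>R f x)"
      unfolding mollify_def using i mollify_integrable[OF r f]
      by (subst Bochner_Integration.integral_diff) auto
    also have "norm \<dots> \<le> (\<integral>\<^sup>+y. norm (?\<rho> x y *\<^sub>R f y - ?\<rho> x y *\<^sub>R f x) \<partial>lborel)"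
      using i mollify_integrable[OF r f]
      by (intro integral_norm_bound_ennreal Bochner_Integration.integrable_diff) auto
    also have "\<dots> = (\<integral>\<^sup>+y. ennreal (?\<rho> 0 (x - y) * norm (f (x - (x - y)) - f x)) \<partial>lborel)"
    proof (intro nn_integral_cong arg_cong[where f = ennreal])
      fix y
      show "norm (?\<rho> x y *\<^sub>R f y - ?\<rho> x y *\<^sub>R f x) = ?\<rho> 0 (x - y) * norm (f (x - (x - y)) - f x)"
        unfolding scaleR_diff_right[symmetric] norm_scaleR using bump_mass_pos[OF r, where 'n = 'n]
        by (simp add: bump_shift[of r x] bump_nonneg)
    qed
    also have "\<dots> = (\<integral>\<^sup>+z. ennreal (?\<rho> 0 z * norm (f (x - z) - f x)) \<partial>lborel)"
      by (rule nn_integral_lborel_reflection[where f = "\<lambda>z. ennreal (?\<rho> 0 z * norm (f (x - z) - f x))"]) measurable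
    finally show ?thesis .
  qed
  then have "(\<integral>\<^sup>+x. norm (mollify r f x - f x) \<partial>lborel)
      \<le> (\<integral>\<^sup>+x. \<integral>\<^sup>+z. ennreal (?\<rho> 0 z * norm (f (x - z) - f x)) \<partial>lborel \<partial>lborel)"
    by (intro nn_integral_mono)
  also have "\<dots> = (\<integral>\<^sup>+z. \<integral>\<^sup>+x. ennreal (?\<rho> 0 z * norm (f (x - z) - f x)) \<partial>lborel \<partial>lborel)"
    by (rule lborel_pair.Fubini') measurable
  also have "\<dots> = (\<integral>\<^sup>+z. ennreal (?\<rho> 0 z) * (\<integral>\<^sup>+x. norm (f (x - z) - f x) \<partial>lborel) \<partial>lborel)"
    using \<rho> by (simp only: ennreal_mult norm_ge_zero) (simp add: nn_integral_cmult)
  also have "\<dots> \<le> (\<integral>\<^sup>+z. ennreal (?\<rho> 0 z) * ennreal e \<partial>lborel)"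
  proof (intro nn_integral_mono)
    fix z :: "real^'n"
    show "ennreal (?\<rho> 0 z) * (\<integral>\<^sup>+x. norm (f (x - z) - f x) \<partial>lborel) \<le> ennreal (?\<rho> 0 z) * ennreal e"
    proof (cases "norm z < r")
      case True
      then show ?thesis by (intro mult_left_mono e) auto
    next
      case False
      then have "bump r 0 z = 0"
        using bump_pos_iff[OF r, of 0 z] bump_nonneg[of r 0 z] by auto
      then show ?thesis by simp
    qed
  qed
  also have "\<dots> = ennreal e"
    using nn_integral_bump[OF r, of "0 :: real^'n"] by (simp add: nn_integral_multc)
  finally show ?thesis .
qed

lemma mollify_L1_tendsto:
  fixes f :: "real^'n \<Rightarrow> 'b::euclidean_space"
  assumes f: "integrable lborel f"
  shows "(\<lambda>k. \<integral>\<^sup>+x. norm (mollify (1 / real (Suc k)) f x - f x) \<partial>lborel) \<longlonglongrightarrow> 0"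
proof (rule tendsto_zero_ennreal)
  fix e :: real assume "0 < e"
  then have "0 < e / 2" by simp
  from continuous_translation_L1[OF f this] obtain d where d: "d > 0"
    "\<And>z. norm z < d \<Longrightarrow> (\<integral>\<^sup>+x. norm (f (x - z) - f x) \<partial>lborel) \<le> ennreal (e / 2)" by blast
  have "\<forall>\<^sub>F k in sequentially. 1 / real (Suc k) < d"
    using order_tendstoD(2)[OF LIMSEQ_inverse_real_of_nat d(1)] by (simp add: divide_inverse)
  then show "\<forall>\<^sub>F k in sequentially. (\<integral>\<^sup>+x. norm (mollify (1 / real (Suc k)) f x - f x) \<partial>lborel) < ennreal e"
      proof eventually_elim
    case (elim k)
    have "(\<integral>\<^sup>+x. norm (mollify (1 / real (Suc k)) f x - f x) \<partial>lborel) \<le> ennreal (e / 2)"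
      using elim d(2) by (intro mollify_L1[OF _ f]) auto
    also have "\<dots> < ennreal e" using \<open>0 < e\<close> by (simp add: ennreal_less_iff)
    finally show ?case .
  qed
qed

text \<open>As long as the ball of radius \<open>r\<close> around each point of the segment lies in
  \<Omega>, the kernel is a test function there, so the gradient of the mollified \<open>W\<close>
  is the mollified \<open>D\<close> and the fundamental theorem of calculus applies. The bound is a
  nonnegative integral, hence meaningful without integrability along the segment.\<close>

lemma mollify_difference:
  fixes W :: "real^'n \<Rightarrow> real" and D :: "real^'n \<Rightarrow> real^'n"
  assumes r: "0 < r" and W: "integrable lborel W" and D: "integrable lborel D"
    and weak: "\<And>\<phi> i. \<phi> \<in> test_functions \<Omega> \<Longrightarrow>
      (LINT x|lborel. W x * partial_derivative i \<phi> x) = - (LINT x|lborel. D x $ i * \<phi> x)"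
    and seg: "\<And>t. t \<in> {0..1} \<Longrightarrow> cball (x + t *\<^sub>R h) r \<subseteq> \<Omega>"
  shows "ennreal \<bar>mollify r W (x + h) - mollify r W x\<bar>
    \<le> (\<integral>\<^sup>+t. indicator {0..1} t * ennreal (norm (mollify r D (x + t *\<^sub>R h)) * norm h) \<partial>lborel)"
proof -
  let ?Z = "bump_mass TYPE('n) r" and ?\<phi> = "bump r (0 :: real^'n)"
  have Z: "0 < ?Z" by (rule bump_mass_pos[OF r])
  have \<phi>: "?\<phi> \<in> test_functions UNIV" by (rule bump_test_function[OF r]) simp
  have der: "grad (bump r z) y = - grad ?\<phi> (z - y)" for z y
  proof -
    have "C_times (Suc 0) ?\<phi>" using \<phi> unfolding test_functions_def by blast
    have "((\<lambda>y. z - y) has_derivative uminus) (at y)"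
      by (auto intro!: derivative_eq_intros)
    from has_derivative_compose[OF this C_times_has_derivative_grad[OF \<open>C_times (Suc 0) ?\<phi>\<close>]]
    have "(bump r z has_derivative (\<lambda>h. - (grad ?\<phi> (z - y) \<bullet> h))) (at y)"
      unfolding bump_shift[of r z, abs_def] by simp
    from partial_derivativeI[OF this] show ?thesis
      by (simp add: grad_def vec_eq_iff inner_axis)
  qed
  \<comment> \<open>Integration by parts, component by component, with the test function
    \<open>bump r z\<close>. The minus sign of \<open>der\<close> cancels the one in
    \<open>weak\<close>, and \<open>?Z\<close> undoes the normalisation of
    \<open>mollify\<close>.\<close>
  have inner: "(LINT y|lborel. W y * (grad ?\<phi> (z - y) \<bullet> h)) = ?Z * (mollify r D z \<bullet> h)" if "cball z r \<subseteq> \<Omega>" for z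
  proof -
    have b: "bump r z \<in> test_functions \<Omega>" by (rule bump_test_function[OF r that])
    have C: "C_times 1 ?\<phi>" using \<phi> unfolding test_functions_def by blast
    obtain B where "0 < B" and B: "\<And>x. norm (grad ?\<phi> x) \<le> B" using test_function_grad_bounded[OF \<phi>] by blast
    have [measurable]: "W \<in> borel_measurable borel" "grad ?\<phi> \<in> borel_measurable borel"
      using W continuous_grad[OF C] by (auto intro: borel_measurable_continuous_onI)
    have iW: "integrable lborel (\<lambda>y. W y * (grad ?\<phi> (z - y) \<bullet> v))" for v
    proof (rule Bochner_Integration.integrable_bound[where f = "\<lambda>y. norm (W y) * (B * norm v)"])
      show "AE y in lborel. norm (W y * (grad ?\<phi> (z - y) \<bullet> v)) \<le> norm (norm (W y) * (B * norm v))"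
      proof (rule AE_I2)
        fix y
        have "\<bar>grad ?\<phi> (z - y) \<bullet> v\<bar> \<le> B * norm v"
          using Cauchy_Schwarz_ineq2 B by (meson mult_right_mono norm_ge_zero order_trans)
        then show "norm (W y * (grad ?\<phi> (z - y) \<bullet> v)) \<le> norm (norm (W y) * (B * norm v))"
          using \<open>0 < B\<close> by (simp add: abs_mult mult_left_mono)
      qed
    qed (use W in auto)
    have iD: "integrable lborel (\<lambda>y. bump r z y *\<^sub>R D y)"
      using integrable_scaleR_right[OF mollify_integrable[OF r D, of z], of ?Z] Z by simp
    have "(LINT y|lborel. W y * (grad ?\<phi> (z - y) \<bullet> h))
        = (LINT y|lborel. (\<Sum>i\<in>UNIV. h $ i * (W y * (grad ?\<phi> (z - y) \<bullet> axis i 1))))"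
      by (simp only: inner_axis) (simp add: inner_vec_def sum_distrib_left mult_ac)
    also have "\<dots> = (\<Sum>i\<in>UNIV. h $ i * (LINT y|lborel. W y * (grad ?\<phi> (z - y) \<bullet> axis i 1)))"
      using iW by (subst Bochner_Integration.integral_sum) auto
    also have "\<dots> = (\<Sum>i\<in>UNIV. h $ i * (LINT y|lborel. (bump r z y *\<^sub>R D y) $ i))"
    proof (intro sum.cong refl arg_cong2[where f = "(*)"])
      fix i
      have "W y * (grad ?\<phi> (z - y) \<bullet> axis i 1) = - (W y * partial_derivative i (bump r z) y)" for y
      proof -
        have "grad (bump r z) y $ i = - grad ?\<phi> (z - y) $ i" using der[of z y] by simp
        then have "partial_derivative i (bump r z) y = - grad ?\<phi> (z - y) $ i" by (simp add: grad_def)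
        then show ?thesis by (simp add: inner_axis)
      qed
      then show "(LINT y|lborel. W y * (grad ?\<phi> (z - y) \<bullet> axis i 1)) = (LINT y|lborel. (bump r z y *\<^sub>R D y) $ i)"
        using weak[OF b, of i] by (simp add: mult.commute)
    qed
    also have "\<dots> = (\<Sum>i\<in>UNIV. h $ i * (LINT y|lborel. bump r z y *\<^sub>R D y) $ i)"
      using integral_bounded_linear[OF bounded_linear_vec_nth iD] by simp
    also have "\<dots> = (LINT y|lborel. bump r z y *\<^sub>R D y) \<bullet> h"
      by (simp add: inner_vec_def mult.commute)
    also have "(LINT y|lborel. bump r z y *\<^sub>R D y) = (LINT y|lborel. ?Z *\<^sub>R ((bump r z y / ?Z) *\<^sub>R D y))"
      using Z by simp
    also have "\<dots> = ?Z *\<^sub>R mollify r D z" unfolding mollify_def by (rule integral_scaleR_right)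
    finally show ?thesis by simp
  qed
  have iW: "integrable lborel (\<lambda>y. bump r z y * W y)" for z
    using integrable_mult_right[OF mollify_integrable[OF r W, of z], of ?Z] Z by simp
  have mW: "?Z * mollify r W z = (LINT y|lborel. W y * ?\<phi> (z - y))" for z
    unfolding mollify_def integral_mult_right_zero[symmetric] using Z
    by (intro Bochner_Integration.integral_cong refl) (simp add: bump_shift[of r z])
  have "?Z * (mollify r W (x + h) - mollify r W x) = (LINT y|lborel. W y * (?\<phi> (x + h - y) - ?\<phi> (x - y)))"
    using iW unfolding right_diff_distrib mW
    by (subst Bochner_Integration.integral_diff) (simp_all add: bump_shift[symmetric] mult.commute)
  also have "\<dots> = (LINT t|lborel. indicator {0..1} t * (LINT y|lborel. W y * (grad ?\<phi> (x + t *\<^sub>R h - y) \<bullet> h)))"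
    by (rule convolution_difference[OF W \<phi>])
  also have "\<dots> = (LINT t|lborel. ?Z * (indicator {0..1} t * (mollify r D (x + t *\<^sub>R h) \<bullet> h)))"
    by (intro Bochner_Integration.integral_cong refl) (auto simp: indicator_def inner seg)
  also have "\<dots> = ?Z * (LINT t|lborel. indicator {0..1} t * (mollify r D (x + t *\<^sub>R h) \<bullet> h))"
    by (rule integral_mult_right_zero)
  finally have eq: "mollify r W (x + h) - mollify r W x = (LINT t|lborel. indicator {0..1} t * (mollify r D (x + t *\<^sub>R h) \<bullet> h))"
    using Z by simp
  have "ennreal \<bar>mollify r W (x + h) - mollify r W x\<bar>
      \<le> (\<integral>\<^sup>+t. ennreal \<bar>indicator {0..1} t * (mollify r D (x + t *\<^sub>R h) \<bullet> h)\<bar> \<partial>lborel)"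
  proof (cases "integrable lborel (\<lambda>t. indicator {0..1} t * (mollify r D (x + t *\<^sub>R h) \<bullet> h))")
    case True
    from integral_norm_bound_ennreal[OF this] show ?thesis unfolding eq by simp
  next
    \<comment> \<open>The Bochner integral of a non-integrable function is 0, so the left side
      vanishes here.\<close>
    case False
    then show ?thesis unfolding eq by (simp add: not_integrable_integral_eq)
  qed
  also have "\<dots> \<le> (\<integral>\<^sup>+t. indicator {0..1} t * ennreal (norm (mollify r D (x + t *\<^sub>R h)) * norm h) \<partial>lborel)"
    by (intro nn_integral_mono) (auto simp: indicator_def Cauchy_Schwarz_ineq2 ennreal_leI)
  finally show ?thesis .
qed

section \<open>Lebesgue norms\<close>

text \<open>A bound for the norm rather than the norm itself: upper bounds on nonnegative integrals
  can be chained without proving integrability or computing an essential supremum. The translation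
  to and from \<open>mem_Lp\<close> and \<open>Lp_norm\<close> is made only at the ends of an
  argument.\<close>

definition Lp_le :: "ennreal \<Rightarrow> 'a measure \<Rightarrow> ('a \<Rightarrow> real) \<Rightarrow> real \<Rightarrow> bool" where
  "Lp_le p M f C \<longleftrightarrow> f \<in> borel_measurable M \<and> 0 \<le> C \<and>
     (if p = \<infinity> then AE x in M. \<bar>f x\<bar> \<le> C
      else (\<integral>\<^sup>+x. ennreal (\<bar>f x\<bar> powr enn2real p) \<partial>M) \<le> ennreal (C powr enn2real p))"

lemma enn2real_ge_1: "1 \<le> p \<Longrightarrow> p \<noteq> \<infinity> \<Longrightarrow> 1 \<le> enn2real p"
  by (cases p) (auto simp: top_ennreal_def[symmetric])

lemma Lp_le_mono:
  assumes "Lp_le p M f C" "g \<in> borel_measurable M" "AE x in M. \<bar>g x\<bar> \<le> \<bar>f x\<bar>" "C \<le> C'"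
  shows "Lp_le p M g C'"
proof (cases "p = \<infinity>")
  case True
  then have "AE x in M. \<bar>f x\<bar> \<le> C" using assms by (simp add: Lp_le_def)
  with assms(3) have "AE x in M. \<bar>g x\<bar> \<le> C'" by eventually_elim (use assms(4) in auto)
  then show ?thesis using assms True by (auto simp: Lp_le_def)
next
  case False
  have "(\<integral>\<^sup>+x. ennreal (\<bar>g x\<bar> powr enn2real p) \<partial>M) \<le> (\<integral>\<^sup>+x. ennreal (\<bar>f x\<bar> powr enn2real p) \<partial>M)"
    using assms(3) by (intro nn_integral_mono_AE, eventually_elim) (auto intro!: ennreal_leI powr_mono2)
  also have "\<dots> \<le> ennreal (C powr enn2real p)" using assms False by (simp add: Lp_le_def)
  also have "\<dots> \<le> ennreal (C' powr enn2real p)"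
    using assms by (intro ennreal_leI powr_mono2) (auto simp: Lp_le_def)
  finally show ?thesis using assms False by (auto simp: Lp_le_def)
qed

lemma Lp_le_scale:
  assumes "Lp_le p M f C" "0 \<le> c" shows "Lp_le p M (\<lambda>x. c * f x) (c * C)"
proof (cases "p = \<infinity>")
  case True
  then have "AE x in M. \<bar>f x\<bar> \<le> C" using assms by (simp add: Lp_le_def)
  then have "AE x in M. \<bar>c * f x\<bar> \<le> c * C"
    by eventually_elim (use assms in \<open>auto simp: abs_mult mult_left_mono\<close>)
  then show ?thesis using assms True by (auto simp: Lp_le_def)
next
  case False
  have [measurable]: "f \<in> borel_measurable M" using assms by (simp add: Lp_le_def)
  have "(\<integral>\<^sup>+x. ennreal (\<bar>c * f x\<bar> powr enn2real p) \<partial>M)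
      = ennreal (c powr enn2real p) * (\<integral>\<^sup>+x. ennreal (\<bar>f x\<bar> powr enn2real p) \<partial>M)"
    using assms(2) by (simp add: abs_mult powr_mult ennreal_mult nn_integral_cmult)
  also have "\<dots> \<le> ennreal (c powr enn2real p) * ennreal (C powr enn2real p)"
    using assms False by (intro mult_left_mono) (auto simp: Lp_le_def)
  also have "\<dots> = ennreal ((c * C) powr enn2real p)"
    using assms by (simp add: ennreal_mult powr_mult Lp_le_def)
  finally show ?thesis using assms False by (auto simp: Lp_le_def)
qed

text \<open>Convexity of the power function; when one argument is 0 it reduces to t^P <= t on
  [0,1].\<close>

lemma powr_weighted_sum_le:
  fixes P :: real
  assumes "1 \<le> P" "0 \<le> \<theta>" "\<theta> \<le> 1" "0 \<le> x" "0 \<le> y"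
  shows "((1 - \<theta>) * x + \<theta> * y) powr P \<le> (1 - \<theta>) * x powr P + \<theta> * y powr P"
proof -
  have le: "t powr P \<le> t" if "0 \<le> t" "t \<le> 1" for t :: real
    using that assms(1) powr_mono'[of 1 P t] by (cases "t = 0") auto
  consider "x = 0" | "y = 0" | "0 < x" "0 < y" using assms by linarith
  then show ?thesis
  proof cases
    case 1
    then show ?thesis using assms le[of \<theta>] by (simp add: powr_mult mult_right_mono)
  next
    case 2
    then show ?thesis using assms le[of "1 - \<theta>"] by (simp add: powr_mult mult_right_mono)
  next
    case 3
    then show ?thesis using convex_onD[OF powr_convex[OF assms(1)], of \<theta> x y] assms by simp
  qed
qed

text \<open>Minkowski's inequality. For positive \<open>a'\<close> and \<open>b'\<close> above
  \<open>a\<close> and \<open>b\<close>, |f| + |g| is a' + b' times the convex combination of |f|/a'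
  and |g|/b' with weights proportional to \<open>a'\<close> and \<open>b'\<close>; convexity of the
  power then bounds the integral by (a' + b')^P.\<close>

lemma Lp_le_add:
  assumes "1 \<le> p" and f: "Lp_le p M f a" and g: "Lp_le p M g b"
  shows "Lp_le p M (\<lambda>x. f x + g x) (a + b)"
proof (cases "p = \<infinity>")
  case True
  then have "AE x in M. \<bar>f x\<bar> \<le> a" "AE x in M. \<bar>g x\<bar> \<le> b" using f g by (simp_all add: Lp_le_def)
  then have "AE x in M. \<bar>f x + g x\<bar> \<le> a + b" by eventually_elim linarith
  then show ?thesis using f g True by (auto simp: Lp_le_def)
next
  case False
  define P where "P = enn2real p"
  have P: "1 \<le> P" using enn2real_ge_1 assms False by (simp add: P_def)
  have [measurable]: "f \<in> borel_measurable M" "g \<in> borel_measurable M" using f g by (auto simp: Lp_le_def)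
  have fa: "(\<integral>\<^sup>+x. ennreal (\<bar>f x\<bar> powr P) \<partial>M) \<le> ennreal (a powr P)"
    and gb: "(\<integral>\<^sup>+x. ennreal (\<bar>g x\<bar> powr P) \<partial>M) \<le> ennreal (b powr P)" and ab: "0 \<le> a" "0 \<le> b"
    using f g False by (auto simp: Lp_le_def P_def)
  have *: "(\<integral>\<^sup>+x. ennreal (\<bar>f x + g x\<bar> powr P) \<partial>M) \<le> ennreal ((a' + b') powr P)"
    if ab': "0 < a'" "a \<le> a'" "0 < b'" "b \<le> b'" for a' b'
  proof -
    define \<theta> where "\<theta> = b' / (a' + b')"
    have \<theta>: "0 \<le> \<theta>" "\<theta> \<le> 1" "(1 - \<theta>) = a' / (a' + b')" using ab' by (auto simp: \<theta>_def field_simps)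
    define c where "c = (a' + b') powr P"
    have pt: "ennreal (\<bar>f x + g x\<bar> powr P) \<le> ennreal (c * (1 - \<theta>) / a' powr P) * ennreal (\<bar>f x\<bar> powr P)
        + ennreal (c * \<theta> / b' powr P) * ennreal (\<bar>g x\<bar> powr P)" for x
    proof -
      have "\<bar>f x + g x\<bar> powr P \<le> ((a' + b') * ((1 - \<theta>) * (\<bar>f x\<bar> / a') + \<theta> * (\<bar>g x\<bar> / b'))) powr P"
      proof -
        have "(a' + b') * ((1 - \<theta>) * (\<bar>f x\<bar> / a') + \<theta> * (\<bar>g x\<bar> / b')) = \<bar>f x\<bar> + \<bar>g x\<bar>"
          using ab' unfolding \<theta>(3) unfolding \<theta>_def by (simp add: distrib_left)
        then show ?thesis using P by (intro powr_mono2) auto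
      qed
      also have "\<dots> \<le> c * ((1 - \<theta>) * (\<bar>f x\<bar> / a') powr P + \<theta> * (\<bar>g x\<bar> / b') powr P)"
        using ab' \<theta> P powr_weighted_sum_le[OF P \<theta>(1,2), of "\<bar>f x\<bar> / a'" "\<bar>g x\<bar> / b'"]
        by (subst powr_mult) (auto simp: c_def intro!: mult_left_mono)
      also have "\<dots> = c * (1 - \<theta>) / a' powr P * \<bar>f x\<bar> powr P + c * \<theta> / b' powr P * \<bar>g x\<bar> powr P"
        using ab' by (simp add: powr_divide algebra_simps)
      finally show ?thesis
        using \<theta> ab' by (simp add: c_def ennreal_leI flip: ennreal_mult ennreal_plus)
    qed
    have "(\<integral>\<^sup>+x. ennreal (\<bar>f x + g x\<bar> powr P) \<partial>M)
        \<le> ennreal (c * (1 - \<theta>) / a' powr P) * (\<integral>\<^sup>+x. ennreal (\<bar>f x\<bar> powr P) \<partial>M)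
        + ennreal (c * \<theta> / b' powr P) * (\<integral>\<^sup>+x. ennreal (\<bar>g x\<bar> powr P) \<partial>M)"
    proof -
      define k1 k2 where "k1 = ennreal (c * (1 - \<theta>) / a' powr P)" and "k2 = ennreal (c * \<theta> / b' powr P)"
      have "(\<integral>\<^sup>+x. ennreal (\<bar>f x + g x\<bar> powr P) \<partial>M)
          \<le> (\<integral>\<^sup>+x. k1 * ennreal (\<bar>f x\<bar> powr P) + k2 * ennreal (\<bar>g x\<bar> powr P) \<partial>M)"
        unfolding k1_def k2_def by (rule nn_integral_mono) (rule pt)
      also have "\<dots> = k1 * (\<integral>\<^sup>+x. ennreal (\<bar>f x\<bar> powr P) \<partial>M) + k2 * (\<integral>\<^sup>+x. ennreal (\<bar>g x\<bar> powr P) \<partial>M)"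
        by (simp add: nn_integral_add nn_integral_cmult)
      finally show ?thesis unfolding k1_def k2_def .
    qed
    also have "\<dots> \<le> ennreal (c * (1 - \<theta>) / a' powr P) * ennreal (a' powr P) + ennreal (c * \<theta> / b' powr P) * ennreal (b' powr P)"
      using ab ab' P
      by (intro add_mono mult_left_mono order_trans[OF fa] order_trans[OF gb] ennreal_leI powr_mono2) auto
    also have "\<dots> = ennreal c"
    proof -
      have e: "ennreal (x / s) * ennreal s = ennreal x" if "0 < s" "0 \<le> x" for x s :: real
        using that by (subst ennreal_mult[symmetric]) auto
      have c: "0 \<le> c * (1 - \<theta>)" "0 \<le> c * \<theta>" using \<theta>(1,2) by (simp_all add: c_def)
      have "0 < a' powr P" "0 < b' powr P" using ab' by simp_all
      note e[OF this(1) c(1)] e[OF this(2) c(2)]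
      then show ?thesis
        using ennreal_plus[OF c] by (simp only: right_diff_distrib mult_1_right diff_add_cancel)
    qed
    finally show ?thesis by (simp add: c_def)
  qed
  \<comment> \<open>The bounds \<open>a\<close> and \<open>b\<close> may be 0, so both are enlarged
    by \<open>e\<close>, which then tends to 0 from the right.\<close>
  have "((\<lambda>e. ennreal ((a + e + (b + e)) powr P)) \<longlongrightarrow> ennreal ((a + 0 + (b + 0)) powr P)) (at_right 0)"
    using P ab by (intro tendsto_ennrealI tendsto_powr' tendsto_intros)
      (auto intro!: eventually_mono[OF eventually_at_right_less])
  moreover have "\<forall>\<^sub>F e in at_right 0. (\<integral>\<^sup>+x. ennreal (\<bar>f x + g x\<bar> powr P) \<partial>M) \<le> ennreal ((a + e + (b + e)) powr P)"
    using ab by (intro eventually_mono[OF eventually_at_right_less] *) auto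
  ultimately have "(\<integral>\<^sup>+x. ennreal (\<bar>f x + g x\<bar> powr P) \<partial>M) \<le> ennreal ((a + b) powr P)"
    by (intro tendsto_lowerbound[where F = "at_right (0::real)"]) auto
  then show ?thesis using f g False by (auto simp: Lp_le_def P_def)
qed

lemma Lp_le_const:
  assumes "1 \<le> p" "finite_measure M"
  shows "Lp_le p M (\<lambda>_. c) (\<bar>c\<bar> * root_factor p (measure M (space M)))"
proof (cases "p = \<infinity>")
  case False
  interpret finite_measure M by fact
  have "1 \<le> enn2real p" using enn2real_ge_1 assms False by simp
  then show ?thesis using False
    by (simp add: Lp_le_def root_factor_def emeasure_eq_measure powr_mult powr_powr flip: ennreal_mult)
qed (simp add: Lp_le_def root_factor_def)

text \<open>The tangent of t^P at \<open>s\<close>, solved for \<open>g\<close>. It bounds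
  \<open>g\<close> by an affine function of g^P, with \<open>s\<close> left free for optimisation;
  the proof obtains it from Young's inequality.\<close>

lemma tangent_powr_le:
  fixes P :: real
  assumes "1 \<le> P" "0 \<le> g" "0 < s"
  shows "g \<le> (1 - 1 / P) * s + g powr P * s powr (1 - P) / P"
proof (cases "g = 0")
  case False
  have "s powr (1 - 1 / P) * (g powr P * s powr (1 - P)) powr (1 / P)
      \<le> (1 - 1 / P) * s + (1 / P) * (g powr P * s powr (1 - P))"
    using assms False by (intro Youngs_inequality_0) auto
  also have "(g powr P * s powr (1 - P)) powr (1 / P) = g * s powr ((1 - P) / P)"
    using assms False by (simp add: powr_mult powr_powr)
  also have "s powr (1 - 1 / P) * (g * s powr ((1 - P) / P)) = g * (s powr (1 - 1 / P + (1 - P) / P))"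
    by (simp add: powr_add)
  also have "1 - 1 / P + (1 - P) / P = 0" using assms by (simp add: field_simps)
  finally show ?thesis using assms by simp
qed (use assms in auto)

text \<open>Integrating \<open>tangent_powr_le\<close> for every \<open>s\<close> linearises the
  problem, and the best \<open>s\<close> is the power mean of \<open>g\<close>. Finiteness is a
  separate conclusion because \<open>enn2real\<close> sends an infinite integral to 0.\<close>

lemma nn_integral_Jensen_powr:
  fixes P :: real and g :: "'a \<Rightarrow> real"
  assumes P: "1 \<le> P" and [measurable]: "g \<in> borel_measurable M" and g: "\<And>x. 0 \<le> g x"
    and m: "emeasure M (space M) = ennreal m" "0 < m"
    and fin: "(\<integral>\<^sup>+x. ennreal (g x powr P) \<partial>M) < \<infinity>"
  shows "(\<integral>\<^sup>+x. ennreal (g x) \<partial>M) < \<infinity>"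
    and "ennreal (enn2real (\<integral>\<^sup>+x. ennreal (g x) \<partial>M) powr P) \<le> ennreal (m powr (P - 1)) * (\<integral>\<^sup>+x. ennreal (g x powr P) \<partial>M)"
proof -
  define Q where "Q = enn2real (\<integral>\<^sup>+x. ennreal (g x powr P) \<partial>M)"
  have Q: "(\<integral>\<^sup>+x. ennreal (g x powr P) \<partial>M) = ennreal Q" "0 \<le> Q"
    using fin by (auto simp: Q_def)
  have bd: "(\<integral>\<^sup>+x. ennreal (g x) \<partial>M) \<le> ennreal ((1 - 1 / P) * s * m + s powr (1 - P) / P * Q)" if "0 < s" for s
  proof -
    have nn: "0 \<le> (1 - 1 / P) * s" "0 \<le> s powr (1 - P) / P" using P that by (auto simp: field_simps)
    have "(\<integral>\<^sup>+x. ennreal (g x) \<partial>M)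
        \<le> (\<integral>\<^sup>+x. ennreal ((1 - 1 / P) * s) + ennreal (s powr (1 - P) / P) * ennreal (g x powr P) \<partial>M)"
    proof (rule nn_integral_mono)
      fix x
      show "ennreal (g x) \<le> ennreal ((1 - 1 / P) * s) + ennreal (s powr (1 - P) / P) * ennreal (g x powr P)"
      proof -
        have "g x \<le> (1 - 1 / P) * s + s powr (1 - P) / P * g x powr P"
          using tangent_powr_le[OF P g that, of x] by (simp add: mult_ac)
        then have "ennreal (g x) \<le> ennreal ((1 - 1 / P) * s + s powr (1 - P) / P * g x powr P)"
          by (rule ennreal_leI)
        also have "\<dots> = ennreal ((1 - 1 / P) * s) + ennreal (s powr (1 - P) / P) * ennreal (g x powr P)"
          using ennreal_plus[OF nn(1) mult_nonneg_nonneg[OF nn(2) powr_ge_zero], of "g x" P]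
            ennreal_mult[OF nn(2) powr_ge_zero, of "g x" P] by metis
        finally show ?thesis .
      qed
    qed
    also have "\<dots> = ennreal ((1 - 1 / P) * s) * ennreal m + ennreal (s powr (1 - P) / P) * ennreal Q"
      by (simp add: nn_integral_add nn_integral_cmult m Q)
    also have "\<dots> = ennreal ((1 - 1 / P) * s * m + s powr (1 - P) / P * Q)"
    proof -
      have "0 \<le> m" using m by simp
      note p1 = mult_nonneg_nonneg[OF nn(1) this] and p2 = mult_nonneg_nonneg[OF nn(2) Q(2)]
      show ?thesis unfolding ennreal_plus[OF p1 p2] ennreal_mult[OF nn(1) \<open>0 \<le> m\<close>] ennreal_mult[OF nn(2) Q(2)] by (rule refl)
    qed
    finally show ?thesis .
  qed
  show fin': "(\<integral>\<^sup>+x. ennreal (g x) \<partial>M) < \<infinity>"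
    using bd[of 1] by (simp add: le_less_trans)
  define G where "G = enn2real (\<integral>\<^sup>+x. ennreal (g x) \<partial>M)"
  have G: "(\<integral>\<^sup>+x. ennreal (g x) \<partial>M) = ennreal G" "0 \<le> G" using fin' by (auto simp: G_def)
  have bd': "G \<le> (1 - 1 / P) * s * m + s powr (1 - P) / P * Q" if "0 < s" for s
  proof -
    have "0 \<le> (1 - 1 / P) * s * m + s powr (1 - P) / P * Q"
      using P that m Q by (intro add_nonneg_nonneg mult_nonneg_nonneg) (auto simp: field_simps)
    then show ?thesis using bd[OF that] G by simp
  qed
  have "G powr P \<le> m powr (P - 1) * Q"
  proof (cases "Q = 0")
    case True
    \<comment> \<open>For \<open>Q = 0\<close> the optimal \<open>s\<close> would be 0; the
      admissible values \<open>e / m\<close> tend to it.\<close>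
    have "G \<le> 0 + e" if "0 < e" for e
    proof -
      have "G \<le> (1 - 1 / P) * (e / m) * m" using bd'[of "e / m"] that m True by simp
      also have "\<dots> = (1 - 1 / P) * e" using m by simp
      also have "\<dots> \<le> 1 * e" using that P by (intro mult_right_mono) auto
      finally show ?thesis by simp
    qed
    then have "G \<le> 0" by (rule field_le_epsilon)
    then show ?thesis using G True by simp
  next
    case False
    \<comment> \<open>The minimiser of the bound \<open>bd'\<close> in \<open>s\<close>; there the
      two terms add up to \<open>s * m\<close>.\<close>
    define s where "s = (Q / m) powr (1 / P)"
    have s: "0 < s" "s powr P = Q / m" using False Q m P by (auto simp: s_def powr_powr)
    have "G \<le> (1 - 1 / P) * s * m + s powr (1 - P) / P * Q" by (rule bd'[OF s(1)])
    also have "s powr (1 - P) = s / (Q / m)" using s by (simp add: powr_diff)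
    also have "(1 - 1 / P) * s * m + s / (Q / m) / P * Q = s * m"
      using False m P by (simp add: field_simps)
    finally have "G powr P \<le> (s * m) powr P" using G P by (intro powr_mono2) auto
    also have "\<dots> = Q / m * m powr P" using s m by (simp add: powr_mult)
    also have "\<dots> = m powr (P - 1) * Q" using m by (simp add: powr_diff)
    finally show ?thesis .
  qed
  then show "ennreal (enn2real (\<integral>\<^sup>+x. ennreal (g x) \<partial>M) powr P) \<le> ennreal (m powr (P - 1)) * (\<integral>\<^sup>+x. ennreal (g x powr P) \<partial>M)"
    using Q unfolding G_def[symmetric] by (simp add: ennreal_leI flip: ennreal_mult)
qed

section \<open>Norms over Lebesgue measurable sets and the best constant\<close>

lemma nn_integral_lebesgue_on:
  fixes h :: "'a::euclidean_space \<Rightarrow> ennreal"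
  assumes "X \<in> sets lebesgue"
  shows "(\<integral>\<^sup>+x. h x \<partial>lebesgue_on X) = (\<integral>\<^sup>+x. h x * indicator X x \<partial>lborel)"
  using assms by (simp add: nn_integral_restrict_space nn_integral_completion)

lemma AE_lebesgue_on:
  assumes "X \<in> sets lebesgue"
  shows "(AE x in lebesgue_on X. P x) \<longleftrightarrow> (AE x in lborel. x \<in> X \<longrightarrow> P x)"
  using assms by (simp add: AE_restrict_space_iff AE_completion_iff)

text \<open>Extended by zero, both functions live on the whole space, where completeness of Lebesgue
  measure permits changes on a null set.\<close>

lemma lebesgue_on_AE_measurable:
  fixes f g :: "'a::euclidean_space \<Rightarrow> 'b::euclidean_space"
  assumes X: "X \<in> sets lebesgue" and Y: "Y \<in> sets lebesgue" and f: "f \<in> borel_measurable (lebesgue_on Y)"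
    and ae: "AE x in lborel. x \<in> X \<longrightarrow> x \<in> Y \<and> g x = f x"
  shows "g \<in> borel_measurable (lebesgue_on X)"
proof -
  have [measurable]: "X \<in> sets lebesgue" by fact
  have "(\<lambda>x. indicator Y x *\<^sub>R f x) \<in> borel_measurable lebesgue"
    using f Y by (simp add: borel_measurable_restrict_space_iff)
  then have "(\<lambda>x. indicator X x *\<^sub>R (indicator Y x *\<^sub>R f x)) \<in> borel_measurable lebesgue"
    by measurable
  then have "(\<lambda>x. indicator X x *\<^sub>R g x) \<in> borel_measurable lebesgue"
    by (rule borel_measurable_AE)
      (use ae in \<open>auto simp: AE_completion_iff indicator_def elim!: eventually_mono\<close>)
  then show ?thesis using X by (simp add: borel_measurable_restrict_space_iff)
qed

text \<open>Only p = \<infinity> needs an argument. The essential supremum can be negative only if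
  almost every point of \<open>X\<close> is excluded, and then it is -\<infinity>; for a
  non-measurable function it is \<infinity> by default. \<open>real_of_ereal\<close> sends both
  values to 0.\<close>

lemma Lp_norm_nonneg: "0 \<le> Lp_norm p X f"
proof (cases "p = \<infinity>")
  case True
  let ?e = "esssup (lebesgue_on X) (\<lambda>x. ereal (norm (f x)))"
  have "0 \<le> real_of_ereal ?e"
  proof (cases "0 \<le> ?e")
    case False
    have "AE x in lebesgue_on X. ereal (norm (f x)) \<le> ?e" by (rule esssup_AE)
    then have "AE x in lebesgue_on X. False"
    proof eventually_elim
      case (elim x)
      moreover have "0 \<le> ereal (norm (f x))" by simp
      ultimately show ?case using False order_trans by blast
    qed
    then have ae: "AE x in lebesgue_on X. ereal (norm (f x)) \<le> - \<infinity>" by eventually_elim simp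
    show ?thesis
    proof (cases "(\<lambda>x. ereal (norm (f x))) \<in> borel_measurable (lebesgue_on X)")
      case True
      from esssup_I[OF this ae] show ?thesis by simp
    next
      case m: False
      then show ?thesis by (simp add: esssup_non_measurable top_ereal_def)
    qed
  qed (simp add: real_of_ereal_pos)
  then show ?thesis using True by (simp add: Lp_norm_def)
qed (simp add: Lp_norm_def)

lemma mem_Lp_imp_Lp_le:
  assumes "1 \<le> p" "mem_Lp p X f"
  shows "Lp_le p (lebesgue_on X) (\<lambda>x. norm (f x)) (Lp_norm p X f)"
proof (cases "p = \<infinity>")
  case True
  have [measurable]: "f \<in> borel_measurable (lebesgue_on X)" using assms by (simp add: mem_Lp_def)
  let ?e = "esssup (lebesgue_on X) (\<lambda>x. ereal (norm (f x)))"
  have "?e < \<infinity>" using assms True by (simp add: mem_Lp_def)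
  have "AE x in lebesgue_on X. ereal (norm (f x)) \<le> ?e" by (rule esssup_AE)
  then have "AE x in lebesgue_on X. norm (f x) \<le> real_of_ereal ?e"
    by eventually_elim (use \<open>?e < \<infinity>\<close> in \<open>cases ?e; auto\<close>)
  then show ?thesis using True Lp_norm_nonneg[of p X f] by (simp add: Lp_le_def Lp_norm_def)
next
  case False
  define P where "P = enn2real p"
  have P: "1 \<le> P" using enn2real_ge_1 assms False by (simp add: P_def)
  have i: "integrable (lebesgue_on X) (\<lambda>x. norm (f x) powr P)" and [measurable]: "f \<in> borel_measurable (lebesgue_on X)"
    using assms False by (auto simp: mem_Lp_def P_def)
  let ?I = "LINT x|lebesgue_on X. norm (f x) powr P"
  have "(\<integral>\<^sup>+x. ennreal (norm (f x) powr P) \<partial>lebesgue_on X) = ennreal ?I"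
    using i by (intro nn_integral_eq_integral) auto
  moreover have "?I = Lp_norm p X f powr P"
    using False P by (simp add: Lp_norm_def powr_powr flip: P_def)
  ultimately show ?thesis
    using False Lp_norm_nonneg[of p X f] by (simp add: Lp_le_def flip: P_def)
qed

lemma Lp_le_imp_mem_Lp:
  assumes p: "1 \<le> p" and [measurable]: "f \<in> borel_measurable (lebesgue_on X)"
    and le: "Lp_le p (lebesgue_on X) (\<lambda>x. norm (f x)) C"
  shows "mem_Lp p X f" "Lp_norm p X f \<le> C"
proof -
  have "mem_Lp p X f \<and> Lp_norm p X f \<le> C"
  proof (cases "p = \<infinity>")
    case True
    then have "AE x in lebesgue_on X. norm (f x) \<le> C" "0 \<le> C" using le by (simp_all add: Lp_le_def)
    then have "esssup (lebesgue_on X) (\<lambda>x. ereal (norm (f x))) \<le> ereal C"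
      by (intro esssup_I) auto
    then show ?thesis using True \<open>0 \<le> C\<close>
      by (cases "esssup (lebesgue_on X) (\<lambda>x. ereal (norm (f x)))") (auto simp: mem_Lp_def Lp_norm_def)
  next
    case False
    define P where "P = enn2real p"
    have P: "1 \<le> P" using enn2real_ge_1 assms False by (simp add: P_def)
    have nn: "(\<integral>\<^sup>+x. ennreal (norm (f x) powr P) \<partial>lebesgue_on X) \<le> ennreal (C powr P)" and C: "0 \<le> C"
      using le False by (simp_all add: Lp_le_def P_def)
    then have i: "integrable (lebesgue_on X) (\<lambda>x. norm (f x) powr P)"
      by (intro integrableI_bounded) (auto simp: le_less_trans)
    have "(LINT x|lebesgue_on X. norm (f x) powr P) \<le> C powr P"
      using nn nn_integral_eq_integral[OF i] by (simp add: ennreal_le_iff)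
    then have "(LINT x|lebesgue_on X. norm (f x) powr P) powr (1 / P) \<le> (C powr P) powr (1 / P)"
      using P by (intro powr_mono2) auto
    also have "\<dots> = C" using P C by (simp add: powr_powr)
    finally show ?thesis using i False by (simp add: mem_Lp_def Lp_norm_def flip: P_def)
  qed
  then show "mem_Lp p X f" "Lp_norm p X f \<le> C" by auto
qed

lemma Lp_le_AE_subset:
  fixes g :: "'a::euclidean_space \<Rightarrow> real"
  assumes X: "X \<in> sets lebesgue" and Y: "Y \<in> sets lebesgue" and f: "Lp_le p (lebesgue_on Y) f C"
    and g: "g \<in> borel_measurable (lebesgue_on X)"
    and ae: "AE x in lborel. x \<in> X \<longrightarrow> x \<in> Y \<and> \<bar>g x\<bar> \<le> \<bar>f x\<bar>"
  shows "Lp_le p (lebesgue_on X) g C"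
proof (cases "p = \<infinity>")
  case True
  have "AE x in lborel. x \<in> Y \<longrightarrow> \<bar>f x\<bar> \<le> C" using f True Y by (simp add: Lp_le_def AE_lebesgue_on)
  with ae have "AE x in lborel. x \<in> X \<longrightarrow> \<bar>g x\<bar> \<le> C" by eventually_elim auto
  then show ?thesis using True X f g by (simp add: Lp_le_def AE_lebesgue_on)
next
  case False
  have "(\<integral>\<^sup>+x. ennreal (\<bar>g x\<bar> powr enn2real p) * indicator X x \<partial>lborel)
      \<le> (\<integral>\<^sup>+x. ennreal (\<bar>f x\<bar> powr enn2real p) * indicator Y x \<partial>lborel)"
    using ae by (intro nn_integral_mono_AE, eventually_elim) (auto simp: indicator_def intro!: ennreal_leI powr_mono2)
  then show ?thesis using False f g X Y by (auto simp: Lp_le_def nn_integral_lebesgue_on)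
qed

lemma mem_Lp_AE_subset:
  fixes g :: "real^'n \<Rightarrow> 'b::euclidean_space"
  assumes p: "1 \<le> p" and X: "X \<in> sets lebesgue" and Y: "Y \<in> sets lebesgue" and f: "mem_Lp p Y f"
    and ae: "AE x in lborel. x \<in> X \<longrightarrow> x \<in> Y \<and> g x = f x"
  shows "mem_Lp p X g" "Lp_norm p X g \<le> Lp_norm p Y f"
proof -
  have g: "g \<in> borel_measurable (lebesgue_on X)"
    using f by (intro lebesgue_on_AE_measurable[OF X Y _ ae]) (simp add: mem_Lp_def)
  have "Lp_le p (lebesgue_on X) (\<lambda>x. norm (g x)) (Lp_norm p Y f)"
  proof (rule Lp_le_AE_subset[OF X Y mem_Lp_imp_Lp_le[OF p f]])
    show "(\<lambda>x. norm (g x)) \<in> borel_measurable (lebesgue_on X)" using g by measurable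
  qed (use ae in \<open>auto elim!: eventually_mono\<close>)
  from Lp_le_imp_mem_Lp[OF p g this] show "mem_Lp p X g" "Lp_norm p X g \<le> Lp_norm p Y f" .
qed

lemma mem_Lp_minus_const:
  fixes f :: "real^'n \<Rightarrow> real"
  assumes p: "1 \<le> p" and X: "X \<in> lmeasurable" and f: "mem_Lp p X f"
  shows "mem_Lp p X (\<lambda>x. f x - c)"
    "Lp_norm p X (\<lambda>x. f x - c) \<le> Lp_norm p X f + \<bar>c\<bar> * root_factor p (measure lebesgue X)"
proof -
  have [measurable]: "f \<in> borel_measurable (lebesgue_on X)" using f by (simp add: mem_Lp_def)
  have "measure (lebesgue_on X) (space (lebesgue_on X)) = measure lebesgue X"
    using X by (simp add: measure_restrict_space fmeasurableD)
  then have "Lp_le p (lebesgue_on X) (\<lambda>x. norm (f x) + \<bar>c\<bar>) (Lp_norm p X f + \<bar>c\<bar> * root_factor p (measure lebesgue X))"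
    using Lp_le_add[OF p mem_Lp_imp_Lp_le[OF p f] Lp_le_const[OF p finite_measure_lebesgue_on[OF X], of "\<bar>c\<bar>"]]
    by simp
  then have "Lp_le p (lebesgue_on X) (\<lambda>x. norm (f x - c)) (Lp_norm p X f + \<bar>c\<bar> * root_factor p (measure lebesgue X))"
    by (rule Lp_le_mono) auto
  from Lp_le_imp_mem_Lp[OF p _ this]
  show "mem_Lp p X (\<lambda>x. f x - c)"
    "Lp_norm p X (\<lambda>x. f x - c) \<le> Lp_norm p X f + \<bar>c\<bar> * root_factor p (measure lebesgue X)"
    by simp_all
qed

lemma Lp_le_constD:
  assumes p: "1 \<le> p" and fin: "finite_measure M" and m: "0 < measure M (space M)" and le: "Lp_le p M (\<lambda>_. c) C"
  shows "\<bar>c\<bar> * root_factor p (measure M (space M)) \<le> C"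
proof (cases "p = \<infinity>")
  case True
  have "\<not> (AE x in M. False)"
    using m by (auto simp: measure_def AE_iff_measurable[OF _ refl])
  moreover have "AE x in M. \<bar>c\<bar> \<le> C" using le True by (simp add: Lp_le_def)
  ultimately have "\<bar>c\<bar> \<le> C" by (cases "\<bar>c\<bar> \<le> C") auto
  then show ?thesis using True by (simp add: root_factor_def)
next
  case False
  interpret finite_measure M by fact
  define P where "P = enn2real p"
  have P: "1 \<le> P" using enn2real_ge_1 assms False by (simp add: P_def)
  let ?m = "measure M (space M)"
  have "ennreal (\<bar>c\<bar> powr P * ?m) \<le> ennreal (C powr P)" and C: "0 \<le> C"
    using le False by (simp_all add: Lp_le_def emeasure_eq_measure P_def ennreal_mult)
  then have "\<bar>c\<bar> powr P * ?m \<le> C powr P" by (simp add: ennreal_le_iff)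
  then have "(\<bar>c\<bar> powr P * ?m) powr (1 / P) \<le> (C powr P) powr (1 / P)"
    using P by (intro powr_mono2) auto
  then show ?thesis
    using P C False by (simp add: powr_mult powr_powr root_factor_def flip: P_def)
qed

text \<open>The triangle inequality for c = f - (f - c). It makes the norm of f - c grow with |c|,
  and later it estimates a constant on one simplex by the function there.\<close>

lemma Lp_norm_const_le:
  fixes f :: "real^'n \<Rightarrow> real"
  assumes p: "1 \<le> p" and X: "X \<in> lmeasurable" "0 < measure lebesgue X" and f: "mem_Lp p X f"
  shows "\<bar>c\<bar> * root_factor p (measure lebesgue X) \<le> Lp_norm p X f + Lp_norm p X (\<lambda>x. f x - c)"
proof -
  have [measurable]: "f \<in> borel_measurable (lebesgue_on X)" using f by (simp add: mem_Lp_def)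
  have m: "measure (lebesgue_on X) (space (lebesgue_on X)) = measure lebesgue X"
    using X by (simp add: measure_restrict_space fmeasurableD)
  have "Lp_le p (lebesgue_on X) (\<lambda>x. norm (f x) + norm (f x - c)) (Lp_norm p X f + Lp_norm p X (\<lambda>x. f x - c))"
    by (intro Lp_le_add p mem_Lp_imp_Lp_le mem_Lp_minus_const X f)
  then have "Lp_le p (lebesgue_on X) (\<lambda>_. c) (Lp_norm p X f + Lp_norm p X (\<lambda>x. f x - c))"
    by (rule Lp_le_mono) auto
  from Lp_le_constD[OF p finite_measure_lebesgue_on[OF X(1)] _ this] show ?thesis
    using X(2) m by simp
qed

lemma root_factor_pos: "0 < m \<Longrightarrow> 0 < root_factor p m"
  by (simp add: root_factor_def)

text \<open>As a function of \<open>c\<close> the norm is Lipschitz with constant \<open>r\<close>,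
  and outside [-R, R] it is at least its value at 0, so a minimiser over the compact interval is
  global. An attained minimum is needed because the first claim is about one fixed
  \<open>w\<close>.\<close>

lemma ex_best_constant:
  fixes f :: "real^'n \<Rightarrow> real"
  assumes p: "1 \<le> p" and X: "X \<in> lmeasurable" "0 < measure lebesgue X" and f: "mem_Lp p X f"
  obtains c where "\<And>c'. Lp_norm p X (\<lambda>x. f x - c) \<le> Lp_norm p X (\<lambda>x. f x - c')"
proof -
  define r where "r = root_factor p (measure lebesgue X)"
  have r: "0 < r" using root_factor_pos X by (simp add: r_def)
  define h where "h c = Lp_norm p X (\<lambda>x. f x - c)" for c
  \<comment> \<open>By \<open>Lp_norm_const_le\<close>, once |c| \<open>r\<close> exceeds twice the
    norm of \<open>f\<close>, the norm of f - c is at least that of \<open>f\<close>.\<close>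
  define R where "R = (2 * Lp_norm p X f) / r"
  have R: "0 \<le> R" using r Lp_norm_nonneg[of p X f] by (simp add: R_def)
  have lip: "h c \<le> h c' + \<bar>c - c'\<bar> * r" for c c'
    using mem_Lp_minus_const(2)[OF p X(1) mem_Lp_minus_const(1)[OF p X(1) f, of c'], of "c - c'"]
    by (simp add: h_def r_def)
  have "r-lipschitz_on {-R..R} h"
  proof (rule lipschitz_onI)
    fix c c'
    show "dist (h c) (h c') \<le> r * dist c c'"
      using lip[of c c'] lip[of c' c] by (simp add: dist_real_def abs_minus_commute mult.commute abs_le_iff)
  qed (use r in simp)
  then have "continuous_on {-R..R} h" by (rule lipschitz_on_continuous_on)
  from continuous_attains_inf[OF _ _ this] R obtain c where
    c: "c \<in> {-R..R}" "\<And>c'. c' \<in> {-R..R} \<Longrightarrow> h c \<le> h c'" by auto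
  show thesis
  proof
    fix c'
    show "Lp_norm p X (\<lambda>x. f x - c) \<le> Lp_norm p X (\<lambda>x. f x - c')"
    proof (cases "c' \<in> {-R..R}")
      case True
      then show ?thesis using c(2) by (simp add: h_def)
    next
      case False
      then have "2 * Lp_norm p X f < \<bar>c'\<bar> * r"
      proof -
        have "R < \<bar>c'\<bar>" using False by auto
        then have "R * r < \<bar>c'\<bar> * r" using r by (rule mult_strict_right_mono)
        then show ?thesis using r by (simp add: R_def)
      qed
      then have "Lp_norm p X f \<le> h c'"
        using Lp_norm_const_le[OF p X f, of c'] by (simp add: h_def r_def)
      moreover have "h c \<le> h 0" using c(2)[of 0] R by auto
      ultimately show ?thesis by (simp add: h_def)
    qed
  qed
qed

section \<open>Sobolev functions\<close>

lemma borel_measurable_vec_nth [measurable (raw)]: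
  fixes f :: "'a \<Rightarrow> real^'n"
  assumes "f \<in> borel_measurable M" shows "(\<lambda>x. f x $ i) \<in> borel_measurable M"
  by (rule measurable_compose[OF assms]) (intro borel_measurable_continuous_onI continuous_intros)

lemma borel_measurable_vec_lambda:
  fixes f :: "'n::finite \<Rightarrow> 'a \<Rightarrow> real"
  assumes "\<And>i. f i \<in> borel_measurable M" shows "(\<lambda>x. \<chi> i. f i x) \<in> borel_measurable M"
  using assms by (subst borel_measurable_euclidean_space) (auto simp: Basis_vec_def inner_axis)

text \<open>For finite p this is t <= 1 + t^p, the 1 being integrable on a set of finite
  measure.\<close>

lemma mem_Lp_integrable:
  fixes f :: "real^'n \<Rightarrow> 'b::euclidean_space"
  assumes p: "1 \<le> p" and X: "X \<in> lmeasurable" and f: "mem_Lp p X f"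
  shows "integrable (lebesgue_on X) f"
proof -
  interpret finite_measure "lebesgue_on X" by (rule finite_measure_lebesgue_on[OF X])
  have [measurable]: "f \<in> borel_measurable (lebesgue_on X)" using f by (simp add: mem_Lp_def)
  show ?thesis
  proof (cases "p = \<infinity>")
    case True
    then have "AE x in lebesgue_on X. norm (f x) \<le> Lp_norm p X f"
      using mem_Lp_imp_Lp_le[OF p f] by (simp add: Lp_le_def)
    then show ?thesis by (intro integrable_const_bound) auto
  next
    case False
    have P: "1 \<le> enn2real p" using enn2real_ge_1 p False by simp
    have "integrable (lebesgue_on X) (\<lambda>x. 1 + norm (f x) powr enn2real p)"
      using f False by (simp add: mem_Lp_def)
    then show ?thesis
    proof (rule Bochner_Integration.integrable_bound)
      have "t \<le> 1 + t powr enn2real p" if "0 \<le> t" for t :: real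
        using that P powr_mono[of 1 "enn2real p" t] powr_ge_zero[of t "enn2real p"]
        by (smt (verit) powr_one)
      then show "AE x in lebesgue_on X. norm (f x) \<le> norm (1 + norm (f x) powr enn2real p)"
        by (intro AE_I2) (simp add: abs_of_nonneg add_nonneg_nonneg)
    qed measurable
  qed
qed

lemma integral_lebesgue_on_eq:
  fixes h :: "real^'n \<Rightarrow> real"
  assumes "X \<in> sets lebesgue" "\<And>x. x \<notin> X \<Longrightarrow> h x = 0"
  shows "(LINT x|lebesgue_on X. h x) = (LINT x|lebesgue. h x)"
proof -
  have "(LINT x|lebesgue_on X. h x) = (LINT x|lebesgue. indicator X x *\<^sub>R h x)"
    using assms by (intro integral_restrict_space) simp
  also have "\<dots> = (LINT x|lebesgue. h x)"
    using assms by (intro Bochner_Integration.integral_cong refl) (auto simp: indicator_def)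
  finally show ?thesis .
qed

lemma test_function_vanishes:
  assumes "\<phi> \<in> test_functions \<Omega>" "x \<notin> \<Omega>"
  shows "\<phi> x = 0" "partial_derivative i \<phi> x = 0"
proof -
  have "x \<notin> closure {x. \<phi> x \<noteq> 0}" using assms unfolding test_functions_def by blast
  then show "\<phi> x = 0" "partial_derivative i \<phi> x = 0"
    using closure_subset[of "{x. \<phi> x \<noteq> 0}"] test_function_grad_zero[OF assms(1)]
    by (blast, simp add: grad_def vec_eq_iff)
qed

lemma test_functions_mono: "\<Omega>' \<subseteq> \<Omega> \<Longrightarrow> test_functions \<Omega>' \<subseteq> test_functions \<Omega>"
  unfolding test_functions_def by blast

text \<open>A test function of the smaller set is one of the larger set and vanishes outside the
  smaller one, so both weak identities are the same identity between integrals over the whole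
  space.\<close>

lemma W1p_subset:
  assumes p: "1 \<le> p" and op: "open \<Omega>" "open \<Omega>'" and sub: "\<Omega>' \<subseteq> \<Omega>" and v: "W1p p \<Omega> v Dv"
  shows "W1p p \<Omega>' v Dv"
proof -
  have L: "\<Omega> \<in> sets lebesgue" "\<Omega>' \<in> sets lebesgue" using op by auto
  have "mem_Lp p \<Omega>' v" "mem_Lp p \<Omega>' Dv"
    using v sub by (auto simp: W1p_def intro!: mem_Lp_AE_subset(1)[OF p L(2,1)])
  moreover have "locally_integrable \<Omega>' v" "locally_integrable \<Omega>' Dv"
    using v sub unfolding W1p_def has_weak_gradient_def locally_integrable_def by (meson subset_trans)+
  moreover have "(LINT x|lebesgue_on \<Omega>'. v x * partial_derivative i \<phi> x) = - (LINT x|lebesgue_on \<Omega>'. Dv x $ i * \<phi> x)"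
    if \<phi>: "\<phi> \<in> test_functions \<Omega>'" for \<phi> i
  proof -
    have \<phi>': "\<phi> \<in> test_functions \<Omega>" using \<phi> test_functions_mono[OF sub] by blast
    then have "(LINT x|lebesgue_on \<Omega>. v x * partial_derivative i \<phi> x) = - (LINT x|lebesgue_on \<Omega>. Dv x $ i * \<phi> x)"
      using v unfolding W1p_def has_weak_gradient_def by blast
    then show ?thesis
      using L test_function_vanishes[OF \<phi>] test_function_vanishes[OF \<phi>']
      by (simp add: integral_lebesgue_on_eq)
  qed
  ultimately show ?thesis by (auto simp: W1p_def has_weak_gradient_def)
qed

lemma test_function_measurable:
  assumes "\<phi> \<in> test_functions \<Omega>"
  shows "\<phi> \<in> borel_measurable borel" "partial_derivative i \<phi> \<in> borel_measurable borel"
proof -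
  have "C_times 0 \<phi>" "C_times (Suc 0) \<phi>" using assms unfolding test_functions_def by blast+
  then show "\<phi> \<in> borel_measurable borel" "partial_derivative i \<phi> \<in> borel_measurable borel"
    by (auto intro!: borel_measurable_continuous_onI)
qed

lemma W1p_minus_const:
  assumes p: "1 \<le> p" and \<Omega>: "open \<Omega>" "\<Omega> \<in> lmeasurable" and v: "W1p p \<Omega> v Dv"
  shows "W1p p \<Omega> (\<lambda>x. v x - c) Dv"
proof -
  have vL: "mem_Lp p \<Omega> v" using v by (simp add: W1p_def)
  have "locally_integrable \<Omega> (\<lambda>x. v x - c)"
    unfolding locally_integrable_def
  proof (intro allI impI)
    fix K assume K: "compact K \<and> K \<subseteq> \<Omega>"
    interpret finite_measure "lebesgue_on K"
      using K by (intro finite_measure_lebesgue_on lmeasurable_compact) simp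
    show "integrable (lebesgue_on K) (\<lambda>x. v x - c)"
      using v K by (simp add: W1p_def has_weak_gradient_def locally_integrable_def)
  qed
  moreover have "(LINT x|lebesgue_on \<Omega>. (v x - c) * partial_derivative i \<phi> x) = - (LINT x|lebesgue_on \<Omega>. Dv x $ i * \<phi> x)"
    if \<phi>: "\<phi> \<in> test_functions \<Omega>" for \<phi> i
  proof -
    obtain B where B: "\<And>x. norm (grad \<phi> x) \<le> B" using test_function_grad_bounded[OF \<phi>] by blast
    have B': "\<bar>partial_derivative i \<phi> x\<bar> \<le> B" for x
      using B[of x] component_le_norm_cart[of "grad \<phi> x" i] by (simp add: grad_def)
    have m: "partial_derivative i \<phi> \<in> borel_measurable (lebesgue_on \<Omega>)"
      using test_function_measurable(2)[OF \<phi>, of i] by (intro measurable_restrict_space1 measurable_completion) simp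
    have bdd: "integrable (lebesgue_on \<Omega>) (\<lambda>x. g x * partial_derivative i \<phi> x)"
      if g: "integrable (lebesgue_on \<Omega>) g" for g
    proof (rule Bochner_Integration.integrable_bound)
      show "integrable (lebesgue_on \<Omega>) (\<lambda>x. B * norm (g x))" using g by simp
      show "AE x in lebesgue_on \<Omega>. norm (g x * partial_derivative i \<phi> x) \<le> norm (B * norm (g x))"
        using B' order_trans[OF B' abs_ge_self]
        by (intro AE_I2) (simp add: abs_mult mult.commute[of _ "\<bar>g _\<bar>"] mult_left_mono)
      show "(\<lambda>x. g x * partial_derivative i \<phi> x) \<in> borel_measurable (lebesgue_on \<Omega>)"
        using g m by measurable
    qed
    interpret finite_measure "lebesgue_on \<Omega>" by (rule finite_measure_lebesgue_on[OF \<Omega>(2)])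
    have "(LINT x|lebesgue_on \<Omega>. c * partial_derivative i \<phi> x) = c * (LINT x|lebesgue. partial_derivative i \<phi> x)"
      using test_function_vanishes[OF \<phi>] \<Omega> by (simp add: integral_lebesgue_on_eq)
    also have "(LINT x|lebesgue. partial_derivative i \<phi> x) = 0"
      using integral_partial_derivative_zero[OF \<phi>, of i] test_function_measurable(2)[OF \<phi>, of i]
      by (simp add: integral_completion)
    finally have z: "(LINT x|lebesgue_on \<Omega>. c * partial_derivative i \<phi> x) = 0" by simp
    have "(LINT x|lebesgue_on \<Omega>. (v x - c) * partial_derivative i \<phi> x)
        = (LINT x|lebesgue_on \<Omega>. v x * partial_derivative i \<phi> x) - (LINT x|lebesgue_on \<Omega>. c * partial_derivative i \<phi> x)"
      unfolding left_diff_distrib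
      by (intro Bochner_Integration.integral_diff bdd mem_Lp_integrable[OF p \<Omega>(2) vL]) simp
    then show ?thesis
      using z v \<phi> by (simp add: W1p_def has_weak_gradient_def)
  qed
  ultimately show ?thesis
    using v mem_Lp_minus_const(1)[OF p \<Omega>(2) vL] by (auto simp: W1p_def has_weak_gradient_def)
qed

lemma lebesgue_borel_representative:
  fixes f :: "real^'n \<Rightarrow> real^'m"
  assumes "f \<in> borel_measurable lebesgue"
  obtains g where "g \<in> borel_measurable borel" "AE x in lborel. f x = g x"
proof -
  have "\<exists>g\<in>borel_measurable lborel. AE x in lborel. f x $ i = g x" for i
    using assms by (intro completion_ex_borel_measurable_real) (rule borel_measurable_vec_nth)
  then obtain g where g: "\<And>i. g i \<in> borel_measurable borel" "\<And>i. AE x in lborel. f x $ i = g i x"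
    by (simp add: measurable_lborel1) metis
  have "(\<lambda>x. \<chi> i. g i x) \<in> borel_measurable borel"
    using g(1) by (intro borel_measurable_vec_lambda)
  moreover have "AE x in lborel. f x = (\<chi> i. g i x)"
    using AE_finite_allI[of UNIV "\<lambda>i x. f x $ i = g i x" lborel] g(2) by (simp add: vec_eq_iff)
  ultimately show thesis by (rule that)
qed

text \<open>The later arguments compose functions with affine maps and use Tonelli on products, all
  with Borel functions on the whole space. Extension by zero keeps the weak identity because test
  functions of \<Omega> vanish outside \<Omega>, and finite measure turns L^p into L^1.\<close>

lemma W1p_borel_representative:
  fixes v :: "real^'n \<Rightarrow> real"
  assumes p: "1 \<le> p" and \<Omega>: "open \<Omega>" "\<Omega> \<in> lmeasurable" and v: "W1p p \<Omega> v Dv"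
  obtains W D where "integrable lborel W" "integrable lborel D"
    "AE x in lborel. x \<in> \<Omega> \<longrightarrow> v x = W x" "AE x in lborel. x \<in> \<Omega> \<longrightarrow> Dv x = D x"
    "\<And>\<phi> i. \<phi> \<in> test_functions \<Omega> \<Longrightarrow>
      (LINT x|lborel. W x * partial_derivative i \<phi> x) = - (LINT x|lborel. D x $ i * \<phi> x)"
proof -
  have L: "\<Omega> \<in> sets lebesgue" using \<Omega> by auto
  have i: "integrable lebesgue (\<lambda>x. indicator \<Omega> x *\<^sub>R v x)" "integrable lebesgue (\<lambda>x. indicator \<Omega> x *\<^sub>R Dv x)"
    using mem_Lp_integrable[OF p \<Omega>(2), of v] mem_Lp_integrable[OF p \<Omega>(2), of Dv] v L
    by (simp_all add: W1p_def integrable_restrict_space)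
  obtain W where W[measurable]: "W \<in> borel_measurable borel" and vW: "AE x in lborel. indicator \<Omega> x *\<^sub>R v x = W x"
    using completion_ex_borel_measurable_real[of "\<lambda>x. indicator \<Omega> x *\<^sub>R v x" lborel] i(1) by auto
  obtain D where D[measurable]: "D \<in> borel_measurable borel" and vD: "AE x in lborel. indicator \<Omega> x *\<^sub>R Dv x = D x"
    using lebesgue_borel_representative[of "\<lambda>x. indicator \<Omega> x *\<^sub>R Dv x"] i(2) by auto
  have "integrable lebesgue W" "integrable lebesgue D"
    using i vW vD
    by (auto intro!: integrable_cong_AE_imp[of lebesgue "\<lambda>x. indicator \<Omega> x *\<^sub>R v x" W]
        integrable_cong_AE_imp[of lebesgue "\<lambda>x. indicator \<Omega> x *\<^sub>R Dv x" D]
        simp: AE_completion_iff eq_commute measurable_completion)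
  then have "integrable lborel W" "integrable lborel D"
    by (simp_all add: integrable_completion)
  moreover have "AE x in lborel. x \<in> \<Omega> \<longrightarrow> v x = W x" "AE x in lborel. x \<in> \<Omega> \<longrightarrow> Dv x = D x"
  proof -
    show "AE x in lborel. x \<in> \<Omega> \<longrightarrow> v x = W x"
      using vW by eventually_elim (auto simp: indicator_def)
    show "AE x in lborel. x \<in> \<Omega> \<longrightarrow> Dv x = D x"
      using vD by eventually_elim (auto simp: indicator_def)
  qed
  moreover have "(LINT x|lborel. W x * partial_derivative i \<phi> x) = - (LINT x|lborel. D x $ i * \<phi> x)"
    if \<phi>: "\<phi> \<in> test_functions \<Omega>" for \<phi> i
  proof -
    note [measurable] = test_function_measurable[OF \<phi>]
    have im: "(\<lambda>x. indicator \<Omega> x *\<^sub>R v x) \<in> borel_measurable lebesgue" "(\<lambda>x. indicator \<Omega> x *\<^sub>R Dv x) \<in> borel_measurable lebesgue"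
      using i by auto
    have pm: "partial_derivative i \<phi> \<in> borel_measurable lebesgue" "\<phi> \<in> borel_measurable lebesgue"
      using test_function_measurable[OF \<phi>] by (auto intro: measurable_completion)
    have "(LINT x|lborel. W x * partial_derivative i \<phi> x) = (LINT x|lebesgue. W x * partial_derivative i \<phi> x)"
      by (simp add: integral_completion)
    also have "\<dots> = (LINT x|lebesgue. (indicator \<Omega> x *\<^sub>R v x) * partial_derivative i \<phi> x)"
      using vW im pm W
      by (intro integral_cong_AE borel_measurable_times)
        (auto simp: AE_completion_iff measurable_completion elim!: eventually_mono)
    also have "\<dots> = (LINT x|lebesgue. v x * partial_derivative i \<phi> x)"
      using test_function_vanishes[OF \<phi>]
      by (intro Bochner_Integration.integral_cong refl) (auto simp: indicator_def)
    also have "\<dots> = (LINT x|lebesgue_on \<Omega>. v x * partial_derivative i \<phi> x)"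
      using test_function_vanishes[OF \<phi>] L by (simp add: integral_lebesgue_on_eq)
    also have "\<dots> = - (LINT x|lebesgue_on \<Omega>. Dv x $ i * \<phi> x)"
      using v \<phi> by (simp add: W1p_def has_weak_gradient_def)
    also have "(LINT x|lebesgue_on \<Omega>. Dv x $ i * \<phi> x) = (LINT x|lebesgue. Dv x $ i * \<phi> x)"
      using test_function_vanishes[OF \<phi>] L by (simp add: integral_lebesgue_on_eq)
    also have "\<dots> = (LINT x|lebesgue. (indicator \<Omega> x *\<^sub>R Dv x) $ i * \<phi> x)"
      using test_function_vanishes[OF \<phi>]
      by (intro Bochner_Integration.integral_cong refl) (auto simp: indicator_def)
    also have "\<dots> = (LINT x|lebesgue. D x $ i * \<phi> x)"
    proof (rule integral_cong_AE)
      show "(\<lambda>x. (indicator \<Omega> x *\<^sub>R Dv x) $ i * \<phi> x) \<in> borel_measurable lebesgue"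
        by (intro borel_measurable_times borel_measurable_vec_nth im pm)
      show "(\<lambda>x. D x $ i * \<phi> x) \<in> borel_measurable lebesgue"
        by (intro borel_measurable_times borel_measurable_vec_nth pm measurable_completion) simp
      show "AE x in lebesgue. (indicator \<Omega> x *\<^sub>R Dv x) $ i * \<phi> x = D x $ i * \<phi> x"
        unfolding AE_completion_iff using vD by eventually_elim (simp only:)
    qed
    also have "\<dots> = (LINT x|lborel. D x $ i * \<phi> x)"
      by (simp add: integral_completion)
    finally show ?thesis .
  qed
  ultimately show thesis by (rule that)
qed

text \<open>
  By Fatou, convergence of the error terms in \<open>L\<^sup>1\<close> is enough to pass to the limit in a pointwise
  inequality, also when the inequality at \<open>x\<close> holds only from an index on that depends on \<open>x\<close>.
\<close>

lemma AE_le_L1_limit: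
  fixes a b :: "'a \<Rightarrow> ennreal" and e :: "nat \<Rightarrow> 'a \<Rightarrow> ennreal"
  assumes e[measurable]: "\<And>k. e k \<in> borel_measurable M" and lim: "(\<lambda>k. \<integral>\<^sup>+x. e k x \<partial>M) \<longlonglongrightarrow> 0"
    and ev: "AE x in M. \<forall>\<^sub>F k in sequentially. a x \<le> b x + e k x"
  shows "AE x in M. a x \<le> b x"
proof -
  have "(\<integral>\<^sup>+x. liminf (\<lambda>k. e k x) \<partial>M) \<le> liminf (\<lambda>k. \<integral>\<^sup>+x. e k x \<partial>M)"
    by (rule nn_integral_liminf) measurable
  also have "\<dots> = 0" using lim by (rule lim_imp_Liminf[OF sequentially_bot])
  finally have "AE x in M. liminf (\<lambda>k. e k x) = 0"
    by (subst (asm) le_zero_eq, subst (asm) nn_integral_0_iff_AE) auto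
  with ev show ?thesis
  proof eventually_elim
    case (elim x)
    show ?case
    proof (cases "b x = \<infinity>")
      case False
      have "a x - b x \<le> liminf (\<lambda>k. e k x)"
        using elim(1) False by (intro Liminf_bounded) (auto elim!: eventually_mono simp: ennreal_minus_le_iff add.commute)
      then show ?thesis using elim(2) False by (simp add: diff_eq_0_iff_ennreal)
    qed simp
  qed
qed

text \<open>A segment in the open set is compact and keeps a positive distance \<open>e\<close> from
  the complement, so the kernel of radius 1/(k+1) fits as soon as this is below \<open>e\<close>.
  The threshold depends on the segment, which is why the last property holds only for all large
  \<open>k\<close>.\<close>

lemma mollified_approximation:
  fixes W :: "real^'n \<Rightarrow> real" and D :: "real^'n \<Rightarrow> real^'n"
  assumes \<Omega>: "open \<Omega>" and W: "integrable lborel W" and D: "integrable lborel D"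
    and weak: "\<And>\<phi> i. \<phi> \<in> test_functions \<Omega> \<Longrightarrow>
      (LINT x|lborel. W x * partial_derivative i \<phi> x) = - (LINT x|lborel. D x $ i * \<phi> x)"
  obtains f G where "\<And>k. f k \<in> borel_measurable borel" "\<And>k. G k \<in> borel_measurable borel"
    "(\<lambda>k. \<integral>\<^sup>+x. norm (f k x - W x) \<partial>lborel) \<longlonglongrightarrow> 0" "(\<lambda>k. \<integral>\<^sup>+x. norm (G k x - D x) \<partial>lborel) \<longlonglongrightarrow> 0"
    "\<And>a b. closed_segment a b \<subseteq> \<Omega> \<Longrightarrow> \<forall>\<^sub>F k :: nat in sequentially. ennreal \<bar>f k b - f k a\<bar>
      \<le> (\<integral>\<^sup>+t. indicator {0..1} t * ennreal (norm (G k (a + t *\<^sub>R (b - a)) :: real^'n) * norm (b - a)) \<partial>lborel)"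
proof
  let ?r = "\<lambda>k. 1 / real (Suc k)"
  show "mollify (?r k) W \<in> borel_measurable borel" "mollify (?r k) D \<in> borel_measurable borel" for k
    using W D by (auto intro!: mollify_measurable)
  show "(\<lambda>k. \<integral>\<^sup>+x. norm (mollify (?r k) W x - W x) \<partial>lborel) \<longlonglongrightarrow> 0"
    "(\<lambda>k. \<integral>\<^sup>+x. norm (mollify (?r k) D x - D x) \<partial>lborel) \<longlonglongrightarrow> 0"
    by (rule mollify_L1_tendsto[OF W] mollify_L1_tendsto[OF D])+
  fix a b :: "real^'n" assume ab: "closed_segment a b \<subseteq> \<Omega>"
  obtain e where e: "e > 0" "(\<Union>x\<in>closed_segment a b. ball x e) \<subseteq> \<Omega>"
    using compact_subset_open_imp_ball_epsilon_subset[OF compact_segment \<Omega> ab] by blast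
  have "\<forall>\<^sub>F k in sequentially. ?r k < e"
    using order_tendstoD(2)[OF LIMSEQ_inverse_real_of_nat e(1)] by (simp add: divide_inverse)
  then show "\<forall>\<^sub>F k in sequentially. ennreal \<bar>mollify (?r k) W b - mollify (?r k) W a\<bar>
      \<le> (\<integral>\<^sup>+t. indicator {0..1} t * ennreal (norm (mollify (?r k) D (a + t *\<^sub>R (b - a))) * norm (b - a)) \<partial>lborel)"
  proof eventually_elim
    case (elim k)
    have "cball (a + t *\<^sub>R (b - a)) (?r k) \<subseteq> \<Omega>" if "t \<in> {0..1}" for t
    proof -
      have "a + t *\<^sub>R (b - a) \<in> closed_segment a b"
        using that by (auto simp: in_segment algebra_simps intro!: exI[of _ t])
      moreover have "cball (a + t *\<^sub>R (b - a)) (?r k) \<subseteq> ball (a + t *\<^sub>R (b - a)) e" using elim by auto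
      ultimately show ?thesis using e(2) by blast
    qed
    from mollify_difference[OF _ W D weak this] show ?case by simp
  qed
qed

text \<open>
  The determinant formula of the library needs a well-ordered index type. The exchange argument for the
  uniqueness of Haar measure gives the scaling factor without determinants.
\<close>

lemma nn_integral_linear_exchange:
  fixes J K :: "'a::euclidean_space \<Rightarrow> 'a" and f g :: "'a \<Rightarrow> ennreal"
  assumes J: "linear J" and JK: "\<And>x. J (K x) = x"
    and [measurable]: "f \<in> borel_measurable borel" "g \<in> borel_measurable borel"
  shows "(\<integral>\<^sup>+x. f (J x) \<partial>lborel) * (\<integral>\<^sup>+x. g x \<partial>lborel) = (\<integral>\<^sup>+x. f x \<partial>lborel) * (\<integral>\<^sup>+x. g (J x) \<partial>lborel)"
proof -
  have [measurable]: "J \<in> borel_measurable borel"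
    using J by (intro borel_measurable_continuous_onI linear_continuous_on) (simp add: linear_conv_bounded_linear)
  have "(\<integral>\<^sup>+x. f (J x) \<partial>lborel) * (\<integral>\<^sup>+y. g y \<partial>lborel) = (\<integral>\<^sup>+y. (\<integral>\<^sup>+x. f (J x) \<partial>lborel) * g y \<partial>lborel)"
    by (simp add: nn_integral_cmult)
  also have "\<dots> = (\<integral>\<^sup>+y. (\<integral>\<^sup>+x. f (J x + y) * g y \<partial>lborel) \<partial>lborel)"
  proof (rule nn_integral_cong)
    \<comment> \<open>Shifting \<open>x\<close> by \<open>K y\<close> turns \<open>J x\<close> into
      \<open>J x + y\<close>. In the second exchange below, \<open>y - J x\<close> is
      \<open>J (K y - x)\<close>, which a reflection brings back to \<open>J x\<close>.\<close>
    fix y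
    have "(\<integral>\<^sup>+x. f (J x) \<partial>lborel) = (\<integral>\<^sup>+x. f (J (K y + x)) \<partial>lborel)"
      by (rule nn_integral_lborel_translation[symmetric]) measurable
    then show "(\<integral>\<^sup>+x. f (J x) \<partial>lborel) * g y = (\<integral>\<^sup>+x. f (J x + y) * g y \<partial>lborel)"
      by (simp add: linear_add[OF J] JK nn_integral_multc add.commute)
  qed
  also have "\<dots> = (\<integral>\<^sup>+x. (\<integral>\<^sup>+y. f (J x + y) * g y \<partial>lborel) \<partial>lborel)"
    by (rule lborel_pair.Fubini') measurable
  also have "\<dots> = (\<integral>\<^sup>+x. (\<integral>\<^sup>+y. f y * g (y - J x) \<partial>lborel) \<partial>lborel)"
  proof (rule nn_integral_cong)
    fix x
    show "(\<integral>\<^sup>+y. f (J x + y) * g y \<partial>lborel) = (\<integral>\<^sup>+y. f y * g (y - J x) \<partial>lborel)"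
      using nn_integral_lborel_translation[of "\<lambda>y. f y * g (y - J x)" "J x"] by simp
  qed
  also have "\<dots> = (\<integral>\<^sup>+y. (\<integral>\<^sup>+x. f y * g (y - J x) \<partial>lborel) \<partial>lborel)"
    by (rule lborel_pair.Fubini') measurable
  also have "\<dots> = (\<integral>\<^sup>+y. f y * (\<integral>\<^sup>+x. g (J x) \<partial>lborel) \<partial>lborel)"
  proof (rule nn_integral_cong)
    fix y
    have "(\<integral>\<^sup>+x. g (J (K y - x)) \<partial>lborel) = (\<integral>\<^sup>+x. g (J x) \<partial>lborel)"
      by (rule nn_integral_lborel_reflection) measurable
    then show "(\<integral>\<^sup>+x. f y * g (y - J x) \<partial>lborel) = f y * (\<integral>\<^sup>+x. g (J x) \<partial>lborel)"
      by (simp add: nn_integral_cmult linear_diff[OF J] JK)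
  qed
  also have "\<dots> = (\<integral>\<^sup>+x. f x \<partial>lborel) * (\<integral>\<^sup>+x. g (J x) \<partial>lborel)"
    by (simp add: nn_integral_multc)
  finally show ?thesis .
qed

text \<open>With the indicator of the unit ball as \<open>g\<close>, the exchange identity gives the
  factor: the volume of the preimage of the ball under \<open>J\<close> divided by the volume of the
  ball. The preimage is not null, since f = 1 would then make an infinite integral times a positive
  volume equal to 0.\<close>

lemma nn_integral_affine_bij:
  fixes J :: "'a::euclidean_space \<Rightarrow> 'a" and c :: 'a
  assumes J: "linear J" "bij J"
  shows "\<exists>\<kappa>>0. \<forall>h\<in>borel_measurable borel.
    (\<integral>\<^sup>+x. h (c + J (x - c)) \<partial>lborel) = ennreal \<kappa> * (\<integral>\<^sup>+x. h x \<partial>lborel)"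
proof -
  define K where "K = inv J"
  have JK: "J (K x) = x" and KJ: "K (J x) = x" for x
    using J(2) by (simp_all add: K_def bij_is_surj surj_f_inv_f bij_is_inj)
  have "linear K" unfolding K_def using J by (intro inj_linear_imp_inv_linear bij_is_inj)
  have [measurable]: "J \<in> borel_measurable borel"
    using J by (intro borel_measurable_continuous_onI linear_continuous_on) (simp add: linear_conv_bounded_linear)
  let ?B = "ball 0 1 :: 'a set"
  let ?V = "emeasure lborel ?B" and ?N = "\<integral>\<^sup>+x. indicator ?B (J x) \<partial>lborel"
  have ex: "(\<integral>\<^sup>+x. f (J x) \<partial>lborel) * ?V = (\<integral>\<^sup>+x. f x \<partial>lborel) * ?N" if "f \<in> borel_measurable borel" for f
  proof -
    have "(indicator ?B :: 'a \<Rightarrow> ennreal) \<in> borel_measurable borel" by (rule borel_measurable_indicator) simp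
    from nn_integral_linear_exchange[OF J(1) JK that this] show ?thesis by simp
  qed
  have V: "?V \<noteq> 0" "?V < \<infinity>"
    using unit_ball_vol_pos[of "real DIM('a)"] emeasure_bounded_finite[of ?B]
    by (auto simp: emeasure_ball simp del: unit_ball_vol_pos)
  have "?N = emeasure lborel (K ` ?B)"
  proof -
    have "J -` ?B = K ` ?B" using JK KJ by (auto simp: image_iff) (metis mem_ball_0)
    moreover have "J -` ?B \<in> sets borel" using measurable_sets[of J borel borel ?B] by simp
    moreover have "indicator ?B (J x) = (indicator (J -` ?B) x :: ennreal)" for x by (simp add: indicator_def)
    ultimately show ?thesis by simp
  qed
  moreover have "bounded (K ` ?B)"
    using \<open>linear K\<close> by (intro bounded_linear_image) (auto simp: linear_conv_bounded_linear)
  ultimately have Nfin: "?N < \<infinity>" using emeasure_bounded_finite by metis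
  have "?N \<noteq> 0"
  proof
    assume "?N = 0"
    then have "emeasure lborel (UNIV :: 'a set) * ?V = 0" using ex[of "\<lambda>_. 1"] by simp
    then show False using V by (simp add: emeasure_lborel_UNIV)
  qed
  obtain a b where ab: "?V = ennreal a" "?N = ennreal b" "0 < a" "0 < b"
    using V Nfin \<open>?N \<noteq> 0\<close> by (cases ?V; cases ?N) (auto simp: less_le)
  show ?thesis
  proof (intro exI conjI ballI)
    show "0 < b / a" using ab by simp
    fix h :: "'a \<Rightarrow> ennreal" assume h[measurable]: "h \<in> borel_measurable borel"
    have "(\<integral>\<^sup>+x. h (c + J (x - c)) \<partial>lborel) = (\<integral>\<^sup>+x. h (c + J (c + x - c)) \<partial>lborel)"
      by (rule nn_integral_lborel_translation[symmetric]) measurable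
    then have e1: "(\<integral>\<^sup>+x. h (c + J (x - c)) \<partial>lborel) = (\<integral>\<^sup>+x. h (c + J x) \<partial>lborel)" by simp
    have e2: "(\<integral>\<^sup>+x. h (c + x) \<partial>lborel) = (\<integral>\<^sup>+x. h x \<partial>lborel)"
      by (rule nn_integral_lborel_translation) measurable
    let ?L = "\<integral>\<^sup>+x. h (c + J x) \<partial>lborel" and ?I = "\<integral>\<^sup>+x. h x \<partial>lborel"
    have "?L * ennreal a = ?I * ennreal b"
      using ex[of "\<lambda>x. h (c + x)"] by (simp add: e2 ab)
    then have "?L * (ennreal a * ennreal (1 / a)) = ?I * (ennreal b * ennreal (1 / a))"
      by (simp add: mult.assoc[symmetric])
    moreover have "ennreal a * ennreal (1 / a) = 1" "ennreal b * ennreal (1 / a) = ennreal (b / a)"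
      using ab by (simp_all add: ennreal_mult[symmetric])
    ultimately show "(\<integral>\<^sup>+x. h (c + J (x - c)) \<partial>lborel) = ennreal (b / a) * ?I"
      by (simp add: e1 mult.commute)
  qed
qed

section \<open>Folding a simplex onto its neighbour\<close>

lemma nn_integral_powr_01:
  assumes "1 \<le> P"
  shows "(\<integral>\<^sup>+t. indicator {0..1} t * ennreal (t powr (P - 1)) \<partial>lborel) = ennreal (1 / P)"
proof -
  have "((\<lambda>t. t powr (P - 1)) has_integral (1 powr (P - 1 + 1) / (P - 1 + 1))) {0..1::real}"
    using assms by (intro has_integral_powr_from_0) auto
  then have "((\<lambda>t. t powr (P - 1)) has_integral (1 / P)) {0..1::real}" by simp
  from nn_integral_has_integral_lebesgue[OF _ this]
  have "(\<integral>\<^sup>+t. ennreal (indicator {0..1} t * t powr (P - 1)) \<partial>lborel) = ennreal (1 / P)"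
    by (simp add: nn_integral_completion)
  moreover have "indicator {0..1} t * ennreal (t powr (P - 1)) = ennreal (indicator {0..1} t * t powr (P - 1))" for t
    by (simp add: indicator_def)
  ultimately show ?thesis by simp
qed

definition hardy_factor :: "ennreal \<Rightarrow> real" where
  "hardy_factor p = (if p = \<infinity> then 1 else enn2real p powr (- 1 / enn2real p))"

text \<open>
  In the application \<open>S\<close> is a simplex, \<open>c\<close> a vertex of one of its faces \<open>F\<close>, \<open>c + E\<close> the vertex opposite
  \<open>F\<close>, and \<open>l (x - c)\<close> the barycentric coordinate of \<open>x\<close> that belongs to \<open>c + E\<close>. Moving from \<open>x\<close> along
  \<open>-E\<close> stays in \<open>S\<close> until \<open>F\<close> is reached.
\<close>

locale edge_direction =
  fixes S :: "(real^'n) set" and c E :: "real^'n" and l :: "real^'n \<Rightarrow> real"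
  assumes compact_S: "compact S" and convex_S: "convex S" and linear_l: "linear l" and l_E: "l E = 1"
    and l_S: "\<And>x. x \<in> S \<Longrightarrow> 0 \<le> l (x - c) \<and> l (x - c) \<le> 1"
    and foot_S: "\<And>x. x \<in> S \<Longrightarrow> x - l (x - c) *\<^sub>R E \<in> S"
begin

definition lam :: "real^'n \<Rightarrow> real" where "lam x = l (x - c)"

lemma lam_measurable [measurable]: "lam \<in> borel_measurable borel"
proof -
  have "continuous_on UNIV l" using linear_l by (simp add: linear_continuous_on linear_conv_bounded_linear)
  from continuous_on_compose2[OF this, of UNIV "\<lambda>x. x - c"]
  have "continuous_on UNIV lam" unfolding lam_def[abs_def] by (simp add: continuous_on_diff)
  then show ?thesis by (rule borel_measurable_continuous_onI)
qed

lemma S_measurable [measurable]: "S \<in> sets borel"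
  using compact_S by (simp add: borel_compact)

lemma lam_shift: "lam (\<tau> *\<^sub>R E + x) = \<tau> + lam x"
  using linear_add[OF linear_l, of "\<tau> *\<^sub>R E" "x - c"] l_E
  by (simp add: lam_def linear_scale[OF linear_l] algebra_simps)

lemma segment_in_S:
  assumes "x \<in> S" "0 \<le> \<tau>" "\<tau> \<le> lam x" shows "x - \<tau> *\<^sub>R E \<in> S"
proof (cases "lam x = 0")
  case False
  then have "0 < lam x" using assms by auto
  have "(1 - \<tau> / lam x) *\<^sub>R x + (\<tau> / lam x) *\<^sub>R (x - lam x *\<^sub>R E) \<in> S"
    using convex_S assms \<open>0 < lam x\<close> foot_S[OF assms(1)]
    by (intro convexD_alt) (auto simp: lam_def divide_le_eq)
  also have "(1 - \<tau> / lam x) *\<^sub>R x + (\<tau> / lam x) *\<^sub>R (x - lam x *\<^sub>R E) = x - \<tau> *\<^sub>R E"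
    using \<open>0 < lam x\<close> by (simp add: algebra_simps)
  finally show ?thesis .
qed (use assms in simp)

text \<open>The parameter counts multiples of \<open>E\<close> instead of arc length, so the
  interval of integration has length \<open>lam x\<close>, at most 1 on \<open>S\<close>. The length
  factor, \<open>norm E\<close> or its folded counterpart \<open>norm (J E)\<close>, is supplied
  outside.\<close>

definition ray :: "(real^'n \<Rightarrow> real) \<Rightarrow> real^'n \<Rightarrow> ennreal" where
  "ray g x = (\<integral>\<^sup>+\<tau>. ennreal (g (x - \<tau> *\<^sub>R E)) * indicator {0..lam x} \<tau> \<partial>lborel)"

lemma ray_measurable [measurable]:
  assumes [measurable]: "g \<in> borel_measurable borel" shows "ray g \<in> borel_measurable borel"
proof -
  have "ray g = (\<lambda>x. \<integral>\<^sup>+\<tau>. (if 0 \<le> \<tau> \<and> \<tau> \<le> lam x then ennreal (g (x - \<tau> *\<^sub>R E)) else 0) \<partial>lborel)"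
    unfolding ray_def by (intro ext nn_integral_cong) (auto simp: indicator_def)
  then show ?thesis by simp
qed

lemma ray_mono: "(\<And>x. g x \<le> h x) \<Longrightarrow> ray g x \<le> ray h x"
  unfolding ray_def by (intro nn_integral_mono mult_right_mono ennreal_leI) auto

lemma ray_add:
  assumes [measurable]: "g \<in> borel_measurable borel" "h \<in> borel_measurable borel"
    and "\<And>x. 0 \<le> g x" "\<And>x. 0 \<le> h x"
  shows "ray (\<lambda>x. g x + h x) x = ray g x + ray h x"
  unfolding ray_def using assms(3,4) by (subst nn_integral_add[symmetric]) (auto simp: distrib_right)

lemma ray_zero: "x \<in> S \<Longrightarrow> lam x = 0 \<Longrightarrow> ray g x = 0"
proof -
  assume "lam x = 0"
  then have "ray g x = (\<integral>\<^sup>+\<tau>. ennreal (g x) * indicator {0::real} \<tau> \<partial>lborel)"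
    unfolding ray_def by (intro nn_integral_cong) (auto simp: indicator_def)
  then show ?thesis by (simp add: nn_integral_cmult)
qed

text \<open>Tonelli followed by the shift of \<open>x\<close> by \<tau> \<open>E\<close>, which adds
  \<tau> to \<open>lam\<close>. The weight becomes the power P - 1 of \<tau> + lam x, and its
  integral over the \<tau> that keep this sum in [0,1] is at most 1/P. This is the origin of
  \<open>hardy_factor\<close>.\<close>

lemma hardy_nn_integral:
  assumes P: "1 \<le> P" and [measurable]: "g \<in> borel_measurable borel"
  shows "(\<integral>\<^sup>+x. ennreal (lam x powr (P - 1)) * ray (\<lambda>x. g x powr P) x * indicator S x \<partial>lborel)
    \<le> ennreal (1 / P) * (\<integral>\<^sup>+x. ennreal (g x powr P) * indicator S x \<partial>lborel)"
proof -
  define k where "k x = ennreal (g x powr P) * indicator S x" for x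
  have [measurable]: "k \<in> borel_measurable borel" unfolding k_def[abs_def] by measurable
  define w where "w = (\<lambda>s. ennreal (s powr (P - 1)))"
  have [measurable]: "w \<in> borel_measurable borel" unfolding w_def by measurable
  have "(\<integral>\<^sup>+x. w (lam x) * ray (\<lambda>x. g x powr P) x * indicator S x \<partial>lborel)
    \<le> (\<integral>\<^sup>+x. (\<integral>\<^sup>+\<tau>. (if 0 \<le> \<tau> \<and> \<tau> \<le> lam x \<and> lam x \<le> 1 then w (lam x) * k (x - \<tau> *\<^sub>R E) else 0) \<partial>lborel) \<partial>lborel)"
  proof (rule nn_integral_mono)
    fix x
    show "w (lam x) * ray (\<lambda>x. g x powr P) x * indicator S x
        \<le> (\<integral>\<^sup>+\<tau>. (if 0 \<le> \<tau> \<and> \<tau> \<le> lam x \<and> lam x \<le> 1 then w (lam x) * k (x - \<tau> *\<^sub>R E) else 0) \<partial>lborel)"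
    proof (cases "x \<in> S")
      case True
      have "w (lam x) * ray (\<lambda>x. g x powr P) x
          = (\<integral>\<^sup>+\<tau>. w (lam x) * (ennreal (g (x - \<tau> *\<^sub>R E) powr P) * indicator {0..lam x} \<tau>) \<partial>lborel)"
        unfolding ray_def by (rule nn_integral_cmult[symmetric]) measurable
      also have "\<dots> \<le> (\<integral>\<^sup>+\<tau>. (if 0 \<le> \<tau> \<and> \<tau> \<le> lam x \<and> lam x \<le> 1 then w (lam x) * k (x - \<tau> *\<^sub>R E) else 0) \<partial>lborel)"
        \<comment> \<open>The shifted point stays in \<open>S\<close>, so the indicator of
          \<open>S\<close> moves there with \<open>k\<close>, and all that is kept about
          \<open>x\<close> itself is that \<open>lam x\<close> lies in [0,1].\<close>
        using segment_in_S[OF True] l_S[OF True]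
        by (intro nn_integral_mono) (auto simp: k_def indicator_def lam_def)
      finally show ?thesis using True by simp
    qed simp
  qed
  also have "\<dots> = (\<integral>\<^sup>+\<tau>. (\<integral>\<^sup>+x. (if 0 \<le> \<tau> \<and> \<tau> \<le> lam x \<and> lam x \<le> 1 then w (lam x) * k (x - \<tau> *\<^sub>R E) else 0) \<partial>lborel) \<partial>lborel)"
    by (rule lborel_pair.Fubini') measurable
  also have "\<dots> = (\<integral>\<^sup>+\<tau>. (\<integral>\<^sup>+x. (if 0 \<le> \<tau> \<and> \<tau> \<le> \<tau> + lam x \<and> \<tau> + lam x \<le> 1 then w (\<tau> + lam x) * k x else 0) \<partial>lborel) \<partial>lborel)"
  proof (rule nn_integral_cong)
    fix \<tau> :: real
    show "(\<integral>\<^sup>+x. (if 0 \<le> \<tau> \<and> \<tau> \<le> lam x \<and> lam x \<le> 1 then w (lam x) * k (x - \<tau> *\<^sub>R E) else 0) \<partial>lborel)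
        = (\<integral>\<^sup>+x. (if 0 \<le> \<tau> \<and> \<tau> \<le> \<tau> + lam x \<and> \<tau> + lam x \<le> 1 then w (\<tau> + lam x) * k x else 0) \<partial>lborel)"
      using nn_integral_lborel_translation[of
          "\<lambda>x. if 0 \<le> \<tau> \<and> \<tau> \<le> lam x \<and> lam x \<le> 1 then w (lam x) * k (x - \<tau> *\<^sub>R E) else 0" "\<tau> *\<^sub>R E"]
      by (simp add: lam_shift cong: if_cong)
  qed
  also have "\<dots> = (\<integral>\<^sup>+x. (\<integral>\<^sup>+\<tau>. (if 0 \<le> \<tau> \<and> \<tau> \<le> \<tau> + lam x \<and> \<tau> + lam x \<le> 1 then w (\<tau> + lam x) * k x else 0) \<partial>lborel) \<partial>lborel)"
    by (rule lborel_pair.Fubini') measurable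
  also have "\<dots> \<le> (\<integral>\<^sup>+x. k x * ennreal (1 / P) \<partial>lborel)"
  proof (rule nn_integral_mono)
    fix x
    have "(\<integral>\<^sup>+\<tau>. (if 0 \<le> \<tau> \<and> \<tau> \<le> \<tau> + lam x \<and> \<tau> + lam x \<le> 1 then w (\<tau> + lam x) * k x else 0) \<partial>lborel)
        \<le> (\<integral>\<^sup>+\<tau>. k x * (indicator {0..1} (lam x + \<tau>) * w (lam x + \<tau>)) \<partial>lborel)"
      by (intro nn_integral_mono) (auto simp: indicator_def mult.commute add.commute)
    also have "\<dots> = k x * (\<integral>\<^sup>+\<tau>. indicator {0..1} (lam x + \<tau>) * w (lam x + \<tau>) \<partial>lborel)"
      by (rule nn_integral_cmult) measurable
    also have "(\<integral>\<^sup>+\<tau>. indicator {0..1} (lam x + \<tau>) * w (lam x + \<tau>) \<partial>lborel) = (\<integral>\<^sup>+\<tau>. indicator {0..1} \<tau> * w \<tau> \<partial>lborel)"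
      by (rule nn_integral_lborel_translation[where f = "\<lambda>\<tau>. indicator {0..1} \<tau> * w \<tau>"]) measurable
    also have "\<dots> = ennreal (1 / P)" unfolding w_def by (rule nn_integral_powr_01[OF P])
    finally show "(\<integral>\<^sup>+\<tau>. (if 0 \<le> \<tau> \<and> \<tau> \<le> \<tau> + lam x \<and> \<tau> + lam x \<le> 1 then w (\<tau> + lam x) * k x else 0) \<partial>lborel)
        \<le> k x * ennreal (1 / P)" .
  qed
  also have "\<dots> = ennreal (1 / P) * (\<integral>\<^sup>+x. k x \<partial>lborel)"
    by (simp add: nn_integral_multc mult.commute)
  finally show ?thesis by (simp add: w_def k_def)
qed

lemma ray_L1:
  assumes [measurable]: "g \<in> borel_measurable borel" and g: "\<And>x. 0 \<le> g x"
  shows "(\<integral>\<^sup>+x. ray g x * indicator S x \<partial>lborel) \<le> (\<integral>\<^sup>+x. ennreal (g x) * indicator S x \<partial>lborel)"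
proof -
  have "(\<integral>\<^sup>+x. ray g x * indicator S x \<partial>lborel)
      \<le> (\<integral>\<^sup>+x. ennreal (lam x powr (1 - 1)) * ray (\<lambda>x. g x powr 1) x * indicator S x \<partial>lborel)"
    \<comment> \<open>\<open>0 powr 0\<close> is 0, so the weight with exponent 1 - 1 is lost where
      \<open>lam x = 0\<close>; there the ray itself vanishes.\<close>
    using ray_zero g by (intro nn_integral_mono) (auto simp: indicator_def)
  also have "\<dots> \<le> ennreal (1 / 1) * (\<integral>\<^sup>+x. ennreal (g x powr 1) * indicator S x \<partial>lborel)"
    by (rule hardy_nn_integral) auto
  finally show ?thesis using g by simp
qed

text \<open>The parameter interval has length \<open>lam x\<close>, and Jensen on an interval of
  this length costs exactly the weight that \<open>hardy_nn_integral\<close> absorbs.\<close>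

lemma ray_Jensen:
  assumes P: "1 \<le> P" and [measurable]: "g \<in> borel_measurable borel" and g: "\<And>x. 0 \<le> g x" and x: "x \<in> S"
  shows "ennreal (enn2real (ray g x) powr P) \<le> ennreal (lam x powr (P - 1)) * ray (\<lambda>x. g x powr P) x"
    and "ray (\<lambda>x. g x powr P) x < \<infinity> \<Longrightarrow> ray g x < \<infinity>"
proof -
  have "ennreal (enn2real (ray g x) powr P) \<le> ennreal (lam x powr (P - 1)) * ray (\<lambda>x. g x powr P) x
    \<and> (ray (\<lambda>x. g x powr P) x < \<infinity> \<longrightarrow> ray g x < \<infinity>)"
  proof (cases "lam x = 0")
    case True
    then show ?thesis using ray_zero[OF x] P by simp
  next
    case False
    then have lam: "0 < lam x" using l_S[OF x] by (auto simp: lam_def)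
    let ?M = "restrict_space lborel {0..lam x}"
    have r: "ray h x = (\<integral>\<^sup>+\<tau>. ennreal (h (x - \<tau> *\<^sub>R E)) \<partial>?M)" for h
      unfolding ray_def by (rule nn_integral_restrict_space[symmetric]) simp
    have m: "(\<lambda>\<tau>. g (x - \<tau> *\<^sub>R E)) \<in> borel_measurable ?M"
      by (intro measurable_restrict_space1) measurable
    have sp: "emeasure ?M (space ?M) = ennreal (lam x)"
      using lam by (simp add: emeasure_restrict_space space_restrict_space)
    show ?thesis
    proof (cases "ray (\<lambda>x. g x powr P) x < \<infinity>")
      case True
      then show ?thesis
        using nn_integral_Jensen_powr[OF P m g sp lam] unfolding r by blast
    next
      case False
      then have "ray (\<lambda>x. g x powr P) x = \<infinity>" by (simp add: not_less top_unique)
      then show ?thesis using lam by (simp add: ennreal_mult_top)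
    qed
  qed
  then show "ennreal (enn2real (ray g x) powr P) \<le> ennreal (lam x powr (P - 1)) * ray (\<lambda>x. g x powr P) x"
    and "ray (\<lambda>x. g x powr P) x < \<infinity> \<Longrightarrow> ray g x < \<infinity>" by auto
qed

text \<open>For finite p combine \<open>ray_Jensen\<close> with \<open>hardy_nn_integral\<close>.
  The second conclusion accompanies the first because \<open>enn2real\<close> would hide infinite
  rays.\<close>

lemma hardy_Lp:
  assumes p: "1 \<le> p" and gm[measurable]: "g \<in> borel_measurable borel" and g: "\<And>x. 0 \<le> g x"
    and le: "Lp_le p (lebesgue_on S) g C"
  shows "Lp_le p (lebesgue_on S) (\<lambda>x. enn2real (ray g x)) (hardy_factor p * C)"
    and "AE x in lborel. x \<in> S \<longrightarrow> ray g x < \<infinity>"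
proof -
  have SL: "S \<in> sets lebesgue" by simp
  have C: "0 \<le> C" using le by (simp add: Lp_le_def)
  have m: "(\<lambda>x. enn2real (ray g x)) \<in> borel_measurable (lebesgue_on S)"
    by (intro measurable_restrict_space1 measurable_completion) simp
  have "Lp_le p (lebesgue_on S) (\<lambda>x. enn2real (ray g x)) (hardy_factor p * C)
    \<and> (AE x in lborel. x \<in> S \<longrightarrow> ray g x < \<infinity>)"
  proof (cases "p = \<infinity>")
    case True
    \<comment> \<open>The excess of \<open>g\<close> over \<open>C\<close> vanishes almost
      everywhere on \<open>S\<close>; by \<open>ray_L1\<close> it is then invisible on almost every
      ray, so the bound passes from points to rays.\<close>
    define h where "h x = max 0 (g x - C)" for x
    have [measurable]: "h \<in> borel_measurable borel" unfolding h_def[abs_def] by measurable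
    have "AE x in lborel. x \<in> S \<longrightarrow> \<bar>g x\<bar> \<le> C"
      using le True SL by (simp add: Lp_le_def AE_lebesgue_on)
    then have "AE x in lborel. ennreal (h x) * indicator S x = 0"
      by eventually_elim (auto simp: h_def indicator_def)
    then have "(\<integral>\<^sup>+x. ennreal (h x) * indicator S x \<partial>lborel) = 0"
      by (subst nn_integral_0_iff_AE) auto
    then have "(\<integral>\<^sup>+x. ray h x * indicator S x \<partial>lborel) = 0"
      using ray_L1[of h] by (simp add: h_def)
    then have z: "AE x in lborel. ray h x * indicator S x = 0"
      by (subst (asm) nn_integral_0_iff_AE) auto
    have "AE x in lborel. x \<in> S \<longrightarrow> ray g x \<le> ennreal C"
      using z
    proof eventually_elim
      case (elim x)
      show ?case
      proof
        assume x: "x \<in> S"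
        have "ray g x \<le> ray (\<lambda>x. C + h x) x" by (rule ray_mono) (simp add: h_def)
        also have "\<dots> = ray (\<lambda>x. C) x + ray h x" using C by (intro ray_add) (auto simp: h_def)
        also have "\<dots> = ray (\<lambda>x. C) x" using elim x by simp
        also have "\<dots> = ennreal C * ennreal (lam x)"
          unfolding ray_def using l_S[OF x] by (subst nn_integral_cmult_indicator) (auto simp: lam_def)
        also have "\<dots> \<le> ennreal C * 1"
          using l_S[OF x] by (intro mult_left_mono) (auto simp: lam_def)
        finally show "ray g x \<le> ennreal C" by simp
      qed
    qed
    moreover from this have "AE x in lborel. x \<in> S \<longrightarrow> \<bar>enn2real (ray g x)\<bar> \<le> C"
      by eventually_elim (use C in \<open>auto intro: enn2real_leI\<close>)
    ultimately show ?thesis using True m SL C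
      by (auto simp: Lp_le_def AE_lebesgue_on hardy_factor_def intro: le_less_trans elim!: eventually_mono)
  next
    case False
    define P where "P = enn2real p"
    have P: "1 \<le> P" using enn2real_ge_1 p False by (simp add: P_def)
    let ?J = "\<lambda>x. ennreal (lam x powr (P - 1)) * ray (\<lambda>x. g x powr P) x * indicator S x"
    have G: "(\<integral>\<^sup>+x. ennreal (g x powr P) * indicator S x \<partial>lborel) \<le> ennreal (C powr P)"
      using le False SL g by (simp add: Lp_le_def nn_integral_lebesgue_on P_def)
    have "(\<integral>\<^sup>+x. ?J x \<partial>lborel) \<le> ennreal (1 / P) * (\<integral>\<^sup>+x. ennreal (g x powr P) * indicator S x \<partial>lborel)"
      by (rule hardy_nn_integral[OF P gm])
    also have "\<dots> \<le> ennreal (1 / P) * ennreal (C powr P)" by (intro mult_left_mono G) simp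
    also have "\<dots> = ennreal (1 / P * C powr P)" using P by (simp add: ennreal_mult[symmetric])
    also have "1 / P * C powr P = (hardy_factor p * C) powr P"
      using P C False by (simp add: hardy_factor_def powr_divide powr_mult powr_powr powr_minus_divide flip: P_def)
    finally have J: "(\<integral>\<^sup>+x. ?J x \<partial>lborel) \<le> ennreal ((hardy_factor p * C) powr P)" .
    have "(\<integral>\<^sup>+x. ennreal (\<bar>enn2real (ray g x)\<bar> powr P) * indicator S x \<partial>lborel) \<le> (\<integral>\<^sup>+x. ?J x \<partial>lborel)"
      using ray_Jensen(1)[OF P gm g] by (intro nn_integral_mono) (auto simp: indicator_def)
    with J have 1: "(\<integral>\<^sup>+x. ennreal (\<bar>enn2real (ray g x)\<bar> powr P) * indicator S x \<partial>lborel) \<le> ennreal ((hardy_factor p * C) powr P)"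
      by simp
    have "(\<integral>\<^sup>+x. ?J x \<partial>lborel) \<noteq> \<infinity>" using J by (auto simp: top_unique)
    then have "AE x in lborel. ?J x \<noteq> \<infinity>" by (intro nn_integral_noteq_infinite) auto
    then have "AE x in lborel. x \<in> S \<longrightarrow> ray g x < \<infinity>"
    proof eventually_elim
      case (elim x)
      show ?case
      proof
        assume x: "x \<in> S"
        show "ray g x < \<infinity>"
        proof (cases "lam x = 0")
          case False
          then have "0 < lam x" using l_S[OF x] by (auto simp: lam_def)
          then have "ray (\<lambda>x. g x powr P) x < \<infinity>"
            using elim x by (auto simp: ennreal_mult_eq_top_iff less_top)
          then show ?thesis by (rule ray_Jensen(2)[OF P gm g x])
        qed (use ray_zero[OF x] in simp)
      qed
    qed
    moreover have "0 \<le> hardy_factor p * C" using C by (simp add: hardy_factor_def)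
    ultimately show ?thesis using 1 False m SL
      by (simp add: Lp_le_def nn_integral_lebesgue_on P_def)
  qed
  then show "Lp_le p (lebesgue_on S) (\<lambda>x. enn2real (ray g x)) (hardy_factor p * C)"
    and "AE x in lborel. x \<in> S \<longrightarrow> ray g x < \<infinity>" by auto
qed

end

lemma AE_frontier_convex:
  fixes S :: "'a::euclidean_space set"
  assumes "convex S" shows "AE x in lborel. x \<notin> frontier S"
proof -
  have "frontier S \<in> null_sets lebesgue"
    using negligible_convex_frontier[OF assms] by (simp only: negligible_iff_null_sets)
  then have "AE x in lebesgue. x \<notin> frontier S" by (rule AE_not_in)
  then show ?thesis by (simp only: AE_completion_iff)
qed

text \<open>
  \<open>R\<close> is the simplex on the other side of \<open>F\<close>, and \<open>x \<mapsto> c + J (x - c)\<close> is the map from \<open>S\<close> onto \<open>R\<close> that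
  is the identity on \<open>F\<close>. The last assumption says that \<open>S \<union> R\<close> has no slit along \<open>F\<close>.
\<close>

locale folding = edge_direction S c E l for S :: "(real^'n) set" and c E l +
  fixes R :: "(real^'n) set" and J :: "real^'n \<Rightarrow> real^'n"
  assumes linear_J: "linear J" and bij_J: "bij J" and J_fix: "\<And>v. l v = 0 \<Longrightarrow> J v = v"
    and fold_image: "(\<lambda>x. c + J (x - c)) ` S = R"
    and foot_interior: "\<And>x. x \<in> interior S \<Longrightarrow> x - l (x - c) *\<^sub>R E \<in> interior (S \<union> R)"
begin

definition fold_map :: "real^'n \<Rightarrow> real^'n" where "fold_map x = c + J (x - c)"

lemma fold_map_inj: "fold_map x = fold_map y \<longleftrightarrow> x = y"
  using bij_J by (auto simp: fold_map_def bij_def dest: injD)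

lemma fold_map_mem_R: "fold_map x \<in> R \<longleftrightarrow> x \<in> S"
  using fold_map_inj unfolding fold_image[symmetric] by (auto simp: fold_map_def[symmetric])

lemma fold_map_image: "fold_map ` S = R"
  using fold_image by (simp add: fold_map_def[abs_def])

lemma continuous_fold_map: "continuous_on A fold_map"
proof -
  have "continuous_on UNIV J" using linear_J by (simp add: linear_continuous_on linear_conv_bounded_linear)
  from continuous_on_compose2[OF this, of A "\<lambda>x. x - c"]
  show ?thesis unfolding fold_map_def[abs_def] by (simp add: continuous_on_diff continuous_on_add)
qed

lemma fold_map_measurable [measurable]: "fold_map \<in> borel_measurable borel"
  by (intro borel_measurable_continuous_onI continuous_fold_map)

lemma compact_R: "compact R"
  using compact_continuous_image[OF continuous_fold_map compact_S] by (simp add: fold_map_image)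

lemma R_measurable [measurable]: "R \<in> sets borel"
  using compact_R by (simp add: borel_compact)

lemma convex_R: "convex R"
proof -
  have "R = (+) (c - J c) ` (J ` S)"
    unfolding fold_image[symmetric] image_image by (simp add: linear_diff[OF linear_J] algebra_simps)
  then show ?thesis using convex_S by (simp add: convex_linear_image linear_J convex_translation)
qed

lemma fold_map_diff: "fold_map (x - v) = fold_map x - J v"
proof -
  have "J (x - v - c) = J (x - c) - J v"
    using linear_diff[OF linear_J, of "x - c" v] by (simp add: algebra_simps)
  then show ?thesis by (simp add: fold_map_def)
qed

lemma fold_map_interior: "x \<in> interior S \<Longrightarrow> fold_map x \<in> interior R"
proof -
  assume x: "x \<in> interior S"
  have "open (fold_map ` interior S)"
    using continuous_fold_map fold_map_inj by (intro invariance_of_domain) (auto simp: inj_on_def)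
  moreover have "fold_map ` interior S \<subseteq> R" using interior_subset fold_map_image by blast
  ultimately show ?thesis using x interior_maximal by blast
qed

definition foot :: "real^'n \<Rightarrow> real^'n" where "foot x = x - lam x *\<^sub>R E"

lemma fold_map_foot: "fold_map (foot x) = foot x"
proof -
  have "l (foot x - c) = 0"
    using lam_shift[of "- lam x" x] by (simp add: lam_def foot_def)
  then show ?thesis using J_fix by (simp add: fold_map_def)
qed

text \<open>By convexity a segment from an interior point to a point of the set is interior except
  perhaps at its end. That end is the foot, common to both segments and covered by
  \<open>foot_interior\<close>.\<close>

lemma foot_segments:
  assumes x: "x \<in> interior S"
  shows "closed_segment x (foot x) \<subseteq> interior (S \<union> R)"
    "closed_segment (fold_map x) (foot x) \<subseteq> interior (S \<union> R)"
proof -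
  have f: "foot x \<in> interior (S \<union> R)" using foot_interior[OF x] by (simp add: foot_def lam_def)
  have fS: "foot x \<in> S" using foot_S x interior_subset by (auto simp: foot_def lam_def)
  then have fR: "foot x \<in> R" using fold_map_mem_R[of "foot x"] by (simp add: fold_map_foot)
  have "open_segment x (foot x) \<subseteq> interior S"
    using in_interior_closure_convex_segment[OF convex_S x] fS closure_subset by blast
  moreover have "open_segment (fold_map x) (foot x) \<subseteq> interior R"
    using in_interior_closure_convex_segment[OF convex_R fold_map_interior[OF x]] fR closure_subset by blast
  moreover have "interior S \<subseteq> interior (S \<union> R)" "interior R \<subseteq> interior (S \<union> R)"
    by (simp_all add: interior_mono)
  ultimately show "closed_segment x (foot x) \<subseteq> interior (S \<union> R)"
    "closed_segment (fold_map x) (foot x) \<subseteq> interior (S \<union> R)"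
    using f x fold_map_interior[OF x] unfolding closed_segment_eq_open by blast+
qed

text \<open>The reciprocal of the absolute determinant of \<open>J\<close>;
  \<open>measure_S_R\<close> identifies it with the volume of \<open>S\<close> over that of
  \<open>R\<close>.\<close>

definition fold_ratio :: real where
  "fold_ratio = (SOME \<kappa>. 0 < \<kappa> \<and> (\<forall>h\<in>borel_measurable borel.
    (\<integral>\<^sup>+x. h (c + J (x - c)) \<partial>lborel) = ennreal \<kappa> * (\<integral>\<^sup>+x. h x \<partial>lborel)))"

lemma fold_ratio_pos: "0 < fold_ratio"
  and nn_integral_fold: "h \<in> borel_measurable borel \<Longrightarrow>
    (\<integral>\<^sup>+x. h (fold_map x) \<partial>lborel) = ennreal fold_ratio * (\<integral>\<^sup>+x. h x \<partial>lborel)"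
  using someI_ex[OF nn_integral_affine_bij[OF linear_J bij_J, of c]]
  unfolding fold_ratio_def[symmetric] fold_map_def by blast+

lemma measure_S_R: "measure lebesgue S = fold_ratio * measure lebesgue R"
proof -
  have "emeasure lborel S = (\<integral>\<^sup>+x. indicator R (fold_map x) \<partial>lborel)"
  proof -
    have "(\<integral>\<^sup>+x. indicator R (fold_map x) \<partial>lborel) = (\<integral>\<^sup>+x. indicator S x \<partial>lborel)"
      by (intro nn_integral_cong) (simp add: indicator_def fold_map_mem_R)
    then show ?thesis by simp
  qed
  also have "\<dots> = ennreal fold_ratio * emeasure lborel R"
    by (subst nn_integral_fold) auto
  finally have "emeasure lborel S = ennreal fold_ratio * emeasure lborel R" .
  then have "measure lborel S = fold_ratio * measure lborel R"
    using fold_ratio_pos by (simp add: measure_def enn2real_mult)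
  then show ?thesis by simp
qed

text \<open>Substituting \<tau> = t * lam x passes from the unit parametrisation of a segment to
  that of \<open>ray\<close>; the length of the segment is \<open>lam x\<close> times
  \<open>K\<close>, and the factor \<open>lam x\<close> is consumed by the substitution.\<close>

lemma segment_le_ray:
  assumes [measurable]: "H \<in> borel_measurable borel" and H: "\<And>x. 0 \<le> H x" and K: "0 \<le> K" and lam: "0 \<le> lam x"
  shows "(\<integral>\<^sup>+t. indicator {0..1} t * ennreal (H (x - (t * lam x) *\<^sub>R E) * (lam x * K)) \<partial>lborel) \<le> ennreal K * ray H x"
proof (cases "lam x = 0")
  case False
  define f where "f = (\<lambda>\<tau>. ennreal (H (x - \<tau> *\<^sub>R E)) * indicator {0..lam x} \<tau>)"
  have [measurable]: "f \<in> borel_measurable borel" unfolding f_def by measurable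
  have "(\<integral>\<^sup>+t. indicator {0..1} t * ennreal (H (x - (t * lam x) *\<^sub>R E) * (lam x * K)) \<partial>lborel)
      = (\<integral>\<^sup>+t. ennreal K * (ennreal (lam x) * f (0 + lam x *\<^sub>R t)) \<partial>lborel)"
  proof (rule nn_integral_cong)
    fix t :: real
    have "indicator {0..lam x} (0 + lam x *\<^sub>R t) = (indicator {0..1} t :: ennreal)"
      using lam False by (auto simp: indicator_def zero_le_mult_iff)
    moreover have "ennreal (H (x - (t * lam x) *\<^sub>R E) * (lam x * K)) = ennreal K * (ennreal (lam x) * ennreal (H (x - (t * lam x) *\<^sub>R E)))"
      using H lam K by (simp add: ennreal_mult mult_ac)
    ultimately show "indicator {0..1} t * ennreal (H (x - (t * lam x) *\<^sub>R E) * (lam x * K))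
        = ennreal K * (ennreal (lam x) * f (0 + lam x *\<^sub>R t))"
      by (simp add: f_def mult_ac)
  qed
  also have "\<dots> = ennreal K * (ennreal (lam x) * (\<integral>\<^sup>+t. f (0 + lam x *\<^sub>R t) \<partial>lborel))"
    by (simp add: nn_integral_cmult)
  also have "ennreal (lam x) * (\<integral>\<^sup>+t. f (0 + lam x *\<^sub>R t) \<partial>lborel) = ray H x"
    using nn_integral_lborel_scale[of f "lam x" 0] False lam by (simp add: ray_def f_def)
  finally show ?thesis by simp
qed simp

text \<open>For the mollified functions, the differences between the foot and the two points
  \<open>x\<close> and \<open>fold_map x\<close> are bounded along the two segments, and the value
  at the foot cancels. Replacing the mollified data by \<open>W\<close> and \<open>D\<close> leaves
  errors that are small in L^1, so \<open>AE_le_L1_limit\<close> applies.\<close>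

lemma trace_pointwise:
  assumes W: "integrable lborel W" and D: "integrable lborel D"
    and weak: "\<And>\<phi> i. \<phi> \<in> test_functions (interior (S \<union> R)) \<Longrightarrow>
      (LINT x|lborel. W x * partial_derivative i \<phi> x) = - (LINT x|lborel. D x $ i * \<phi> x)"
  shows "AE x in lborel. x \<in> S \<longrightarrow> ennreal \<bar>W x - W (fold_map x)\<bar>
    \<le> ennreal (norm E) * ray (\<lambda>x. norm (D x)) x + ennreal (norm (J E)) * ray (\<lambda>x. norm (D (fold_map x))) x"
proof -
  have [measurable]: "W \<in> borel_measurable borel" "D \<in> borel_measurable borel" using W D by auto
  obtain f G where [measurable]: "\<And>k. f k \<in> borel_measurable borel" "\<And>k. G k \<in> borel_measurable borel"
    and lim: "(\<lambda>k. \<integral>\<^sup>+x. norm (f k x - W x) \<partial>lborel) \<longlonglongrightarrow> 0" "(\<lambda>k. \<integral>\<^sup>+x. norm (G k x - D x) \<partial>lborel) \<longlonglongrightarrow> 0"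
    and seg: "\<And>a b. closed_segment a b \<subseteq> interior (S \<union> R) \<Longrightarrow> \<forall>\<^sub>F k :: nat in sequentially. ennreal \<bar>f k b - f k a\<bar>
      \<le> (\<integral>\<^sup>+t. indicator {0..1} t * ennreal (norm (G k (a + t *\<^sub>R (b - a)) :: real^'n) * norm (b - a)) \<partial>lborel)"
    using mollified_approximation[OF open_interior W D weak] by blast
  define d where "d k x = \<bar>f k x - W x\<bar>" for k x
  define g where "g k x = norm (G k x - D x)" for k x
  have [measurable]: "\<And>k. d k \<in> borel_measurable borel" "\<And>k. g k \<in> borel_measurable borel"
    unfolding d_def[abs_def] g_def[abs_def] by measurable
  have nn: "0 \<le> d k x" "0 \<le> g k x" for k x by (auto simp: d_def g_def)
  let ?a = "\<lambda>x. ennreal \<bar>W x - W (fold_map x)\<bar> * indicator S x"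
  let ?b = "\<lambda>x. ennreal (norm E) * ray (\<lambda>x. norm (D x)) x + ennreal (norm (J E)) * ray (\<lambda>x. norm (D (fold_map x))) x"
  let ?e = "\<lambda>k x. ennreal (d k x) + ennreal (d k (fold_map x))
      + (ennreal (norm E) * (ray (g k) x * indicator S x) + ennreal (norm (J E)) * (ray (\<lambda>x. g k (fold_map x)) x * indicator S x))"
  have "AE x in lborel. ?a x \<le> ?b x"
  proof (rule AE_le_L1_limit[where e = ?e])
    show "?e k \<in> borel_measurable lborel" for k by measurable
    \<comment> \<open>In L^1 the fold costs \<open>fold_ratio\<close> and a ray costs at most 1, so
      every error is a fixed multiple of an error of \<open>f k\<close> or
      \<open>G k\<close>.\<close>
    have bd: "(\<integral>\<^sup>+x. ?e k x \<partial>lborel) \<le> (\<integral>\<^sup>+x. d k x \<partial>lborel) + ennreal fold_ratio * (\<integral>\<^sup>+x. d k x \<partial>lborel)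
        + (ennreal (norm E) * (\<integral>\<^sup>+x. g k x \<partial>lborel) + ennreal (norm (J E)) * (ennreal fold_ratio * (\<integral>\<^sup>+x. g k x \<partial>lborel)))" for k
    proof -
      have "(\<integral>\<^sup>+x. ?e k x \<partial>lborel) = (\<integral>\<^sup>+x. d k x \<partial>lborel) + (\<integral>\<^sup>+x. d k (fold_map x) \<partial>lborel)
          + (ennreal (norm E) * (\<integral>\<^sup>+x. ray (g k) x * indicator S x \<partial>lborel)
          + ennreal (norm (J E)) * (\<integral>\<^sup>+x. ray (\<lambda>x. g k (fold_map x)) x * indicator S x \<partial>lborel))"
        by (simp add: nn_integral_add nn_integral_cmult)
      moreover have "(\<integral>\<^sup>+x. d k (fold_map x) \<partial>lborel) = ennreal fold_ratio * (\<integral>\<^sup>+x. d k x \<partial>lborel)"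
        using nn_integral_fold[of "\<lambda>x. ennreal (d k x)"] by simp
      moreover have "(\<integral>\<^sup>+x. ray h x * indicator S x \<partial>lborel) \<le> (\<integral>\<^sup>+x. h x \<partial>lborel)"
        if "h \<in> borel_measurable borel" "\<And>x. 0 \<le> h x" for h
        by (rule order_trans[OF ray_L1[OF that]]) (auto intro!: nn_integral_mono simp: indicator_def)
      note this[of "g k"] this[of "\<lambda>x. g k (fold_map x)"]
      moreover have "(\<integral>\<^sup>+x. g k (fold_map x) \<partial>lborel) = ennreal fold_ratio * (\<integral>\<^sup>+x. g k x \<partial>lborel)"
        using nn_integral_fold[of "\<lambda>x. ennreal (g k x)"] by simp
      ultimately show ?thesis
        using nn by (auto intro!: add_mono mult_left_mono)
    qed
    have lim2: "(\<lambda>k. (\<integral>\<^sup>+x. d k x \<partial>lborel) + ennreal fold_ratio * (\<integral>\<^sup>+x. d k x \<partial>lborel)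
        + (ennreal (norm E) * (\<integral>\<^sup>+x. g k x \<partial>lborel) + ennreal (norm (J E)) * (ennreal fold_ratio * (\<integral>\<^sup>+x. g k x \<partial>lborel))))
        \<longlonglongrightarrow> 0 + ennreal fold_ratio * 0 + (ennreal (norm E) * 0 + ennreal (norm (J E)) * (ennreal fold_ratio * 0))"
      using lim unfolding d_def g_def real_norm_def
      by (intro tendsto_add tendsto_mult_ennreal tendsto_const) auto
    show "(\<lambda>k. \<integral>\<^sup>+x. ?e k x \<partial>lborel) \<longlonglongrightarrow> 0"
      by (rule tendsto_sandwich[where f = "\<lambda>_. 0", OF _ _ tendsto_const lim2[simplified]]) (use bd in auto)
    have "AE x in lborel. x \<notin> frontier S"
      by (rule AE_frontier_convex[OF convex_S])
    then show "AE x in lborel. \<forall>\<^sub>F k in sequentially. ?a x \<le> ?b x + ?e k x"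
    proof eventually_elim
      case (elim x)
      show ?case
      proof (cases "x \<in> S")
        case True
        then have x: "x \<in> interior S"
          using elim closure_subset by (auto simp: frontier_def)
        have lam: "0 \<le> lam x" using l_S[OF True] by (simp add: lam_def)
        show ?thesis
          using seg[OF foot_segments(1)[OF x]] seg[OF foot_segments(2)[OF x]]
        proof eventually_elim
          case (elim k)
          have "ennreal \<bar>f k (foot x) - f k x\<bar> \<le> ennreal (norm E) * ray (\<lambda>x. norm (G k x)) x"
            using elim(1) segment_le_ray[of "\<lambda>x. norm (G k x)" "norm E" x] lam
            by (simp add: foot_def)
          also have "\<dots> \<le> ennreal (norm E) * ray (\<lambda>x. norm (D x) + g k x) x"
            by (intro mult_left_mono ray_mono) (auto simp: g_def norm_triangle_sub add.commute)
          also have "\<dots> = ennreal (norm E) * ray (\<lambda>x. norm (D x)) x + ennreal (norm E) * ray (g k) x"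
            using nn by (subst ray_add) (auto simp: distrib_left)
          finally have 1: "ennreal \<bar>f k (foot x) - f k x\<bar>
            \<le> ennreal (norm E) * ray (\<lambda>x. norm (D x)) x + ennreal (norm E) * ray (g k) x" .
          have ft: "foot x - fold_map x = - (lam x *\<^sub>R J E)"
          proof -
            have "foot x = fold_map (x - lam x *\<^sub>R E)" using fold_map_foot[of x] by (simp add: foot_def)
            then have "foot x = fold_map x - lam x *\<^sub>R J E" by (simp only: fold_map_diff linear_scale[OF linear_J])
            then show ?thesis by simp
          qed
          \<comment> \<open>The fold is affine and fixes the foot, so the second segment is the
            image of the first and its points are \<open>fold_map\<close> of points on the ray
            through \<open>x\<close>.\<close>
          have "fold_map x + t *\<^sub>R (foot x - fold_map x) = fold_map (x - (t * lam x) *\<^sub>R E)" for t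
            unfolding ft by (simp add: fold_map_diff linear_scale[OF linear_J])
          then have "ennreal \<bar>f k (foot x) - f k (fold_map x)\<bar> \<le> ennreal (norm (J E)) * ray (\<lambda>x. norm (G k (fold_map x))) x"
            using elim(2) segment_le_ray[of "\<lambda>x. norm (G k (fold_map x))" "norm (J E)" x] lam
            by (simp add: ft)
          also have "\<dots> \<le> ennreal (norm (J E)) * ray (\<lambda>x. norm (D (fold_map x)) + g k (fold_map x)) x"
            by (intro mult_left_mono ray_mono) (auto simp: g_def norm_triangle_sub add.commute)
          also have "\<dots> = ennreal (norm (J E)) * ray (\<lambda>x. norm (D (fold_map x))) x
              + ennreal (norm (J E)) * ray (\<lambda>x. g k (fold_map x)) x"
            using nn by (subst ray_add) (auto simp: distrib_left)
          finally have 2: "ennreal \<bar>f k (foot x) - f k (fold_map x)\<bar> \<le> ennreal (norm (J E)) * ray (\<lambda>x. norm (D (fold_map x))) x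
              + ennreal (norm (J E)) * ray (\<lambda>x. g k (fold_map x)) x" .
          have "\<bar>W x - W (fold_map x)\<bar> \<le> (d k x + d k (fold_map x))
              + (\<bar>f k (foot x) - f k x\<bar> + \<bar>f k (foot x) - f k (fold_map x)\<bar>)"
            unfolding d_def by linarith
          then have "ennreal \<bar>W x - W (fold_map x)\<bar> \<le> ennreal ((d k x + d k (fold_map x))
              + (\<bar>f k (foot x) - f k x\<bar> + \<bar>f k (foot x) - f k (fold_map x)\<bar>))"
            by (rule ennreal_leI)
          also have "\<dots> = (ennreal (d k x) + ennreal (d k (fold_map x)))
              + (ennreal \<bar>f k (foot x) - f k x\<bar> + ennreal \<bar>f k (foot x) - f k (fold_map x)\<bar>)"
            using nn by (simp add: ennreal_plus add_nonneg_nonneg)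
          also have "\<dots> \<le> (ennreal (d k x) + ennreal (d k (fold_map x)))
              + ((ennreal (norm E) * ray (\<lambda>x. norm (D x)) x + ennreal (norm E) * ray (g k) x)
              + (ennreal (norm (J E)) * ray (\<lambda>x. norm (D (fold_map x))) x
              + ennreal (norm (J E)) * ray (\<lambda>x. g k (fold_map x)) x))"
            by (intro add_mono order_refl 1 2)
          finally show ?case using True by (simp add: add_ac)
        qed
      qed simp
    qed
  qed
  then show ?thesis by (auto simp: indicator_def elim!: eventually_mono)
qed

end

lemma AE_convex_interior:
  fixes X :: "(real^'n) set"
  assumes "convex X" "interior X \<subseteq> \<Omega>"
  shows "AE x in lborel. x \<in> X \<longrightarrow> x \<in> \<Omega>"
  using AE_frontier_convex[OF assms(1)]
proof eventually_elim
  case (elim x)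
  then show ?case using assms(2) closure_subset by (auto simp: frontier_def)
qed

lemma W1p_mem_Lp_convex:
  assumes p: "1 \<le> p" and \<Omega>: "open \<Omega>" and X: "compact X" "convex X" "interior X \<subseteq> \<Omega>" and v: "W1p p \<Omega> v Dv"
  shows "mem_Lp p X v" "mem_Lp p X Dv"
proof -
  have L: "X \<in> sets lebesgue" "\<Omega> \<in> sets lebesgue" using \<Omega> X by (auto simp: lmeasurable_compact fmeasurableD)
  have ae: "AE x in lborel. x \<in> X \<longrightarrow> x \<in> \<Omega> \<and> f x = f x" for f :: "real^'a \<Rightarrow> 'b"
    using AE_convex_interior[OF X(2,3)] by simp
  show "mem_Lp p X v" "mem_Lp p X Dv"
    using v by (auto simp: W1p_def intro!: mem_Lp_AE_subset(1)[OF p L _ ae])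
qed

lemma Lp_le_representative:
  fixes f :: "real^'n \<Rightarrow> 'b::euclidean_space"
  assumes p: "1 \<le> p" and X: "X \<in> sets lebesgue" and f: "mem_Lp p X f"
    and g: "g \<in> borel_measurable borel" and ae: "AE x in lborel. x \<in> X \<longrightarrow> f x = g x"
  shows "Lp_le p (lebesgue_on X) (\<lambda>x. norm (g x)) (Lp_norm p X f)"
proof (rule Lp_le_mono[OF mem_Lp_imp_Lp_le[OF p f] _ _ order_refl])
  have "(\<lambda>x. norm (g x)) \<in> borel_measurable borel" using g by measurable
  then show "(\<lambda>x. norm (g x)) \<in> borel_measurable (lebesgue_on X)"
    by (intro measurable_restrict_space1 measurable_completion) simp
  show "AE x in lebesgue_on X. \<bar>norm (g x)\<bar> \<le> \<bar>norm (f x)\<bar>"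
    unfolding AE_lebesgue_on[OF X] using ae by eventually_elim auto
qed

context folding
begin

lemma fold_Lp:
  assumes p: "1 \<le> p" and [measurable]: "h \<in> borel_measurable borel" and h: "\<And>x. 0 \<le> h x" and le: "Lp_le p (lebesgue_on R) h C"
  shows "Lp_le p (lebesgue_on S) (\<lambda>x. h (fold_map x)) (root_factor p fold_ratio * C)"
proof -
  have L: "S \<in> sets lebesgue" "R \<in> sets lebesgue" by simp_all
  have C: "0 \<le> C" using le by (simp add: Lp_le_def)
  have m: "(\<lambda>x. h (fold_map x)) \<in> borel_measurable (lebesgue_on S)"
    by (intro measurable_restrict_space1 measurable_completion) simp
  show ?thesis
  proof (cases "p = \<infinity>")
    case True
    have "AE x in lborel. x \<in> R \<longrightarrow> \<bar>h x\<bar> \<le> C"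
      using le True L by (simp add: Lp_le_def AE_lebesgue_on)
    \<comment> \<open>The excess over \<open>C\<close> expresses the almost everywhere bound as a
      vanishing integral, which \<open>nn_integral_fold\<close> can transport from \<open>R\<close>
      to \<open>S\<close>.\<close>
    then have "AE x in lborel. ennreal (max 0 (h x - C)) * indicator R x = 0"
      by eventually_elim (auto simp: indicator_def)
    then have "(\<integral>\<^sup>+x. ennreal (max 0 (h x - C)) * indicator R x \<partial>lborel) = 0"
      by (subst nn_integral_0_iff_AE) auto
    moreover have "(\<integral>\<^sup>+x. ennreal (max 0 (h (fold_map x) - C)) * indicator R (fold_map x) \<partial>lborel)
        = ennreal fold_ratio * (\<integral>\<^sup>+x. ennreal (max 0 (h x - C)) * indicator R x \<partial>lborel)"
      by (rule nn_integral_fold) measurable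
    ultimately have "(\<integral>\<^sup>+x. ennreal (max 0 (h (fold_map x) - C)) * indicator R (fold_map x) \<partial>lborel) = 0"
      by simp
    then have "AE x in lborel. ennreal (max 0 (h (fold_map x) - C)) * indicator R (fold_map x) = 0"
      by (subst (asm) nn_integral_0_iff_AE) auto
    then have "AE x in lborel. x \<in> S \<longrightarrow> \<bar>h (fold_map x)\<bar> \<le> C"
    proof eventually_elim
      case (elim x)
      show ?case
      proof
        assume "x \<in> S"
        then have "ennreal (max 0 (h (fold_map x) - C)) = 0" using elim by (simp add: fold_map_mem_R)
        then have "max 0 (h (fold_map x) - C) \<le> 0" by (simp only: ennreal_eq_0_iff)
        then show "\<bar>h (fold_map x)\<bar> \<le> C" using h[of "fold_map x"] by simp
      qed
    qed
    then show ?thesis using True m L C by (simp add: Lp_le_def AE_lebesgue_on root_factor_def)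
  next
    case False
    define P where "P = enn2real p"
    have G: "(\<integral>\<^sup>+x. ennreal (\<bar>h x\<bar> powr P) * indicator R x \<partial>lborel) \<le> ennreal (C powr P)"
      using le False L by (simp add: Lp_le_def nn_integral_lebesgue_on P_def)
    have "(\<integral>\<^sup>+x. ennreal (\<bar>h (fold_map x)\<bar> powr P) * indicator S x \<partial>lborel)
        = (\<integral>\<^sup>+x. ennreal (\<bar>h (fold_map x)\<bar> powr P) * indicator R (fold_map x) \<partial>lborel)"
      by (intro nn_integral_cong) (simp add: indicator_def fold_map_mem_R)
    also have "\<dots> = ennreal fold_ratio * (\<integral>\<^sup>+x. ennreal (\<bar>h x\<bar> powr P) * indicator R x \<partial>lborel)"
      by (rule nn_integral_fold) measurable
    also have "\<dots> \<le> ennreal fold_ratio * ennreal (C powr P)" by (intro mult_left_mono G) simp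
    also have "\<dots> = ennreal (fold_ratio * C powr P)" using fold_ratio_pos by (simp add: ennreal_mult)
    finally have le: "(\<integral>\<^sup>+x. ennreal (\<bar>h (fold_map x)\<bar> powr P) * indicator S x \<partial>lborel) \<le> ennreal (fold_ratio * C powr P)" .
    have "P \<noteq> 0" using enn2real_ge_1[OF p False] by (simp add: P_def)
    then have "(root_factor p fold_ratio * C) powr P = fold_ratio * C powr P"
      using False fold_ratio_pos by (simp add: root_factor_def powr_mult powr_powr flip: P_def)
    moreover have "0 \<le> root_factor p fold_ratio * C" using C by (simp add: root_factor_def)
    ultimately show ?thesis using le False m L by (simp add: Lp_le_def nn_integral_lebesgue_on flip: P_def)
  qed
qed

text \<open>Three summands bound |v| on \<open>S\<close>: the value at the folded point, the ray of
  the gradient and the ray of the folded gradient. \<open>fold_Lp\<close> turns norms of folded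
  functions into norms on \<open>R\<close> at the price of the volume ratio, and
  \<open>hardy_Lp\<close> is applied on \<open>S\<close> to both rays, also to the folded
  one.\<close>

lemma trace_estimate:
  assumes p: "1 \<le> p" and v: "W1p p (interior (S \<union> R)) v Dv"
  shows "Lp_norm p S v \<le> root_factor p fold_ratio * Lp_norm p R v
    + (norm E * hardy_factor p * Lp_norm p S Dv + norm (J E) * hardy_factor p * root_factor p fold_ratio * Lp_norm p R Dv)"
proof -
  let ?U = "interior (S \<union> R)"
  have L: "S \<in> sets lebesgue" "R \<in> sets lebesgue" by simp_all
  have "bounded (S \<union> R)" using compact_S compact_R compact_imp_bounded by auto
  then have U: "?U \<in> lmeasurable" by (intro lmeasurable_open) (auto intro: bounded_subset interior_subset)
  have sub: "interior S \<subseteq> ?U" "interior R \<subseteq> ?U" by (simp_all add: interior_mono)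
  note memS = W1p_mem_Lp_convex[OF p open_interior compact_S convex_S sub(1) v]
  note memR = W1p_mem_Lp_convex[OF p open_interior compact_R convex_R sub(2) v]
  obtain W D where W: "integrable lborel W" and D: "integrable lborel D"
    and ae: "AE x in lborel. x \<in> ?U \<longrightarrow> v x = W x" "AE x in lborel. x \<in> ?U \<longrightarrow> Dv x = D x"
    and weak: "\<And>\<phi> i. \<phi> \<in> test_functions ?U \<Longrightarrow>
      (LINT x|lborel. W x * partial_derivative i \<phi> x) = - (LINT x|lborel. D x $ i * \<phi> x)"
    using W1p_borel_representative[OF p open_interior U v] by blast
  have [measurable]: "W \<in> borel_measurable borel" "D \<in> borel_measurable borel" using W D by auto
  have aeS: "AE x in lborel. x \<in> S \<longrightarrow> v x = W x" "AE x in lborel. x \<in> S \<longrightarrow> Dv x = D x"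
    using AE_convex_interior[OF convex_S sub(1)] ae by (eventually_elim, blast)+
  have aeR: "AE x in lborel. x \<in> R \<longrightarrow> v x = W x" "AE x in lborel. x \<in> R \<longrightarrow> Dv x = D x"
    using AE_convex_interior[OF convex_R sub(2)] ae by (eventually_elim, blast)+
  let ?r = "root_factor p fold_ratio"
  have h1: "Lp_le p (lebesgue_on S) (\<lambda>x. norm (W (fold_map x))) (?r * Lp_norm p R v)"
    by (rule fold_Lp[OF p _ _ Lp_le_representative[OF p L(2) memR(1) _ aeR(1)]]) auto
  have h2: "Lp_le p (lebesgue_on S) (\<lambda>x. norm (D x)) (Lp_norm p S Dv)"
    by (rule Lp_le_representative[OF p L(1) memS(2) _ aeS(2)]) auto
  have h3: "Lp_le p (lebesgue_on S) (\<lambda>x. norm (D (fold_map x))) (?r * Lp_norm p R Dv)"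
    by (rule fold_Lp[OF p _ _ Lp_le_representative[OF p L(2) memR(2) _ aeR(2)]]) auto
  note H2 = hardy_Lp[OF p _ _ h2, simplified] and H3 = hardy_Lp[OF p _ _ h3, simplified]
  let ?g2 = "\<lambda>x. enn2real (ray (\<lambda>x. norm (D x)) x)" and ?g3 = "\<lambda>x. enn2real (ray (\<lambda>x. norm (D (fold_map x))) x)"
  have sum: "Lp_le p (lebesgue_on S) (\<lambda>x. norm (W (fold_map x)) + (norm E * ?g2 x + norm (J E) * ?g3 x))
     (?r * Lp_norm p R v + (norm E * (hardy_factor p * Lp_norm p S Dv) + norm (J E) * (hardy_factor p * (?r * Lp_norm p R Dv))))"
    by (intro Lp_le_add p h1 Lp_le_scale H2(1) H3(1)) auto
  have tp: "AE x in lborel. x \<in> S \<longrightarrow> ennreal \<bar>W x - W (fold_map x)\<bar>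
    \<le> ennreal (norm E) * ray (\<lambda>x. norm (D x)) x + ennreal (norm (J E)) * ray (\<lambda>x. norm (D (fold_map x))) x"
    by (rule trace_pointwise[OF W D]) (rule weak)
  have "AE x in lborel. x \<in> S \<longrightarrow> \<bar>v x\<bar> \<le> norm (W (fold_map x)) + (norm E * ?g2 x + norm (J E) * ?g3 x)"
    using tp aeS(1) H2(2) H3(2)
  proof eventually_elim
    case (elim x)
    show ?case
    proof
      assume x: "x \<in> S"
      then have "ray (\<lambda>x. norm (D x)) x = ennreal (?g2 x)" "ray (\<lambda>x. norm (D (fold_map x))) x = ennreal (?g3 x)"
        using elim by simp_all
      then have "ennreal \<bar>W x - W (fold_map x)\<bar> \<le> ennreal (norm E) * ennreal (?g2 x) + ennreal (norm (J E)) * ennreal (?g3 x)"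
        using elim(1) x by simp
      also have "\<dots> = ennreal (norm E * ?g2 x + norm (J E) * ?g3 x)"
        by (simp add: ennreal_plus ennreal_mult)
      finally have "\<bar>W x - W (fold_map x)\<bar> \<le> norm E * ?g2 x + norm (J E) * ?g3 x"
        by (subst (asm) ennreal_le_iff) auto
      then show "\<bar>v x\<bar> \<le> norm (W (fold_map x)) + (norm E * ?g2 x + norm (J E) * ?g3 x)"
        using elim(2) x by simp
    qed
  qed
  then have ae': "AE x in lebesgue_on S. \<bar>norm (v x)\<bar> \<le> \<bar>norm (W (fold_map x)) + (norm E * ?g2 x + norm (J E) * ?g3 x)\<bar>"
    unfolding AE_lebesgue_on[OF L(1)] by eventually_elim auto
  have vm: "v \<in> borel_measurable (lebesgue_on S)" using memS(1) by (simp add: mem_Lp_def)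
  then have vm': "(\<lambda>x. norm (v x)) \<in> borel_measurable (lebesgue_on S)" by measurable
  have "Lp_norm p S v \<le> ?r * Lp_norm p R v + (norm E * (hardy_factor p * Lp_norm p S Dv) + norm (J E) * (hardy_factor p * (?r * Lp_norm p R Dv)))"
    by (rule Lp_le_imp_mem_Lp(2)[OF p vm Lp_le_mono[OF sum _ ae' order_refl]]) (rule vm')
  then show ?thesis by (simp add: mult.assoc)
qed

end

section \<open>The Poincare inequality on convex bodies\<close>

definition segment_mean :: "(real^'n \<Rightarrow> real) \<Rightarrow> real^'n \<Rightarrow> real^'n \<Rightarrow> ennreal" where
  "segment_mean h x y = (\<integral>\<^sup>+t. ennreal (h (x + t *\<^sub>R (y - x))) * indicator {0..1} t \<partial>lborel)"

lemma segment_mean_measurable [measurable]: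
  assumes [measurable]: "h \<in> borel_measurable borel"
  shows "(\<lambda>z. segment_mean h (fst z) (snd z)) \<in> borel_measurable (borel \<Otimes>\<^sub>M borel)"
proof -
  have "(\<lambda>z. segment_mean h (fst z) (snd z))
      = (\<lambda>z. \<integral>\<^sup>+t. (if 0 \<le> t \<and> t \<le> 1 then ennreal (h (fst z + t *\<^sub>R (snd z - fst z))) else 0) \<partial>lborel)"
    unfolding segment_mean_def by (intro ext nn_integral_cong) (auto simp: indicator_def)
  then show ?thesis by simp
qed

text \<open>Scaling by \<open>c\<close> multiplies volumes by c^n >= 2^(-n). This is the origin of
  the power of 2 in \<open>poincare_convex\<close>.\<close>

lemma nn_integral_homothety_le:
  fixes f :: "real^'n \<Rightarrow> ennreal"
  assumes f: "f \<in> borel_measurable borel" and c: "1 / 2 \<le> c"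
  shows "(\<integral>\<^sup>+x. f (a + c *\<^sub>R x) \<partial>lborel) \<le> ennreal (2 ^ CARD('n)) * (\<integral>\<^sup>+x. f x \<partial>lborel)"
proof -
  let ?I = "\<integral>\<^sup>+x. f (a + c *\<^sub>R x) \<partial>lborel"
  have eq: "(\<integral>\<^sup>+x. f x \<partial>lborel) = ennreal (\<bar>c\<bar> ^ CARD('n)) * ?I"
    using nn_integral_lborel_scale[OF f, of c a] c by simp
  have "1 \<le> 2 ^ CARD('n) * \<bar>c\<bar> ^ CARD('n)"
    using c one_le_power[of "2 * c" "CARD('n)"] by (simp add: power_mult_distrib)
  then have "ennreal 1 * ?I \<le> ennreal (2 ^ CARD('n) * \<bar>c\<bar> ^ CARD('n)) * ?I"
    by (intro mult_right_mono ennreal_leI) auto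
  also have "\<dots> = ennreal (2 ^ CARD('n)) * (ennreal (\<bar>c\<bar> ^ CARD('n)) * ?I)"
    by (simp add: ennreal_mult mult.assoc)
  finally show ?thesis by (simp add: eq)
qed

text \<open>For \<open>t \<le> 1/2\<close> the map \<open>x \<mapsto> x + t (y - x)\<close> contracts by at most a factor 2, and for \<open>t \<ge> 1/2\<close>
  the same holds for the dependence on \<open>y\<close>.\<close>

lemma segment_mean_L1:
  fixes S :: "(real^'n) set"
  assumes [measurable]: "h \<in> borel_measurable borel" "S \<in> sets borel"
  shows "(\<integral>\<^sup>+x. (\<integral>\<^sup>+y. indicator S x * indicator S y * segment_mean h x y \<partial>lborel) \<partial>lborel)
    \<le> ennreal (2 ^ CARD('n)) * emeasure lborel S * (\<integral>\<^sup>+x. ennreal (h x) \<partial>lborel)"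
proof -
  let ?K = "ennreal (2 ^ CARD('n)) * emeasure lborel S * (\<integral>\<^sup>+x. ennreal (h x) \<partial>lborel)"
  let ?F = "\<lambda>t x y. indicator S x * indicator S y * ennreal (h (x + t *\<^sub>R (y - x)))"
  have t: "(\<integral>\<^sup>+x. (\<integral>\<^sup>+y. ?F t x y \<partial>lborel) \<partial>lborel) \<le> ?K" if "t \<in> {0..1}" for t
  proof (cases "t \<le> 1 / 2")
    case True
    have "(\<integral>\<^sup>+x. (\<integral>\<^sup>+y. ?F t x y \<partial>lborel) \<partial>lborel) = (\<integral>\<^sup>+y. (\<integral>\<^sup>+x. ?F t x y \<partial>lborel) \<partial>lborel)"
      by (rule lborel_pair.Fubini') measurable
    also have "\<dots> \<le> (\<integral>\<^sup>+y. indicator S y * (ennreal (2 ^ CARD('n)) * (\<integral>\<^sup>+x. ennreal (h x) \<partial>lborel)) \<partial>lborel)"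
    proof (rule nn_integral_mono)
      fix y
      have "(\<integral>\<^sup>+x. ?F t x y \<partial>lborel) \<le> (\<integral>\<^sup>+x. indicator S y * ennreal (h (t *\<^sub>R y + (1 - t) *\<^sub>R x)) \<partial>lborel)"
        by (intro nn_integral_mono) (auto simp: indicator_def algebra_simps)
      also have "\<dots> = indicator S y * (\<integral>\<^sup>+x. ennreal (h (t *\<^sub>R y + (1 - t) *\<^sub>R x)) \<partial>lborel)"
        by (rule nn_integral_cmult) measurable
      also have "\<dots> \<le> indicator S y * (ennreal (2 ^ CARD('n)) * (\<integral>\<^sup>+x. ennreal (h x) \<partial>lborel))"
        using True by (intro mult_left_mono nn_integral_homothety_le) auto
      finally show "(\<integral>\<^sup>+x. ?F t x y \<partial>lborel) \<le> indicator S y * (ennreal (2 ^ CARD('n)) * (\<integral>\<^sup>+x. ennreal (h x) \<partial>lborel))" .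
    qed
    also have "\<dots> = ?K" by (simp add: nn_integral_multc mult_ac)
    finally show ?thesis .
  next
    case False
    have "(\<integral>\<^sup>+x. (\<integral>\<^sup>+y. ?F t x y \<partial>lborel) \<partial>lborel)
        \<le> (\<integral>\<^sup>+x. indicator S x * (ennreal (2 ^ CARD('n)) * (\<integral>\<^sup>+x. ennreal (h x) \<partial>lborel)) \<partial>lborel)"
    proof (rule nn_integral_mono)
      fix x
      have "(\<integral>\<^sup>+y. ?F t x y \<partial>lborel) \<le> (\<integral>\<^sup>+y. indicator S x * ennreal (h ((1 - t) *\<^sub>R x + t *\<^sub>R y)) \<partial>lborel)"
        by (intro nn_integral_mono) (auto simp: indicator_def algebra_simps)
      also have "\<dots> = indicator S x * (\<integral>\<^sup>+y. ennreal (h ((1 - t) *\<^sub>R x + t *\<^sub>R y)) \<partial>lborel)"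
        by (rule nn_integral_cmult) measurable
      also have "\<dots> \<le> indicator S x * (ennreal (2 ^ CARD('n)) * (\<integral>\<^sup>+x. ennreal (h x) \<partial>lborel))"
        using False by (intro mult_left_mono nn_integral_homothety_le) auto
      finally show "(\<integral>\<^sup>+y. ?F t x y \<partial>lborel) \<le> indicator S x * (ennreal (2 ^ CARD('n)) * (\<integral>\<^sup>+x. ennreal (h x) \<partial>lborel))" .
    qed
    also have "\<dots> = ?K" by (simp add: nn_integral_multc mult_ac)
    finally show ?thesis .
  qed
  let ?G = "\<lambda>t x y. if 0 \<le> t \<and> t \<le> 1 then ?F t x y else 0"
  have "(\<integral>\<^sup>+x. (\<integral>\<^sup>+y. indicator S x * indicator S y * segment_mean h x y \<partial>lborel) \<partial>lborel)
      = (\<integral>\<^sup>+x. (\<integral>\<^sup>+y. (\<integral>\<^sup>+t. ?G t x y \<partial>lborel) \<partial>lborel) \<partial>lborel)"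
  proof (intro nn_integral_cong)
    fix x y
    have "indicator S x * indicator S y * segment_mean h x y
        = (\<integral>\<^sup>+t. indicator S x * indicator S y * (ennreal (h (x + t *\<^sub>R (y - x))) * indicator {0..1} t) \<partial>lborel)"
      unfolding segment_mean_def by (rule nn_integral_cmult[symmetric]) measurable
    also have "\<dots> = (\<integral>\<^sup>+t. ?G t x y \<partial>lborel)"
      by (intro nn_integral_cong) (auto simp: indicator_def)
    finally show "indicator S x * indicator S y * segment_mean h x y = (\<integral>\<^sup>+t. ?G t x y \<partial>lborel)" .
  qed
  also have "\<dots> = (\<integral>\<^sup>+x. (\<integral>\<^sup>+t. (\<integral>\<^sup>+y. ?G t x y \<partial>lborel) \<partial>lborel) \<partial>lborel)"
    by (intro nn_integral_cong lborel_pair.Fubini') measurable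
  also have "\<dots> = (\<integral>\<^sup>+t. (\<integral>\<^sup>+x. (\<integral>\<^sup>+y. ?G t x y \<partial>lborel) \<partial>lborel) \<partial>lborel)"
    by (rule lborel_pair.Fubini') measurable
  also have "\<dots> \<le> (\<integral>\<^sup>+t. ?K * indicator {0..1} t \<partial>(lborel :: real measure))"
  proof (rule nn_integral_mono)
    fix t :: real
    show "(\<integral>\<^sup>+x. (\<integral>\<^sup>+y. ?G t x y \<partial>lborel) \<partial>lborel) \<le> ?K * indicator {0..1} t"
      using t[of t] by (cases "t \<in> {0..1}") auto
  qed
  also have "\<dots> = ?K" by (simp add: nn_integral_cmult)
  finally show ?thesis .
qed

lemma segment_mean_bound:
  assumes "convex S" "x \<in> S" "y \<in> S" "\<And>z. z \<in> S \<Longrightarrow> g z \<le> h z"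
  shows "segment_mean g x y \<le> segment_mean h x y"
  unfolding segment_mean_def
proof (rule nn_integral_mono)
  fix t :: real
  have "x + t *\<^sub>R (y - x) \<in> S" if "t \<in> {0..1}"
  proof -
    have "(1 - t) *\<^sub>R x + t *\<^sub>R y \<in> S" using assms that by (intro convexD_alt) auto
    then show ?thesis by (simp add: algebra_simps)
  qed
  then show "ennreal (g (x + t *\<^sub>R (y - x))) * indicator {0..1} t \<le> ennreal (h (x + t *\<^sub>R (y - x))) * indicator {0..1} t"
    using assms(4) by (auto simp: indicator_def intro!: ennreal_leI)
qed

lemma segment_mean_add:
  assumes [measurable]: "g \<in> borel_measurable borel" "h \<in> borel_measurable borel"
    and "\<And>x. 0 \<le> g x" "\<And>x. 0 \<le> h x"
  shows "segment_mean (\<lambda>x. g x + h x) x y = segment_mean g x y + segment_mean h x y"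
  unfolding segment_mean_def using assms(3,4) by (subst nn_integral_add[symmetric]) (auto simp: distrib_right)

lemma segment_mean_const: "0 \<le> a \<Longrightarrow> segment_mean (\<lambda>_. a) x y = ennreal a"
  unfolding segment_mean_def by (subst nn_integral_cmult_indicator) auto

lemma segment_mean_Jensen:
  assumes P: "1 \<le> P" and [measurable]: "g \<in> borel_measurable borel" and g: "\<And>x. 0 \<le> g x"
    and fin: "segment_mean (\<lambda>x. g x powr P) x y < \<infinity>"
  shows "ennreal (enn2real (segment_mean g x y) powr P) \<le> segment_mean (\<lambda>x. g x powr P) x y"
    and "segment_mean g x y < \<infinity>"
proof -
  let ?M = "restrict_space lborel {0..1::real}"
  have r: "segment_mean h x y = (\<integral>\<^sup>+t. ennreal (h (x + t *\<^sub>R (y - x))) \<partial>?M)" for h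
    unfolding segment_mean_def by (rule nn_integral_restrict_space[symmetric]) simp
  have m: "(\<lambda>t. g (x + t *\<^sub>R (y - x))) \<in> borel_measurable ?M"
    by (intro measurable_restrict_space1) measurable
  have sp: "emeasure ?M (space ?M) = ennreal 1"
    by (simp add: emeasure_restrict_space space_restrict_space)
  show "ennreal (enn2real (segment_mean g x y) powr P) \<le> segment_mean (\<lambda>x. g x powr P) x y"
    "segment_mean g x y < \<infinity>"
    using nn_integral_Jensen_powr[OF P m g sp zero_less_one] fin unfolding r by simp_all
qed

text \<open>The limit argument of \<open>trace_pointwise\<close>, now in the product space: the
  exceptional pairs form a null set there, \<open>segment_mean_L1\<close> controls the error of the
  gradient, and the length of a segment is replaced by the diameter.\<close>

lemma segment_pointwise:
  fixes S :: "(real^'n) set"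
  assumes S: "compact S" "convex S" and W: "integrable lborel W" and D: "integrable lborel D"
    and weak: "\<And>\<phi> i. \<phi> \<in> test_functions (interior S) \<Longrightarrow>
      (LINT x|lborel. W x * partial_derivative i \<phi> x) = - (LINT x|lborel. D x $ i * \<phi> x)"
  shows "AE z in lborel \<Otimes>\<^sub>M lborel. fst z \<in> S \<and> snd z \<in> S \<longrightarrow> ennreal \<bar>W (fst z) - W (snd z)\<bar>
    \<le> ennreal (diameter S) * segment_mean (\<lambda>x. norm (D x)) (fst z) (snd z)"
proof -
  have [measurable]: "W \<in> borel_measurable borel" "D \<in> borel_measurable borel" using W D by auto
  have [measurable]: "S \<in> sets borel" using S by (simp add: borel_compact)
  have V: "emeasure lborel S < \<infinity>" using S compact_imp_bounded emeasure_bounded_finite by blast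
  have d: "0 \<le> diameter S" using S compact_imp_bounded diameter_ge_0 by blast
  obtain f G where [measurable]: "\<And>k. f k \<in> borel_measurable borel" "\<And>k. G k \<in> borel_measurable borel"
    and lim: "(\<lambda>k. \<integral>\<^sup>+x. norm (f k x - W x) \<partial>lborel) \<longlonglongrightarrow> 0" "(\<lambda>k. \<integral>\<^sup>+x. norm (G k x - D x) \<partial>lborel) \<longlonglongrightarrow> 0"
    and seg: "\<And>a b. closed_segment a b \<subseteq> interior S \<Longrightarrow> \<forall>\<^sub>F k :: nat in sequentially. ennreal \<bar>f k b - f k a\<bar>
      \<le> (\<integral>\<^sup>+t. indicator {0..1} t * ennreal (norm (G k (a + t *\<^sub>R (b - a)) :: real^'n) * norm (b - a)) \<partial>lborel)"
    using mollified_approximation[OF open_interior W D weak] by blast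
  define e where "e k x = \<bar>f k x - W x\<bar>" for k x
  define g where "g k x = norm (G k x - D x)" for k x
  have [measurable]: "\<And>k. e k \<in> borel_measurable borel" "\<And>k. g k \<in> borel_measurable borel"
    unfolding e_def[abs_def] g_def[abs_def] by measurable
  have nn: "0 \<le> e k x" "0 \<le> g k x" for k x by (auto simp: e_def g_def)
  let ?a = "\<lambda>z. ennreal \<bar>W (fst z) - W (snd z)\<bar> * (indicator S (fst z) * indicator S (snd z))"
  let ?b = "\<lambda>z. ennreal (diameter S) * segment_mean (\<lambda>x. norm (D x)) (fst z) (snd z)"
  let ?e = "\<lambda>k z. indicator S (fst z) * indicator S (snd z) * ennreal (e k (fst z))
    + indicator S (fst z) * indicator S (snd z) * ennreal (e k (snd z))
    + ennreal (diameter S) * (indicator S (fst z) * indicator S (snd z) * segment_mean (g k) (fst z) (snd z))"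
  have "AE z in lborel \<Otimes>\<^sub>M lborel. ?a z \<le> ?b z"
  proof (rule AE_le_L1_limit[where e = ?e])
    show "?e k \<in> borel_measurable (lborel \<Otimes>\<^sub>M lborel)" for k by measurable
    have bd: "(\<integral>\<^sup>+z. ?e k z \<partial>(lborel \<Otimes>\<^sub>M lborel)) \<le> emeasure lborel S * (\<integral>\<^sup>+x. e k x \<partial>lborel) + emeasure lborel S * (\<integral>\<^sup>+x. e k x \<partial>lborel)
        + ennreal (diameter S) * (ennreal (2 ^ CARD('n)) * emeasure lborel S * (\<integral>\<^sup>+x. g k x \<partial>lborel))" for k
    proof -
      have "(\<integral>\<^sup>+z. ?e k z \<partial>(lborel \<Otimes>\<^sub>M lborel))
          = (\<integral>\<^sup>+z. indicator S (fst z) * indicator S (snd z) * ennreal (e k (fst z)) \<partial>(lborel \<Otimes>\<^sub>M lborel))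
          + (\<integral>\<^sup>+z. indicator S (fst z) * indicator S (snd z) * ennreal (e k (snd z)) \<partial>(lborel \<Otimes>\<^sub>M lborel))
          + ennreal (diameter S) * (\<integral>\<^sup>+z. indicator S (fst z) * indicator S (snd z) * segment_mean (g k) (fst z) (snd z) \<partial>(lborel \<Otimes>\<^sub>M lborel))"
        by (simp add: nn_integral_add nn_integral_cmult)
      also have "(\<integral>\<^sup>+z. indicator S (fst z) * indicator S (snd z) * ennreal (e k (fst z)) \<partial>(lborel \<Otimes>\<^sub>M lborel))
          \<le> emeasure lborel S * (\<integral>\<^sup>+x. e k x \<partial>lborel)"
      proof -
        have "(\<integral>\<^sup>+z. indicator S (fst z) * indicator S (snd z) * ennreal (e k (fst z)) \<partial>(lborel \<Otimes>\<^sub>M lborel))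
          = (\<integral>\<^sup>+x. (\<integral>\<^sup>+y. (indicator S x * ennreal (e k x)) * indicator S y \<partial>lborel) \<partial>lborel)"
          by (subst lborel.nn_integral_fst[symmetric]) (auto intro!: nn_integral_cong simp: mult_ac)
        also have "\<dots> = emeasure lborel S * (\<integral>\<^sup>+x. indicator S x * ennreal (e k x) \<partial>lborel)"
          by (simp add: nn_integral_cmult nn_integral_multc mult.commute)
        also have "\<dots> \<le> emeasure lborel S * (\<integral>\<^sup>+x. e k x \<partial>lborel)"
          by (intro mult_left_mono nn_integral_mono) (auto simp: indicator_def)
        finally show ?thesis .
      qed
      also have "(\<integral>\<^sup>+z. indicator S (fst z) * indicator S (snd z) * ennreal (e k (snd z)) \<partial>(lborel \<Otimes>\<^sub>M lborel))
          \<le> emeasure lborel S * (\<integral>\<^sup>+x. e k x \<partial>lborel)"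
      proof -
        have "(\<integral>\<^sup>+z. indicator S (fst z) * indicator S (snd z) * ennreal (e k (snd z)) \<partial>(lborel \<Otimes>\<^sub>M lborel))
          = (\<integral>\<^sup>+x. (\<integral>\<^sup>+y. indicator S x * (indicator S y * ennreal (e k y)) \<partial>lborel) \<partial>lborel)"
          by (subst lborel.nn_integral_fst[symmetric]) (auto intro!: nn_integral_cong simp: mult_ac)
        also have "\<dots> = emeasure lborel S * (\<integral>\<^sup>+x. indicator S x * ennreal (e k x) \<partial>lborel)"
          by (simp add: nn_integral_cmult nn_integral_multc)
        also have "\<dots> \<le> emeasure lborel S * (\<integral>\<^sup>+x. e k x \<partial>lborel)"
          by (intro mult_left_mono nn_integral_mono) (auto simp: indicator_def)
        finally show ?thesis .
      qed
      also have "(\<integral>\<^sup>+z. indicator S (fst z) * indicator S (snd z) * segment_mean (g k) (fst z) (snd z) \<partial>(lborel \<Otimes>\<^sub>M lborel))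
          \<le> ennreal (2 ^ CARD('n)) * emeasure lborel S * (\<integral>\<^sup>+x. g k x \<partial>lborel)"
        using segment_mean_L1[of "g k" S] by (subst lborel.nn_integral_fst[symmetric]) auto
      finally show ?thesis by (simp add: add_mono mult_left_mono)
    qed
    have lim2: "(\<lambda>k. emeasure lborel S * (\<integral>\<^sup>+x. e k x \<partial>lborel) + emeasure lborel S * (\<integral>\<^sup>+x. e k x \<partial>lborel)
        + ennreal (diameter S) * (ennreal (2 ^ CARD('n)) * emeasure lborel S * (\<integral>\<^sup>+x. g k x \<partial>lborel)))
        \<longlonglongrightarrow> emeasure lborel S * 0 + emeasure lborel S * 0 + ennreal (diameter S) * (ennreal (2 ^ CARD('n)) * emeasure lborel S * 0)"
      using lim V unfolding e_def g_def real_norm_def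
      by (intro tendsto_add tendsto_mult_ennreal tendsto_const) (auto simp: ennreal_mult_eq_top_iff)
    show "(\<lambda>k. \<integral>\<^sup>+z. ?e k z \<partial>(lborel \<Otimes>\<^sub>M lborel)) \<longlonglongrightarrow> 0"
      by (rule tendsto_sandwich[where f = "\<lambda>_. 0", OF _ _ tendsto_const lim2[simplified]]) (use bd in auto)
    have [measurable]: "frontier S \<in> sets borel" by (simp add: borel_closed)
    have fr: "AE x in lborel. x \<notin> frontier S" by (rule AE_frontier_convex[OF S(2)])
    have "AE z in lborel \<Otimes>\<^sub>M lborel. fst z \<notin> frontier S \<and> snd z \<notin> frontier S"
    proof (rule lborel_pair.AE_pair_measure)
      show "{z \<in> space (lborel \<Otimes>\<^sub>M lborel). fst z \<notin> frontier S \<and> snd z \<notin> frontier S} \<in> sets (lborel \<Otimes>\<^sub>M lborel)"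
        by measurable
      show "AE x in lborel. AE y in lborel. fst (x, y) \<notin> frontier S \<and> snd (x, y) \<notin> frontier S"
        using fr by eventually_elim (use fr in \<open>auto elim: eventually_mono\<close>)
    qed
    then show "AE z in lborel \<Otimes>\<^sub>M lborel. \<forall>\<^sub>F k in sequentially. ?a z \<le> ?b z + ?e k z"
    proof eventually_elim
      case (elim z)
      obtain x y where z: "z = (x, y)" by (cases z)
      show ?case
      proof (cases "x \<in> S \<and> y \<in> S")
        case True
        then have xy: "x \<in> interior S" "y \<in> interior S"
          using elim closure_subset by (auto simp: frontier_def z)
        have "closed_segment x y \<subseteq> interior S"
          using xy convex_interior[OF S(2)] by (intro closed_segment_subset)
        then have "\<forall>\<^sub>F k in sequentially. ennreal \<bar>f k y - f k x\<bar>
          \<le> (\<integral>\<^sup>+t. indicator {0..1} t * ennreal (norm (G k (x + t *\<^sub>R (y - x))) * norm (y - x)) \<partial>lborel)"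
          by (rule seg)
        then show ?thesis
        proof eventually_elim
          case (elim k)
          have dist: "norm (y - x) \<le> diameter S"
            using diameter_bounded_bound[OF compact_imp_bounded[OF S(1)], of y x] True by (simp add: dist_norm)
          have "ennreal \<bar>f k y - f k x\<bar> \<le> (\<integral>\<^sup>+t. ennreal (diameter S) * (ennreal (norm (G k (x + t *\<^sub>R (y - x)))) * indicator {0..1} t) \<partial>lborel)"
            using dist d
            by (intro order_trans[OF elim] nn_integral_mono)
              (auto simp: indicator_def ennreal_mult[symmetric] mult.commute[of "norm (G _ _)"] intro!: ennreal_leI mult_right_mono)
          also have "\<dots> = ennreal (diameter S) * segment_mean (\<lambda>x. norm (G k x)) x y"
            unfolding segment_mean_def by (rule nn_integral_cmult) measurable
          also have "\<dots> \<le> ennreal (diameter S) * segment_mean (\<lambda>x. norm (D x) + g k x) x y"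
            by (intro mult_left_mono segment_mean_bound[OF convex_UNIV]) (auto simp: g_def norm_triangle_sub add.commute)
          also have "\<dots> = ennreal (diameter S) * segment_mean (\<lambda>x. norm (D x)) x y + ennreal (diameter S) * segment_mean (g k) x y"
            using nn by (subst segment_mean_add) (auto simp: distrib_left)
          finally have 1: "ennreal \<bar>f k y - f k x\<bar> \<le> ennreal (diameter S) * segment_mean (\<lambda>x. norm (D x)) x y + ennreal (diameter S) * segment_mean (g k) x y" .
          have "\<bar>W x - W y\<bar> \<le> e k x + e k y + \<bar>f k y - f k x\<bar>"
            unfolding e_def by linarith
          then have "ennreal \<bar>W x - W y\<bar> \<le> ennreal (e k x + e k y + \<bar>f k y - f k x\<bar>)"
            by (rule ennreal_leI)
          also have "\<dots> = ennreal (e k x) + ennreal (e k y) + ennreal \<bar>f k y - f k x\<bar>"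
            using nn by (simp add: ennreal_plus add_nonneg_nonneg)
          also have "\<dots> \<le> ennreal (e k x) + ennreal (e k y)
            + (ennreal (diameter S) * segment_mean (\<lambda>x. norm (D x)) x y + ennreal (diameter S) * segment_mean (g k) x y)"
            by (intro add_mono order_refl 1)
          finally show ?case using True by (simp add: z add_ac)
        qed
      qed (auto simp: z)
    qed
  qed
  then show ?thesis by (auto simp: indicator_def elim!: eventually_mono)
qed

lemma AE_not_null_ex:
  assumes "AE x in lborel. x \<in> S \<longrightarrow> Q x" "emeasure lborel S \<noteq> 0" "S \<in> sets borel"
  shows "\<exists>x\<in>S. Q x"
proof (rule ccontr)
  assume "\<not> ?thesis"
  then have "AE x in lborel. x \<notin> S" using assms(1) by (auto elim: eventually_mono)
  then have "emeasure lborel S = 0" using assms(3) by (subst (asm) AE_iff_measurable[OF _ refl]) auto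
  then show False using assms(2) by simp
qed

text \<open>If \<open>F\<close> exceeded \<open>B\<close> on all of \<open>S\<close>, a set of
  positive finite measure, its integral would strictly exceed \<open>V * B\<close>.\<close>

lemma ex_point_le_mean:
  assumes [measurable]: "S \<in> sets borel" "F \<in> borel_measurable borel"
    and V: "emeasure lborel S = ennreal V" "0 < V" and B: "0 \<le> B"
    and le: "(\<integral>\<^sup>+x. indicator S x * F x \<partial>lborel) \<le> ennreal (V * B)"
  shows "\<exists>x\<in>S. F x \<le> ennreal B"
proof (rule ccontr)
  assume "\<not> ?thesis"
  then have gt: "AE x in lborel. x \<in> S \<longrightarrow> ennreal B < F x" by (intro AE_I2) auto
  have "(\<integral>\<^sup>+x. indicator S x * ennreal B \<partial>lborel) < (\<integral>\<^sup>+x. indicator S x * F x \<partial>lborel)"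
  proof (rule nn_integral_less)
    show "(\<integral>\<^sup>+x. indicator S x * ennreal B \<partial>lborel) \<noteq> \<infinity>"
      using V by (simp add: nn_integral_multc ennreal_mult_eq_top_iff)
    show "AE x in lborel. indicator S x * ennreal B \<le> indicator S x * F x"
      using gt by eventually_elim (auto simp: indicator_def)
    show "\<not> (AE x in lborel. indicator S x * F x \<le> indicator S x * ennreal B)"
    proof
      assume "AE x in lborel. indicator S x * F x \<le> indicator S x * ennreal B"
      with gt have "AE x in lborel. x \<in> S \<longrightarrow> False"
        by eventually_elim (auto simp: indicator_def)
      from AE_not_null_ex[OF this] V show False by auto
    qed
  qed measurable
  also have "(\<integral>\<^sup>+x. indicator S x * ennreal B \<partial>lborel) = ennreal (V * B)"
    using V B by (simp add: nn_integral_multc ennreal_mult)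
  finally show False using le by simp
qed

section \<open>The inequality on one convex body\<close>

text \<open>The constant is a value \<open>W x\<close> at a well chosen point: averaging the p-th
  power of the norm of W - W x over \<open>x\<close> leads to segment means of the gradient, and
  some \<open>x\<close> is no worse than the average. The factor is crude; it serves to show that
  the set whose infimum is \<open>C_PF\<close> is nonempty.\<close>

lemma poincare_convex:
  fixes S :: "(real^'n) set"
  assumes p: "1 \<le> p" and S: "compact S" "convex S" "interior S \<noteq> {}" and v: "W1p p (interior S) v Dv"
  shows "\<exists>c. Lp_norm p S (\<lambda>x. v x - c) \<le> diameter S * 2 ^ CARD('n) * Lp_norm p S Dv"
proof -
  let ?U = "interior S" and ?N = "Lp_norm p S Dv" and ?d = "diameter S"
  have [measurable]: "S \<in> sets borel" using S by (simp add: borel_compact)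
  have L: "S \<in> sets lebesgue" by simp
  have bS: "bounded S" using S compact_imp_bounded by blast
  have U: "?U \<in> lmeasurable" using bS by (intro lmeasurable_open) (auto intro: bounded_subset interior_subset)
  have d: "0 \<le> ?d" using bS diameter_ge_0 by blast
  have N: "0 \<le> ?N" by (rule Lp_norm_nonneg)
  note mem = W1p_mem_Lp_convex[OF p open_interior S(1,2) order_refl v]
  define V where "V = measure lborel S"
  have V: "emeasure lborel S = ennreal V" "0 < V"
  proof -
    have fin: "emeasure lborel S < \<infinity>" by (rule emeasure_bounded_finite[OF bS])
    then show e: "emeasure lborel S = ennreal V" unfolding V_def by (intro emeasure_eq_ennreal_measure) simp
    have "\<not> negligible S" using S(3) by (metis interior_subset negligible_subset open_interior open_not_negligible)
    then have "emeasure lborel S \<noteq> 0"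
      by (simp add: negligible_iff_null_sets null_sets_def)
    then show "0 < V" using e by (simp add: V_def zero_less_measure_iff emeasure_eq_ennreal_measure)
  qed
  obtain W D where W: "integrable lborel W" and D: "integrable lborel D"
    and ae: "AE x in lborel. x \<in> ?U \<longrightarrow> v x = W x" "AE x in lborel. x \<in> ?U \<longrightarrow> Dv x = D x"
    and weak: "\<And>\<phi> i. \<phi> \<in> test_functions ?U \<Longrightarrow>
      (LINT x|lborel. W x * partial_derivative i \<phi> x) = - (LINT x|lborel. D x $ i * \<phi> x)"
    using W1p_borel_representative[OF p open_interior U v] by blast
  have [measurable]: "W \<in> borel_measurable borel" "D \<in> borel_measurable borel" using W D by auto
  have aeS: "AE x in lborel. x \<in> S \<longrightarrow> v x = W x" "AE x in lborel. x \<in> S \<longrightarrow> Dv x = D x"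
    using AE_convex_interior[OF S(2) order_refl] ae by (eventually_elim, blast)+
  have hD: "Lp_le p (lebesgue_on S) (\<lambda>x. norm (D x)) ?N"
    by (rule Lp_le_representative[OF p L mem(2) _ aeS(2)]) simp
  let ?sm = "segment_mean (\<lambda>x. norm (D x))"
  have pw: "AE z in lborel \<Otimes>\<^sub>M lborel. fst z \<in> S \<and> snd z \<in> S \<longrightarrow> ennreal \<bar>W (fst z) - W (snd z)\<bar>
    \<le> ennreal ?d * ?sm (fst z) (snd z)"
    by (rule segment_pointwise[OF S(1,2) W D]) (rule weak)
  have "\<exists>x\<in>S. Lp_le p (lebesgue_on S) (\<lambda>y. W y - W x) (?d * 2 ^ CARD('n) * ?N)"
  proof (cases "p = \<infinity>")
    case True
    \<comment> \<open>The excess of the gradient over its essential bound. Its segment means vanish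
      for almost every pair, so the bound holds on average along almost every segment.\<close>
    define h where "h x = max 0 (norm (D x) - ?N) * indicator S x" for x
    have h0: "0 \<le> h x" for x by (simp add: h_def)
    have [measurable]: "h \<in> borel_measurable borel" unfolding h_def[abs_def] by measurable
    have "AE x in lborel. x \<in> S \<longrightarrow> norm (D x) \<le> ?N"
      using hD True L by (simp add: Lp_le_def AE_lebesgue_on)
    then have "AE x in lborel. ennreal (h x) = 0"
      by eventually_elim (auto simp: h_def indicator_def)
    then have "(\<integral>\<^sup>+x. ennreal (h x) \<partial>lborel) = 0" by (subst nn_integral_0_iff_AE) auto
    then have "(\<integral>\<^sup>+x. (\<integral>\<^sup>+y. indicator S x * indicator S y * segment_mean h x y \<partial>lborel) \<partial>lborel) = 0"
      using segment_mean_L1[of h S] by simp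
    then have "(\<integral>\<^sup>+z. indicator S (fst z) * indicator S (snd z) * segment_mean h (fst z) (snd z) \<partial>(lborel \<Otimes>\<^sub>M lborel)) = 0"
      by (subst lborel.nn_integral_fst[symmetric]) auto
    then have "AE z in lborel \<Otimes>\<^sub>M lborel. indicator S (fst z) * indicator S (snd z) * segment_mean h (fst z) (snd z) = 0"
      by (subst (asm) nn_integral_0_iff_AE) auto
    with pw have "AE z in lborel \<Otimes>\<^sub>M lborel. fst z \<in> S \<and> snd z \<in> S \<longrightarrow> \<bar>W (snd z) - W (fst z)\<bar> \<le> ?d * ?N"
    proof eventually_elim
      case (elim z)
      show ?case
      proof
        assume z: "fst z \<in> S \<and> snd z \<in> S"
        have "?sm (fst z) (snd z) \<le> segment_mean (\<lambda>x. ?N + h x) (fst z) (snd z)"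
          using z by (intro segment_mean_bound[OF S(2)]) (auto simp: h_def)
        also have "\<dots> = segment_mean (\<lambda>x. ?N) (fst z) (snd z) + segment_mean h (fst z) (snd z)"
          using N h0 by (intro segment_mean_add) auto
        also have "\<dots> = ennreal ?N" using elim(2) z N by (simp add: segment_mean_const)
        finally have "ennreal \<bar>W (fst z) - W (snd z)\<bar> \<le> ennreal ?d * ennreal ?N"
          using elim(1) z by (meson mult_left_mono order_trans zero_le)
        then have "ennreal \<bar>W (fst z) - W (snd z)\<bar> \<le> ennreal (?d * ?N)"
          using d N by (simp add: ennreal_mult)
        then show "\<bar>W (snd z) - W (fst z)\<bar> \<le> ?d * ?N"
          using d N by (subst (asm) ennreal_le_iff) (auto simp: abs_minus_commute)
      qed
    qed
    from lborel_pair.AE_pair[OF this]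
    have "AE x in lborel. x \<in> S \<longrightarrow> (AE y in lborel. y \<in> S \<longrightarrow> \<bar>W y - W x\<bar> \<le> ?d * ?N)"
      by eventually_elim auto
    from AE_not_null_ex[OF this] V obtain x where x: "x \<in> S" "AE y in lborel. y \<in> S \<longrightarrow> \<bar>W y - W x\<bar> \<le> ?d * ?N"
      by auto
    have "?d * ?N \<le> ?d * 2 ^ CARD('n) * ?N"
      using d N mult_right_mono[of 1 "2 ^ CARD('n)" "?d * ?N"] by (simp add: mult_ac)
    then have "AE y in lborel. y \<in> S \<longrightarrow> \<bar>W y - W x\<bar> \<le> ?d * 2 ^ CARD('n) * ?N"
      using x(2) by (auto elim!: eventually_mono)
    moreover have "(\<lambda>y. W y - W x) \<in> borel_measurable (lebesgue_on S)"
      by (intro measurable_restrict_space1 measurable_completion) simp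
    ultimately show ?thesis
      using x(1) True L d N by (intro bexI[of _ x]) (auto simp: Lp_le_def AE_lebesgue_on)
  next
    case False
    define P where "P = enn2real p"
    have P: "1 \<le> P" using enn2real_ge_1[OF p False] by (simp add: P_def)
    define h where "h x = norm (D x) powr P * indicator S x" for x
    have [measurable]: "h \<in> borel_measurable borel" unfolding h_def[abs_def] by measurable
    have "(\<integral>\<^sup>+x. ennreal (h x) \<partial>lborel) = (\<integral>\<^sup>+x. ennreal (norm (D x) powr P) * indicator S x \<partial>lborel)"
      by (intro nn_integral_cong) (auto simp: h_def indicator_def)
    also have "\<dots> \<le> ennreal (?N powr P)"
      using hD False L by (simp add: Lp_le_def nn_integral_lebesgue_on P_def)
    finally have hN: "(\<integral>\<^sup>+x. ennreal (h x) \<partial>lborel) \<le> ennreal (?N powr P)" .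
    define F where "F x = (\<integral>\<^sup>+y. indicator S y * ennreal (\<bar>W y - W x\<bar> powr P) \<partial>lborel)" for x
    have [measurable]: "F \<in> borel_measurable borel" unfolding F_def[abs_def] by measurable
    let ?B = "?d powr P * (2 ^ CARD('n) * ?N powr P)"
    have pw': "AE z in lborel \<Otimes>\<^sub>M lborel. fst z \<in> S \<and> snd z \<in> S \<longrightarrow>
        ennreal (\<bar>W (snd z) - W (fst z)\<bar> powr P) \<le> ennreal (?d powr P) * segment_mean h (fst z) (snd z)"
      using pw
    proof eventually_elim
      case (elim z)
      show ?case
      proof
        assume z: "fst z \<in> S \<and> snd z \<in> S"
        let ?x = "fst z" and ?y = "snd z"
        have le: "segment_mean (\<lambda>x. norm (D x) powr P) ?x ?y \<le> segment_mean h ?x ?y"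
          using z by (intro segment_mean_bound[OF S(2)]) (auto simp: h_def)
        show "ennreal (\<bar>W ?y - W ?x\<bar> powr P) \<le> ennreal (?d powr P) * segment_mean h ?x ?y"
        \<comment> \<open>In \<open>ennreal\<close> the product of 0 and \<infinity> is 0, so an
          infinite segment mean makes the right side infinite only for nonzero
          \<open>?d\<close>.\<close>
        proof (cases "?d = 0")
          case True
          then have "ennreal \<bar>W ?x - W ?y\<bar> \<le> 0" using elim z by simp
          then have "W ?x = W ?y" by (simp add: ennreal_eq_0_iff)
          then show ?thesis by simp
        next
          case dnz: False
          show ?thesis
          proof (cases "segment_mean h ?x ?y < \<infinity>")
            case True
            then have fin: "segment_mean (\<lambda>x. norm (D x) powr P) ?x ?y < \<infinity>" using le by (rule le_less_trans[rotated])
            note J = segment_mean_Jensen[OF P _ _ fin, simplified]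
            let ?s = "enn2real (?sm ?x ?y)"
            have "ennreal \<bar>W ?x - W ?y\<bar> \<le> ennreal ?d * ennreal ?s" using elim z J(2) by simp
            also have "\<dots> = ennreal (?d * ?s)" using d by (simp add: ennreal_mult)
            finally have "\<bar>W ?x - W ?y\<bar> \<le> ?d * ?s" using d by (subst (asm) ennreal_le_iff) auto
            then have "\<bar>W ?y - W ?x\<bar> powr P \<le> (?d * ?s) powr P" using P by (intro powr_mono2) auto
            also have "\<dots> = ?d powr P * ?s powr P" using d by (simp add: powr_mult)
            finally have "ennreal (\<bar>W ?y - W ?x\<bar> powr P) \<le> ennreal (?d powr P) * ennreal (?s powr P)"
              by (simp add: ennreal_mult[symmetric] ennreal_leI)
            also have "\<dots> \<le> ennreal (?d powr P) * segment_mean h ?x ?y"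
              by (intro mult_left_mono order_trans[OF J(1) le]) auto
            finally show ?thesis .
          next
            case False
            then have "segment_mean h ?x ?y = \<infinity>" by (simp add: not_less top_unique)
            then show ?thesis using dnz d by (simp add: ennreal_mult_top)
          qed
        qed
      qed
    qed
    have "(\<integral>\<^sup>+x. indicator S x * F x \<partial>lborel) = (\<integral>\<^sup>+x. (\<integral>\<^sup>+y. indicator S x * (indicator S y * ennreal (\<bar>W y - W x\<bar> powr P)) \<partial>lborel) \<partial>lborel)"
      unfolding F_def by (intro nn_integral_cong nn_integral_cmult[symmetric]) measurable
    also have "\<dots> = (\<integral>\<^sup>+z. indicator S (fst z) * (indicator S (snd z) * ennreal (\<bar>W (snd z) - W (fst z)\<bar> powr P)) \<partial>(lborel \<Otimes>\<^sub>M lborel))"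
      by (subst lborel.nn_integral_fst[symmetric]) auto
    also have "\<dots> \<le> (\<integral>\<^sup>+z. ennreal (?d powr P) * (indicator S (fst z) * indicator S (snd z) * segment_mean h (fst z) (snd z)) \<partial>(lborel \<Otimes>\<^sub>M lborel))"
      using pw' by (intro nn_integral_mono_AE, eventually_elim) (auto simp: indicator_def)
    also have "\<dots> = ennreal (?d powr P) * (\<integral>\<^sup>+z. indicator S (fst z) * indicator S (snd z) * segment_mean h (fst z) (snd z) \<partial>(lborel \<Otimes>\<^sub>M lborel))"
      by (rule nn_integral_cmult) measurable
    also have "(\<integral>\<^sup>+z. indicator S (fst z) * indicator S (snd z) * segment_mean h (fst z) (snd z) \<partial>(lborel \<Otimes>\<^sub>M lborel))
        = (\<integral>\<^sup>+x. (\<integral>\<^sup>+y. indicator S x * indicator S y * segment_mean h x y \<partial>lborel) \<partial>lborel)"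
      by (subst lborel.nn_integral_fst[symmetric]) auto
    also have "ennreal (?d powr P) * \<dots> \<le> ennreal (?d powr P) * (ennreal (2 ^ CARD('n)) * ennreal V * ennreal (?N powr P))"
      by (intro mult_left_mono order_trans[OF segment_mean_L1[of h S, unfolded V(1)]] mult_left_mono hN) auto
    also have "\<dots> = ennreal (V * ?B)" using V(2) by (simp add: ennreal_mult mult_ac)
    finally have FB: "(\<integral>\<^sup>+x. indicator S x * F x \<partial>lborel) \<le> ennreal (V * ?B)" .
    obtain x where x: "x \<in> S" "F x \<le> ennreal ?B"
      using ex_point_le_mean[OF _ _ V _ FB] by auto
    \<comment> \<open>The power of 2 coming from the segment means carries no exponent
      \<open>P\<close>; raising it to this exponent gives one constant for all p.\<close>
    have "?B \<le> ?d powr P * ((2 ^ CARD('n)) powr P * ?N powr P)"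
    proof -
      have "(2 ^ CARD('n)) powr 1 \<le> (2 ^ CARD('n) :: real) powr P" using P by (intro powr_mono) auto
      then show ?thesis by (intro mult_left_mono mult_right_mono) auto
    qed
    also have "\<dots> = (?d * 2 ^ CARD('n) * ?N) powr P" using d N by (simp add: powr_mult mult_ac)
    finally have "F x \<le> ennreal ((?d * 2 ^ CARD('n) * ?N) powr P)" using x(2) order_trans ennreal_leI by blast
    moreover have "(\<lambda>y. W y - W x) \<in> borel_measurable (lebesgue_on S)"
      by (intro measurable_restrict_space1 measurable_completion) simp
    ultimately show ?thesis
      using x(1) False L d N
      by (intro bexI[of _ x]) (auto simp: Lp_le_def nn_integral_lebesgue_on F_def mult.commute[of "indicator S _"] simp flip: P_def)
  qed
  then obtain x where le: "Lp_le p (lebesgue_on S) (\<lambda>y. W y - W x) (?d * 2 ^ CARD('n) * ?N)" by blast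
  have vm: "(\<lambda>y. v y - W x) \<in> borel_measurable (lebesgue_on S)"
    using mem(1) unfolding mem_Lp_def by (intro borel_measurable_diff borel_measurable_const) blast
  then have vm': "(\<lambda>y. norm (v y - W x)) \<in> borel_measurable (lebesgue_on S)" by measurable
  have "AE y in lebesgue_on S. \<bar>norm (v y - W x)\<bar> \<le> \<bar>W y - W x\<bar>"
    unfolding AE_lebesgue_on[OF L] using aeS(1) by eventually_elim simp
  from Lp_le_imp_mem_Lp(2)[OF p vm Lp_le_mono[OF le vm' this order_refl]]
  show ?thesis by blast
qed

section \<open>Neighbouring simplices\<close>

lemma top_simplex_hull:
  fixes T :: "(real^'n) set"
  assumes "T \<in> top_simplices \<T>"
  obtains A where "\<not> affine_dependent A" "card A = Suc CARD('n)" "T = convex hull A" "finite A"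
proof -
  obtain A where A: "\<not> affine_dependent A" "int (card A) = int CARD('n) + 1" "T = convex hull A"
    using assms by (auto simp: top_simplices_def simplex_def)
  then show thesis using that[of A] aff_independent_finite by auto
qed

lemma top_simplex_compact_convex:
  fixes T :: "(real^'n) set"
  assumes "T \<in> top_simplices \<T>"
  shows "compact T" "convex T" "interior T \<noteq> {}"
proof -
  obtain A where A: "\<not> affine_dependent A" "card A = Suc CARD('n)" "T = convex hull A" "finite A"
    by (rule top_simplex_hull[OF assms])
  then show "compact T" "convex T" by (simp_all add: finite_imp_compact_convex_hull)
  have "aff_dim T = int (DIM(real^'n))"
    using A aff_dim_affine_independent[OF A(1)] by (simp add: aff_dim_convex_hull)
  then have "affine hull T = UNIV" by (simp only: aff_dim_eq_full)
  then have "rel_interior T = interior T" by (rule rel_interior_interior)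
  moreover have "T \<noteq> {}" using A by auto
  ultimately show "interior T \<noteq> {}" using \<open>convex T\<close> rel_interior_eq_empty by metis
qed

lemma span_simplex_edges:
  fixes A :: "(real^'n) set"
  assumes A: "\<not> affine_dependent A" "card A = Suc CARD('n)" "c \<in> A"
  shows "independent ((\<lambda>x. x - c) ` (A - {c}))" "span ((\<lambda>x. x - c) ` (A - {c})) = UNIV"
proof -
  let ?B = "(\<lambda>x. x - c) ` (A - {c})"
  have "(\<lambda>x. x - c) = (\<lambda>x. - c + x)" by auto
  then show i: "independent ?B"
    using A affine_dependent_iff_dependent2[OF A(3)] by simp
  have "card ?B = CARD('n)"
    using A by (simp add: card_image inj_on_def card_Diff_singleton)
  then have "UNIV \<subseteq> span ?B"
    using i by (intro card_ge_dim_independent) auto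
  then show "span ?B = UNIV" by auto
qed

text \<open>The simplices differ in one vertex each, \<open>z\<close> and \<open>z'\<close>, over a
  common vertex set \<open>C\<close>. The point that is not routine is \<open>foot_interior\<close>:
  it comes down to \<open>z'\<close> lying on the negative side of the hyperplane of the face, which
  follows from the intersection of the simplices being no larger than the face.\<close>

lemma neighbors_folding:
  fixes S R :: "(real^'n) set"
  assumes S: "S \<in> top_simplices \<T>" and R: "R \<in> top_simplices \<T>" and nb: "face_neighboring S R"
  obtains c E l J where "folding S c E l R J" "norm E \<le> diameter S" "transition_jacobian S R (matrix J)"
    "linear J"
proof -
  obtain A where A: "\<not> affine_dependent A" "card A = Suc CARD('n)" "S = convex hull A" "finite A"
    by (rule top_simplex_hull[OF S])
  obtain B where B: "\<not> affine_dependent B" "card B = Suc CARD('n)" "R = convex hull B" "finite B"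
    by (rule top_simplex_hull[OF R])
  define F where "F = S \<inter> R"
  have F: "F facet_of convex hull A" "F facet_of convex hull B"
    using nb A B by (auto simp: face_neighboring_def F_def)
  obtain z where z: "z \<in> A" "F = convex hull (A - {z})" and "F \<noteq> {}"
    using F(1) unfolding facet_of_convex_hull_affine_independent[OF A(1)] by blast
  obtain z' where z': "z' \<in> B" "F = convex hull (B - {z'})"
    using F(2) unfolding facet_of_convex_hull_affine_independent[OF B(1)] by blast
  define C where "C = A - {z}"
  have iA: "\<not> affine_dependent (A - {z})" and iB: "\<not> affine_dependent (B - {z'})"
    using A(1) B(1) affine_independent_Diff by blast+
  \<comment> \<open>Both vertex sets are affinely independent with the same hull \<open>F\<close>,
    so each of them is the set of extreme points of \<open>F\<close>.\<close>
  have "C = B - {z'}"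
    using extreme_point_of_convex_hull_affine_independent[OF iA] extreme_point_of_convex_hull_affine_independent[OF iB] z z'
    unfolding C_def by (metis (no_types, lifting) set_eqI)
  then have AC: "A = insert z C" and BC: "B = insert z' C" and zC: "z \<notin> C" "z' \<notin> C"
    using z z' by (auto simp: C_def)
  obtain c where c: "c \<in> C" using \<open>F \<noteq> {}\<close> z by (auto simp: C_def)
  have cA: "c \<in> A" "c \<in> B" using c AC BC by auto
  note spanA = span_simplex_edges[OF A(1,2) cA(1)] and spanB = span_simplex_edges[OF B(1,2) cA(2)]
  define E where "E = z - c"
  obtain l where l: "linear l" "\<And>v. v \<in> (\<lambda>x. x - c) ` (A - {c}) \<Longrightarrow> l v = (if v = E then 1 else 0 :: real)"
    using linear_independent_extend[OF spanA(1), of "\<lambda>v. if v = E then 1 else 0"] by auto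
  have lE: "l E = 1" using l(2)[of E] z zC c by (auto simp: E_def)
  have lC: "l (a - c) = 0" if "a \<in> C" for a
  proof (cases "a = c")
    case True then show ?thesis using l(1) by (simp add: linear_0)
  next
    case False
    then show ?thesis using l(2)[of "a - c"] that zC AC by (auto simp: E_def)
  qed
  \<comment> \<open>A rank-one correction of the identity: it fixes the hyperplane where
    \<open>l\<close> vanishes and carries the edge from \<open>c\<close> to \<open>z\<close> into
    the edge from \<open>c\<close> to \<open>z'\<close>.\<close>
  define J where "J v = v + l v *\<^sub>R (z' - z)" for v
  have J: "linear J" unfolding J_def[abs_def]
    using l(1) by (intro linearI) (simp_all add: linear_add linear_scale algebra_simps)
  have JE: "J E = z' - c" by (simp add: J_def lE) (simp add: E_def)
  have JC: "J (a - c) = a - c" if "a \<in> C" for a using lC[OF that] by (simp add: J_def)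
  have "surj J"
  proof -
    have "(\<lambda>x. x - c) ` (B - {c}) \<subseteq> range J"
    proof (rule image_subsetI)
      fix b assume "b \<in> B - {c}"
      then show "b - c \<in> range J" using JE JC BC by (metis Diff_iff insertE rangeI)
    qed
    then have "span ((\<lambda>x. x - c) ` (B - {c})) \<subseteq> range J"
      using J by (intro span_minimal linear_subspace_image) auto
    then show ?thesis using spanB(2) by auto
  qed
  then have bijJ: "bij J" using J linear_surjective_imp_injective by (auto simp: bij_def)
  have combo: "l (u *\<^sub>R x + w *\<^sub>R y - c) = u * l (x - c) + w * l (y - c)" if "u + w = 1" for u w x y
  proof -
    have "u *\<^sub>R x + w *\<^sub>R y - c = u *\<^sub>R (x - c) + w *\<^sub>R (y - c)"
      using that by (simp add: algebra_simps flip: scaleR_add_left)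
    then show ?thesis using l(1) by (simp add: linear_add linear_scale)
  qed
  have convS: "convex S" using A by simp
  have lS: "0 \<le> l (x - c) \<and> l (x - c) \<le> 1" if "x \<in> S" for x
  proof -
    have "convex {x. 0 \<le> l (x - c) \<and> l (x - c) \<le> 1}"
      by (rule convexI) (auto simp: combo intro!: convex_bound_le add_nonneg_nonneg)
    moreover have "A \<subseteq> {x. 0 \<le> l (x - c) \<and> l (x - c) \<le> 1}"
      using lC lE AC by (auto simp: E_def)
    ultimately have "S \<subseteq> {x. 0 \<le> l (x - c) \<and> l (x - c) \<le> 1}" unfolding A(3) by (intro hull_minimal)
    then show ?thesis using that by auto
  qed
  have footF: "x - l (x - c) *\<^sub>R E \<in> F" if "x \<in> S" for x
  proof -
    have "convex F" by (simp add: z)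
    have "convex {x. x - l (x - c) *\<^sub>R E \<in> F}"
    proof (rule convexI, clarify)
      fix x y u w assume h: "x - l (x - c) *\<^sub>R E \<in> F" "y - l (y - c) *\<^sub>R E \<in> F" "0 \<le> u" "0 \<le> w" "u + w = (1::real)"
      have "u *\<^sub>R (x - l (x - c) *\<^sub>R E) + w *\<^sub>R (y - l (y - c) *\<^sub>R E) \<in> F"
        by (rule convexD[OF \<open>convex F\<close> h])
      then show "u *\<^sub>R x + w *\<^sub>R y - l (u *\<^sub>R x + w *\<^sub>R y - c) *\<^sub>R E \<in> F"
        using h(5) by (simp add: combo algebra_simps)
    qed
    moreover have "A \<subseteq> {x. x - l (x - c) *\<^sub>R E \<in> F}"
    proof safe
      fix a assume "a \<in> A"
      have CF: "C \<subseteq> F" unfolding z C_def by (rule hull_subset)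
      show "a - l (a - c) *\<^sub>R E \<in> F"
      proof (cases "a = z")
        case True then show ?thesis using lE c CF by (auto simp: E_def)
      next
        case False then show ?thesis using \<open>a \<in> A\<close> AC lC CF by auto
      qed
    qed
    ultimately have "S \<subseteq> {x. x - l (x - c) *\<^sub>R E \<in> F}" unfolding A(3) by (intro hull_minimal)
    then show ?thesis using that by auto
  qed
  have lF: "l (x - c) = 0" if "x \<in> F" for x
  proof -
    have "convex {x. l (x - c) = 0}" by (rule convexI) (auto simp: combo)
    moreover have "C \<subseteq> {x. l (x - c) = 0}" using lC by auto
    ultimately have "F \<subseteq> {x. l (x - c) = 0}" unfolding z(2) C_def by (intro hull_minimal)
    then show ?thesis using that by auto
  qed
  have ed: "edge_direction S c E l"
    using A l(1) lE lS footF by (intro edge_direction.intro) (auto simp: finite_imp_compact_convex_hull F_def)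
  interpret edge_direction S c E l by (rule ed)
  define X where "X x = c + J (x - c)" for x
  have X_eq: "X x = (c - J c) + J x" for x by (simp add: X_def linear_diff[OF J])
  have Ximage: "X ` S = R"
  proof -
    have "X ` S = (+) (c - J c) ` (J ` S)" by (simp add: image_image X_eq)
    also have "\<dots> = convex hull ((+) (c - J c) ` (J ` A))"
      by (simp add: A(3) convex_hull_linear_image[OF J] convex_hull_translation)
    also have "(+) (c - J c) ` (J ` A) = X ` A" by (simp add: image_image X_eq)
    also have "X ` A = B"
    proof -
      have "X z = z'" using JE by (simp add: X_def E_def)
      moreover have "X ` C = C" using JC by (auto simp: X_def image_iff)
      ultimately show ?thesis by (simp add: AC BC)
    qed
    finally show ?thesis by (simp add: B)
  qed
  have XF: "X x = x" if "x \<in> F" for x using lF[OF that] by (simp add: X_def J_def)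
  have Xdiff: "X (x - v) = X x - J v" for x v
    using linear_diff[OF J, of "x - c" v] by (simp add: X_def algebra_simps)
  have Xadd: "X (x + v) = X x + J v" for x v
    using linear_add[OF J, of "x - c" v] by (simp add: X_def algebra_simps)
  define K where "K = inv J"
  have K: "linear K" unfolding K_def using J bijJ by (intro inj_linear_imp_inv_linear bij_is_inj)
  have JK: "J (K v) = v" for v using bijJ by (simp add: K_def bij_is_surj surj_f_inv_f)
  \<comment> \<open>The coordinate of the second apex: its sign tells on which side of the face
    \<open>R\<close> lies, and it is the factor by which \<open>J\<close> rescales
    \<open>l\<close>.\<close>
  define \<alpha> where "\<alpha> = l (z' - c)"
  have lJ: "l (J v) = \<alpha> * l v" for v
  proof -
    have "l (z' - z) = \<alpha> - 1"
      using linear_diff[OF l(1), of "z' - c" "z - c"] lE by (simp add: \<alpha>_def E_def)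
    moreover have "l (J v) = l v * (1 + l (z' - z))"
      unfolding J_def by (simp only: linear_add[OF l(1)] linear_scale[OF l(1)] real_scaleR_def distrib_left mult_1_right)
    ultimately show ?thesis by (metis add.commute diff_add_cancel mult.commute)
  qed
  \<comment> \<open>Near the foot of an interior point \<open>S\<close> contains a half-ball on the
    side of \<open>z\<close>: move \<open>x\<close> by a small \<open>k\<close> with
    \<open>l k\<close> nonnegative and go down by the old height. The fold carries this to
    \<open>R\<close>, with \<open>K\<close> measuring the side.\<close>
  have half: "\<exists>e>0. (\<forall>h. norm h < e \<and> 0 \<le> l h \<longrightarrow> foot + h \<in> S) \<and> (\<forall>h. norm h < e \<and> 0 \<le> l (K h) \<longrightarrow> foot + h \<in> R)"
    if x: "x \<in> interior S" and foot: "foot = x - l (x - c) *\<^sub>R E" for x foot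
  proof -
    obtain e where e: "e > 0" "ball x e \<subseteq> S" using x by (auto simp: mem_interior)
    obtain Q where Q: "Q > 0" "\<And>h. norm (K h) \<le> Q * norm h"
      using linear_bounded_pos[OF K] by (metis mult.commute)
    have xS: "x \<in> S" using x interior_subset by blast
    have up: "foot + k \<in> S" if "norm k < e" "0 \<le> l k" for k
    proof -
      have "x + k \<in> S" using that e(2) by (auto simp: dist_norm subset_iff)
      moreover have "l (x + k - c) = l (x - c) + l k"
        using linear_add[OF l(1), of "x - c" k] by (simp add: algebra_simps)
      ultimately have "(x + k) - l (x - c) *\<^sub>R E \<in> S"
        using lS[OF xS] that by (intro segment_in_S) (auto simp: lam_def)
      then show ?thesis by (simp add: foot algebra_simps)
    qed
    show ?thesis
    \<comment> \<open>\<open>Q\<close> bounds the inverse of \<open>J\<close>, so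
      \<open>norm h < e / Q\<close> keeps \<open>K h\<close> within the radius allowed for
      \<open>S\<close>.\<close>
    proof (intro exI[of _ "min e (e / Q)"] conjI allI impI)
      show "0 < min e (e / Q)" using e Q by simp
      fix h assume h: "norm h < min e (e / Q) \<and> 0 \<le> l h"
      then show "foot + h \<in> S" by (intro up) auto
    next
      fix h assume h: "norm h < min e (e / Q) \<and> 0 \<le> l (K h)"
      have "norm (K h) < e" using h Q(1) by (intro le_less_trans[OF Q(2)]) (auto simp: field_simps)
      then have "X (foot + K h) \<in> R" using up[of "K h"] h Ximage by blast
      moreover have "X foot = foot" using XF footF[OF xS] by (simp add: foot)
      ultimately show "foot + h \<in> R" by (simp add: Xadd JK)
    qed
  qed
  have "\<alpha> < 0"
  proof (rule ccontr)
    \<comment> \<open>Were both apexes on the same side, a short step from the foot along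
      \<open>E\<close> would stay in both simplices and hence in \<open>F\<close>, where
      \<open>l\<close> vanishes.\<close>
    assume "\<not> \<alpha> < 0"
    moreover have "\<alpha> \<noteq> 0" using lJ[of "K E"] lE by (auto simp: JK)
    ultimately have \<alpha>: "0 < \<alpha>" by simp
    obtain x where x: "x \<in> interior S" using top_simplex_compact_convex(3)[OF S] by blast
    define foot where "foot = x - l (x - c) *\<^sub>R E"
    obtain e where e: "e > 0" "\<And>h. norm h < e \<and> 0 \<le> l h \<Longrightarrow> foot + h \<in> S"
      "\<And>h. norm h < e \<and> 0 \<le> l (K h) \<Longrightarrow> foot + h \<in> R"
      using half[OF x foot_def] by blast
    have E0: "norm E > 0" using lE linear_0[OF l(1)] by auto
    define s where "s = e / (2 * norm E)"
    have s: "0 < s" "norm (s *\<^sub>R E) < e" using e E0 by (auto simp: s_def)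
    have ls: "l (s *\<^sub>R E) = s" using l(1) lE by (simp add: linear_scale)
    have "\<alpha> * l (K (s *\<^sub>R E)) = s" using lJ[of "K (s *\<^sub>R E)"] ls by (simp add: JK)
    then have "0 \<le> l (K (s *\<^sub>R E))" using s \<alpha> by (metis less_eq_real_def zero_less_mult_pos)
    then have "foot + s *\<^sub>R E \<in> F" using e(2,3)[of "s *\<^sub>R E"] s ls by (simp add: F_def)
    then have "l (foot + s *\<^sub>R E - c) = 0" by (rule lF)
    moreover have "l (foot - c) = 0" using lF footF x interior_subset by (auto simp: foot_def)
    moreover have "l (foot + s *\<^sub>R E - c) = l (foot - c) + l (s *\<^sub>R E)"
      using linear_add[OF l(1), of "foot - c" "s *\<^sub>R E"] by (simp add: algebra_simps)
    ultimately show False using ls s by simp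
  qed
  \<comment> \<open>Since \<alpha> is negative, the half-balls in \<open>S\<close> and in
    \<open>R\<close> lie on opposite sides and together fill a ball around the foot.\<close>
  have footint: "x - l (x - c) *\<^sub>R E \<in> interior (S \<union> R)" if x: "x \<in> interior S" for x
  proof -
    define foot where "foot = x - l (x - c) *\<^sub>R E"
    obtain e where e: "e > 0" "\<And>h. norm h < e \<and> 0 \<le> l h \<Longrightarrow> foot + h \<in> S"
      "\<And>h. norm h < e \<and> 0 \<le> l (K h) \<Longrightarrow> foot + h \<in> R"
      using half[OF x foot_def] by blast
    have "ball foot e \<subseteq> S \<union> R"
    proof
      fix y assume "y \<in> ball foot e"
      then have n: "norm (y - foot) < e" by (simp add: dist_norm norm_minus_commute)
      show "y \<in> S \<union> R"
      proof (cases "0 \<le> l (y - foot)")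
        case True then show ?thesis using e(2)[of "y - foot"] n by simp
      next
        case False
        have "\<alpha> * l (K (y - foot)) = l (y - foot)" using lJ[of "K (y - foot)"] by (simp add: JK)
        then have "0 \<le> l (K (y - foot))" using False \<open>\<alpha> < 0\<close> by (smt (verit) mult_neg_neg mult_less_0_iff)
        then show ?thesis using e(3)[of "y - foot"] n by simp
      qed
    qed
    then show ?thesis using e(1) by (auto simp: mem_interior foot_def)
  qed
  show thesis
  proof
    show "folding S c E l R J"
      by (intro folding.intro folding_axioms.intro ed J bijJ footint)
        (use J_def Ximage in \<open>auto simp: X_def[abs_def]\<close>)
    have "z \<in> S" "c \<in> S" using z cA by (auto simp: A(3) hull_inc)
    then have "dist z c \<le> diameter S"
      using diameter_bounded_bound[OF compact_imp_bounded[OF compact_S]] by blast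
    then show "norm E \<le> diameter S" by (simp add: E_def dist_norm)
    show "linear J" by (rule J)
    have mJ: "matrix J *v x = J x" for x using J by (simp add: matrix_works linear_matrix_vector_mul_eq)
    have Xe: "(\<lambda>x. matrix J *v x + (c - J c)) = X" by (simp add: mJ fun_eq_iff X_eq)
    show "transition_jacobian S R (matrix J)"
      unfolding transition_jacobian_def
    proof (intro exI[of _ "c - J c"] conjI ballI)
      have "inj X" using bijJ unfolding bij_def X_def inj_def by (metis add_left_cancel diff_add_cancel)
      then show "bij_betw (\<lambda>x. matrix J *v x + (c - J c)) S R"
        unfolding Xe using Ximage by (auto simp: bij_betw_def intro: inj_on_subset)
      fix x assume "x \<in> S \<inter> R"
      then show "matrix J *v x + (c - J c) = x"
        using XF[of x] by (simp add: fun_cong[OF Xe, simplified] F_def)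
    qed
  qed
qed

section \<open>Poincare-Friedrichs constants\<close>

lemma measure_pos_of_interior:
  fixes S :: "(real^'n) set"
  assumes "compact S" "interior S \<noteq> {}" shows "0 < measure lebesgue S"
proof -
  have "\<not> negligible S" using assms(2) by (metis interior_subset negligible_subset open_interior open_not_negligible)
  moreover have "S \<in> lmeasurable" using assms(1) by (rule lmeasurable_compact)
  ultimately have "measure lebesgue S \<noteq> 0" using negligible_iff_measure by blast
  then show ?thesis by (simp add: zero_less_measure_iff)
qed

text \<open>Every admissible constant satisfies the inequality with the same minimiser
  \<open>c\<close>, so the inequality passes to the infimum. The hypotheses on \<open>C\<close>
  provide one admissible constant; the real \<open>Inf\<close> of an empty set would carry no
  information.\<close>

lemma Lp_norm_best_constant:
  fixes X :: "(real^'n) set"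
  assumes p: "1 \<le> p" and X: "X \<in> lmeasurable" "0 < measure lebesgue X" and v: "mem_Lp p X v" "W1p p (interior X) v Dv"
    and C: "0 \<le> C" "\<And>v Dv. W1p p (interior X) v Dv \<Longrightarrow> \<exists>c. Lp_norm p X (\<lambda>x. v x - c) \<le> C * Lp_norm p X Dv"
  shows "\<exists>c. Lp_norm p X (\<lambda>x. v x - c) \<le> C_PF p X * Lp_norm p X Dv"
proof -
  define \<C> where "\<C> = {C. 0 \<le> C \<and> (\<forall>v Dv. W1p p (interior X) v Dv \<longrightarrow>
    (INF c. Lp_norm p X (\<lambda>x. v x - c)) \<le> C * Lp_norm p X Dv)}"
  have bdd: "bdd_below (range (\<lambda>c. Lp_norm p X (\<lambda>x. v x - c)))" for v
    by (rule bdd_belowI[of _ 0]) (auto simp: Lp_norm_nonneg)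
  have "C \<in> \<C>"
    unfolding \<C>_def
  proof (intro CollectI conjI allI impI)
    fix v Dv assume "W1p p (interior X) v Dv"
    then obtain c where "Lp_norm p X (\<lambda>x. v x - c) \<le> C * Lp_norm p X Dv" using C(2) by blast
    then show "(INF c. Lp_norm p X (\<lambda>x. v x - c)) \<le> C * Lp_norm p X Dv"
      by (rule order_trans[OF cINF_lower[OF bdd UNIV_I]])
  qed (rule C(1))
  obtain c where c: "\<And>c'. Lp_norm p X (\<lambda>x. v x - c) \<le> Lp_norm p X (\<lambda>x. v x - c')"
    using ex_best_constant[OF p X v(1)] by blast
  have le: "Lp_norm p X (\<lambda>x. v x - c) \<le> K * Lp_norm p X Dv" if "K \<in> \<C>" for K
  proof -
    have "Lp_norm p X (\<lambda>x. v x - c) \<le> (INF c. Lp_norm p X (\<lambda>x. v x - c))"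
      using c by (intro cINF_greatest) auto
    also have "\<dots> \<le> K * Lp_norm p X Dv" using that v(2) by (auto simp: \<C>_def)
    finally show ?thesis .
  qed
  have "Lp_norm p X (\<lambda>x. v x - c) \<le> Inf \<C> * Lp_norm p X Dv"
  proof (cases "Lp_norm p X Dv = 0")
    case True
    then show ?thesis using le[OF \<open>C \<in> \<C>\<close>] by simp
  next
    case False
    then have N: "0 < Lp_norm p X Dv" using Lp_norm_nonneg[of p X Dv] by linarith
    have "Lp_norm p X (\<lambda>x. v x - c) / Lp_norm p X Dv \<le> Inf \<C>"
      using \<open>C \<in> \<C>\<close> le N by (intro cInf_greatest) (auto simp: divide_le_eq)
    then show ?thesis using N by (simp add: divide_le_eq)
  qed
  then show ?thesis unfolding C_PF_def \<C>_def by blast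
qed

lemma simplex_best_constant:
  fixes S :: "(real^'n) set"
  assumes p: "1 \<le> p" and S: "compact S" "convex S" "interior S \<noteq> {}" and v: "W1p p (interior S) v Dv"
  shows "\<exists>c. Lp_norm p S (\<lambda>x. v x - c) \<le> C_PF p S * Lp_norm p S Dv"
proof (rule Lp_norm_best_constant[OF p lmeasurable_compact[OF S(1)] measure_pos_of_interior[OF S(1,3)] _ v])
  show "mem_Lp p S v" by (rule W1p_mem_Lp_convex(1)[OF p open_interior S(1,2) order_refl v])
  show "0 \<le> diameter S * 2 ^ CARD('n)"
    using compact_imp_bounded[OF S(1)] by (simp add: diameter_ge_0)
qed (rule poincare_convex[OF p S])

section \<open>Norms over the union of two neighbours\<close>

lemma mem_Lp_union:
  fixes S R :: "(real^'n) set"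
  assumes p: "1 \<le> p" and S: "compact S" "convex S" and R: "compact R" "convex R" and f: "mem_Lp p (interior (S \<union> R)) f"
  shows "mem_Lp p (S \<union> R) f"
proof -
  have L: "S \<union> R \<in> sets lebesgue" "interior (S \<union> R) \<in> sets lebesgue"
    using S R by (auto simp: lmeasurable_compact fmeasurableD)
  have "AE x in lborel. x \<in> S \<union> R \<longrightarrow> x \<in> interior (S \<union> R) \<and> f x = f x"
    using AE_convex_interior[OF S(2), of "interior (S \<union> R)"] AE_convex_interior[OF R(2), of "interior (S \<union> R)"]
    by (simp add: interior_mono)
  then show ?thesis using f by (rule mem_Lp_AE_subset(1)[OF p L, rotated])
qed

lemma Lp_norm_union_le:
  fixes S R :: "(real^'n) set"
  assumes p: "1 \<le> p" and L: "S \<in> sets lebesgue" "R \<in> sets lebesgue" and f: "mem_Lp p (S \<union> R) f"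
  shows "Lp_norm p (S \<union> R) f \<le> Lp_norm p S f + Lp_norm p R f"
proof -
  have m: "mem_Lp p S f" "mem_Lp p R f"
    by (rule mem_Lp_AE_subset(1)[OF p _ _ f]; use L in auto)+
  note le = mem_Lp_imp_Lp_le[OF p m(1)] mem_Lp_imp_Lp_le[OF p m(2)]
  have fm: "f \<in> borel_measurable (lebesgue_on (S \<union> R))" using f by (simp add: mem_Lp_def)
  then have fm': "(\<lambda>x. norm (f x)) \<in> borel_measurable (lebesgue_on (S \<union> R))" by measurable
  have LU: "S \<union> R \<in> sets lebesgue" using L by auto
  have "Lp_le p (lebesgue_on (S \<union> R)) (\<lambda>x. norm (f x)) (Lp_norm p S f + Lp_norm p R f)"
  proof (cases "p = \<infinity>")
    case True
    have "AE x in lborel. x \<in> S \<longrightarrow> norm (f x) \<le> Lp_norm p S f" "AE x in lborel. x \<in> R \<longrightarrow> norm (f x) \<le> Lp_norm p R f"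
      using le True L by (simp_all add: Lp_le_def AE_lebesgue_on)
    then have "AE x in lborel. x \<in> S \<union> R \<longrightarrow> norm (f x) \<le> Lp_norm p S f + Lp_norm p R f"
      by eventually_elim (use Lp_norm_nonneg[of p S f] Lp_norm_nonneg[of p R f] in force)
    then show ?thesis using True fm' LU Lp_norm_nonneg[of p S f] Lp_norm_nonneg[of p R f]
      by (simp add: Lp_le_def AE_lebesgue_on)
  next
    case False
    define P where "P = enn2real p"
    have P: "1 \<le> P" using enn2real_ge_1[OF p False] by (simp add: P_def)
    let ?a = "Lp_norm p S f" and ?b = "Lp_norm p R f"
    have ab: "0 \<le> ?a" "0 \<le> ?b" by (rule Lp_norm_nonneg)+
    have mS: "(\<lambda>x. ennreal (norm (f x) powr P) * indicator X x) \<in> borel_measurable lebesgue"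
      if "X \<in> sets lebesgue" "mem_Lp p X f" for X
    proof -
      have [measurable]: "f \<in> borel_measurable (lebesgue_on X)" using that by (simp add: mem_Lp_def)
      have "(\<lambda>x. ennreal (norm (f x) powr P)) \<in> borel_measurable (lebesgue_on X)" by measurable
      then show ?thesis using that by (intro borel_measurable_restrict_space_iff_ennreal[THEN iffD1]) auto
    qed
    have "(\<integral>\<^sup>+x. ennreal (norm (f x) powr P) * indicator (S \<union> R) x \<partial>lborel)
        = (\<integral>\<^sup>+x. ennreal (norm (f x) powr P) * indicator (S \<union> R) x \<partial>lebesgue)"
      by (rule nn_integral_completion[symmetric])
    also have "\<dots> \<le> (\<integral>\<^sup>+x. ennreal (norm (f x) powr P) * indicator S x + ennreal (norm (f x) powr P) * indicator R x \<partial>lebesgue)"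
      by (intro nn_integral_mono) (auto simp: indicator_def)
    also have "\<dots> = (\<integral>\<^sup>+x. ennreal (norm (f x) powr P) * indicator S x \<partial>lebesgue) + (\<integral>\<^sup>+x. ennreal (norm (f x) powr P) * indicator R x \<partial>lebesgue)"
      by (intro nn_integral_add mS L m)
    also have "\<dots> \<le> ennreal (?a powr P) + ennreal (?b powr P)"
      using le False L by (intro add_mono) (simp_all add: Lp_le_def nn_integral_lebesgue_on nn_integral_completion P_def)
    also have "\<dots> = ennreal (?a powr P + ?b powr P)" by (simp add: ennreal_plus)
    also have "\<dots> \<le> ennreal ((?a + ?b) powr P)"
    proof (rule ennreal_leI)
      show "?a powr P + ?b powr P \<le> (?a + ?b) powr P"
      proof (cases "?a + ?b = 0")
        case True
        then have "?a = 0" "?b = 0" using ab by linarith+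
        then show ?thesis by simp
      next
        case False
        define s where "s = ?a + ?b"
        have s: "0 < s" using False ab by (simp add: s_def)
        \<comment> \<open>Superadditivity of t^P: after division by the sum both ratios lie in
          [0,1], where t^P <= t.\<close>
        have "(x / s) powr P \<le> x / s" if "0 \<le> x" "x \<le> s" for x
          using that s P powr_mono'[of 1 P "x / s"] by (cases "x = 0") auto
        from this[of ?a] this[of ?b] have "(?a / s) powr P + (?b / s) powr P \<le> ?a / s + ?b / s"
          using ab by (simp add: s_def)
        also have "\<dots> = 1" using s by (simp add: s_def add_divide_distrib[symmetric])
        finally have "(?a powr P + ?b powr P) / s powr P \<le> 1" using ab s by (simp add: powr_divide add_divide_distrib)
        then show ?thesis using s by (simp add: divide_le_eq s_def)
      qed
    qed
    finally show ?thesis using False fm' LU ab by (simp add: Lp_le_def nn_integral_lebesgue_on P_def)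
  qed
  from Lp_le_imp_mem_Lp(2)[OF p fm this] show ?thesis .
qed

text \<open>On almost disjoint sets the integrals of |f|^p add up. This is the constraint under
  which \<open>dual_factor_bound\<close> applies Hoelder's inequality.\<close>

lemma Lp_norm_almost_disjoint:
  fixes S R :: "(real^'n) set"
  assumes p: "1 \<le> p" "p \<noteq> \<infinity>" and L: "S \<in> sets lebesgue" "R \<in> sets lebesgue" and f: "mem_Lp p (S \<union> R) f"
    and disj: "AE x in lborel. x \<notin> S \<inter> R"
  shows "Lp_norm p S f powr enn2real p + Lp_norm p R f powr enn2real p \<le> Lp_norm p (S \<union> R) f powr enn2real p"
proof -
  define P where "P = enn2real p"
  have P: "1 \<le> P" using enn2real_ge_1[OF p] by (simp add: P_def)
  have m: "mem_Lp p S f" "mem_Lp p R f"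
    by (rule mem_Lp_AE_subset(1)[OF p(1) _ _ f]; use L in auto)+
  have val: "(\<integral>\<^sup>+x. ennreal (norm (f x) powr P) * indicator X x \<partial>lborel) = ennreal (Lp_norm p X f powr P)"
    and mX: "(\<lambda>x. ennreal (norm (f x) powr P) * indicator X x) \<in> borel_measurable lebesgue"
    if "X \<in> sets lebesgue" "mem_Lp p X f" for X
  proof -
    have i: "integrable (lebesgue_on X) (\<lambda>x. norm (f x) powr P)" using that p by (simp add: mem_Lp_def P_def)
    have "(\<integral>\<^sup>+x. ennreal (norm (f x) powr P) * indicator X x \<partial>lborel) = (\<integral>\<^sup>+x. ennreal (norm (f x) powr P) \<partial>lebesgue_on X)"
      using that by (simp add: nn_integral_lebesgue_on)
    also have "\<dots> = ennreal (LINT x|lebesgue_on X. norm (f x) powr P)"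
      using i by (intro nn_integral_eq_integral) auto
    also have "(LINT x|lebesgue_on X. norm (f x) powr P) = Lp_norm p X f powr P"
      using p P by (simp add: Lp_norm_def powr_powr flip: P_def)
    finally show "(\<integral>\<^sup>+x. ennreal (norm (f x) powr P) * indicator X x \<partial>lborel) = ennreal (Lp_norm p X f powr P)" .
    have [measurable]: "f \<in> borel_measurable (lebesgue_on X)" using that by (simp add: mem_Lp_def)
    have "(\<lambda>x. ennreal (norm (f x) powr P)) \<in> borel_measurable (lebesgue_on X)" by measurable
    then show "(\<lambda>x. ennreal (norm (f x) powr P) * indicator X x) \<in> borel_measurable lebesgue"
      using that by (intro borel_measurable_restrict_space_iff_ennreal[THEN iffD1]) auto
  qed
  have "ennreal (Lp_norm p S f powr P) + ennreal (Lp_norm p R f powr P)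
      = (\<integral>\<^sup>+x. ennreal (norm (f x) powr P) * indicator S x \<partial>lebesgue) + (\<integral>\<^sup>+x. ennreal (norm (f x) powr P) * indicator R x \<partial>lebesgue)"
    using L m by (simp only: nn_integral_completion val)
  also have "\<dots> = (\<integral>\<^sup>+x. ennreal (norm (f x) powr P) * indicator S x + ennreal (norm (f x) powr P) * indicator R x \<partial>lebesgue)"
    by (intro nn_integral_add[symmetric] mX L m)
  also have "\<dots> \<le> (\<integral>\<^sup>+x. ennreal (norm (f x) powr P) * indicator (S \<union> R) x \<partial>lebesgue)"
    using AE_completion[OF disj] by (intro nn_integral_mono_AE, eventually_elim) (auto simp: indicator_def)
  also have "\<dots> = ennreal (Lp_norm p (S \<union> R) f powr P)"
    using L f by (simp only: nn_integral_completion val sets.Un)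
  finally have "ennreal (Lp_norm p S f powr P + Lp_norm p R f powr P) \<le> ennreal (Lp_norm p (S \<union> R) f powr P)"
    by (simp add: ennreal_plus)
  from this[unfolded ennreal_le_iff[OF powr_ge_zero]] show ?thesis unfolding P_def .
qed

lemma conjugate_exponents:
  fixes p q :: ennreal
  assumes "1 \<le> p" "1 \<le> q" "1 = 1 / p + 1 / q" "p \<noteq> 1" "p \<noteq> \<infinity>"
  shows "1 < enn2real p" "1 < enn2real q" "1 / enn2real p + 1 / enn2real q = 1"
proof -
  obtain P where P: "p = ennreal P" "0 \<le> P" using assms(5) by (cases p) auto
  have "1 \<le> P" using assms(1) P by (simp add: one_ennreal.rep_eq ennreal_1[symmetric] del: ennreal_1)
  then have P1: "1 < P" using assms(4) P by (metis ennreal_1 less_eq_real_def)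
  have i: "1 / p = ennreal (1 / P)" using P P1 by (simp add: divide_ennreal ennreal_1[symmetric] del: ennreal_1)
  have "q \<noteq> \<infinity>"
  proof
    assume "q = \<infinity>"
    then have "1 = ennreal (1 / P)" using assms(3) i by simp
    then have "1 / P = 1" using P1 by (simp add: ennreal_eq_1)
    then show False using P1 by simp
  qed
  then obtain Q where Q: "q = ennreal Q" "0 \<le> Q" by (cases q) auto
  have Q1: "1 \<le> Q" using assms(2) Q by (simp add: one_ennreal.rep_eq ennreal_1[symmetric] del: ennreal_1)
  have j: "1 / q = ennreal (1 / Q)" using Q Q1 by (simp add: divide_ennreal ennreal_1[symmetric] del: ennreal_1)
  have "ennreal 1 = ennreal (1 / P + 1 / Q)"
    using assms(3) P1 Q1 unfolding i j by (simp add: ennreal_plus)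
  then have sum: "1 / P + 1 / Q = 1" using P1 Q1 by (subst (asm) ennreal_inj) auto
  then show "1 / enn2real p + 1 / enn2real q = 1" using P Q by simp
  show "1 < enn2real p" using P P1 by simp
  have "1 / Q < 1" using sum P1 by (smt (verit) zero_less_divide_1_iff)
  then show "1 < enn2real q" using Q Q1 by (simp add: divide_less_eq)
qed

text \<open>Hoelder's inequality for the pairs (b, a) and (1, C^(1/p)), the second having q-norm
  \<open>dual_factor p q C\<close> for 1 < p < \<infinity>; it is proved by Young's inequality after
  dividing by \<open>N\<close> and \<open>Y\<close>. For p = 1 the dual norm is a maximum; for p =
  \<infinity> both weights are 1, whence the 2.\<close>

lemma dual_factor_bound:
  assumes pq: "1 \<le> p" "1 \<le> q" "1 = 1 / p + 1 / q" and C: "0 < C" and a: "0 \<le> a" and b: "0 \<le> b" and N: "0 \<le> N"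
    and fin: "p \<noteq> \<infinity> \<Longrightarrow> b powr enn2real p + a powr enn2real p \<le> N powr enn2real p"
    and inf: "p = \<infinity> \<Longrightarrow> a \<le> N \<and> b \<le> N"
  shows "b + root_factor p C * a \<le> dual_factor p q C * N"
proof -
  consider "p = 1" | "p = \<infinity>" | "p \<noteq> 1" "p \<noteq> \<infinity>" by blast
  then show ?thesis
  proof cases
    case 1
    then have "b + a \<le> N" using fin a b N by simp
    have "b + C * a \<le> max 1 C * b + max 1 C * a"
      using a b by (intro add_mono mult_right_mono) (auto simp: mult_le_cancel_right1)
    also have "\<dots> \<le> max 1 C * N" using \<open>b + a \<le> N\<close> by (simp add: distrib_left[symmetric] mult_left_mono)
    finally show ?thesis using 1 C by (simp add: root_factor_def dual_factor_def)
  next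
    case 2
    then show ?thesis using inf by (auto simp: root_factor_def dual_factor_def)
  next
    case 3
    define P Q where "P = enn2real p" and "Q = enn2real q"
    have PQ: "1 < P" "1 < Q" "1 / P + 1 / Q = 1"
      using conjugate_exponents[OF pq 3] by (simp_all add: P_def Q_def)
    define Y where "Y = (1 + C powr (Q / P)) powr (1 / Q)"
    have "0 < 1 + C powr (Q / P)" by (simp add: add_pos_nonneg)
    then have Y: "0 < Y" "Y powr Q = 1 + C powr (Q / P)"
      using PQ by (simp_all add: Y_def powr_powr)
    have fin': "b powr P + a powr P \<le> N powr P" using fin 3 by (simp add: P_def)
    have goal: "b + C powr (1 / P) * a \<le> Y * N"
    proof (cases "N = 0")
      case True
      then have "b powr P + a powr P \<le> 0" using fin' PQ by simp
      then have "b powr P = 0" "a powr P = 0" by (smt (verit) powr_ge_zero)+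
      then show ?thesis using True by simp
    next
      case False
      then have N0: "0 < N" using N by simp
      have 1: "(b / N) * (1 / Y) \<le> (b / N) powr P / P + (1 / Y) powr Q / Q"
        using PQ b N Y by (intro Youngs_inequality) auto
      have 2: "(a / N) * (C powr (1 / P) / Y) \<le> (a / N) powr P / P + (C powr (1 / P) / Y) powr Q / Q"
        using PQ a N Y by (intro Youngs_inequality) auto
      have "(b / N) * (1 / Y) + (a / N) * (C powr (1 / P) / Y)
          \<le> ((b powr P + a powr P) / N powr P) / P + ((1 + C powr (Q / P)) / Y powr Q) / Q"
        using add_mono[OF 1 2] a b N0 Y(1) PQ by (simp add: powr_divide powr_powr add_divide_distrib)
      also have "\<dots> \<le> 1 / P + 1 / Q"
        using fin' N0 Y PQ by (intro add_mono divide_right_mono) (auto simp: divide_le_eq)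
      finally have "(b + C powr (1 / P) * a) / (Y * N) \<le> 1"
        using PQ(3) by (simp add: add_divide_distrib mult.commute)
      then show ?thesis using Y(1) N0 by (simp add: divide_le_eq)
    qed
    then show ?thesis using 3 by (simp add: root_factor_def dual_factor_def Y_def P_def Q_def)
  qed
qed

lemma face_neighboring_commute: "face_neighboring S R \<longleftrightarrow> face_neighboring R S"
  by (auto simp: face_neighboring_def Int_commute)

text \<open>A proper face of a convex set misses its interior, so it lies in the frontier, which is
  a null set.\<close>

lemma face_neighboring_AE_disjoint:
  fixes S R :: "(real^'n) set"
  assumes S: "convex S" and nb: "face_neighboring S R"
  shows "AE x in lborel. x \<notin> S \<inter> R"
  using AE_frontier_convex[OF S]
proof eventually_elim
  case (elim x)
  have "S \<inter> R face_of S" "S \<inter> R \<noteq> S"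
    using nb by (auto simp: face_neighboring_def facet_of_def)
  then have "S \<inter> R \<inter> interior S = {}" by (intro face_of_disjoint_interior)
  then show ?case using elim closure_subset by (auto simp: frontier_def)
qed

lemma root_factor_mono: "1 \<le> p \<Longrightarrow> 0 \<le> a \<Longrightarrow> a \<le> b \<Longrightarrow> root_factor p a \<le> root_factor p b"
  by (auto simp: root_factor_def intro!: powr_mono2)

lemma root_factor_nonneg: "0 \<le> root_factor p a"
  by (simp add: root_factor_def)

lemma C_PF_face_eq: "C_PF_face p S F = hardy_factor p * diameter S"
  by (simp add: C_PF_face_def hardy_factor_def)

lemma hardy_factor_nonneg: "0 \<le> hardy_factor p"
  by (simp add: hardy_factor_def)

text \<open>The edge \<open>E\<close> is at most as long as the diameter of \<open>S\<close>, and
  \<open>J E\<close> at most \<open>onorm J\<close> times that. Hence both gradient terms carry the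
  face constant of \<open>S\<close>, although the second gradient lives on \<open>R\<close>.\<close>

lemma neighbors_trace:
  fixes S R :: "(real^'n) set"
  assumes S: "S \<in> top_simplices \<T>" and R: "R \<in> top_simplices \<T>" and nb: "face_neighboring S R" and p: "1 \<le> p"
  shows "\<exists>J. transition_jacobian S R J \<and> (\<forall>v Dv. W1p p (interior (S \<union> R)) v Dv \<longrightarrow> Lp_norm p S v
      \<le> root_factor p (measure lebesgue S / measure lebesgue R) * Lp_norm p R v
        + C_PF_face p S (S \<inter> R) * Lp_norm p S Dv
        + C_PF_face p S (S \<inter> R) * root_factor p (measure lebesgue S / measure lebesgue R) * onorm ((*v) J) * Lp_norm p R Dv)"
proof -
  obtain c E l J where f: "folding S c E l R J" and E: "norm E \<le> diameter S"
    and tj: "transition_jacobian S R (matrix J)" and J: "linear J"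
    by (rule neighbors_folding[OF S R nb])
  interpret folding S c E l R J by (rule f)
  have "0 < measure lebesgue R"
    using top_simplex_compact_convex[OF R] by (intro measure_pos_of_interior)
  then have ratio: "fold_ratio = measure lebesgue S / measure lebesgue R"
    using measure_S_R by simp
  have "matrix J *v x = J x" for x using J by (simp add: matrix_works)
  then have Jm: "(*v) (matrix J) = J" by auto
  have nJE: "norm (J E) \<le> onorm J * diameter S"
  proof -
    have b: "bounded_linear J" using J by (simp add: linear_conv_bounded_linear)
    have "norm (J E) \<le> onorm J * norm E" by (rule onorm[OF b])
    also have "\<dots> \<le> onorm J * diameter S" by (intro mult_left_mono E onorm_pos_le b)
    finally show ?thesis .
  qed
  show ?thesis
  proof (intro exI conjI allI impI)
    show "transition_jacobian S R (matrix J)" by (rule tj)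
    fix v Dv assume v: "W1p p (interior (S \<union> R)) v Dv"
    let ?h = "hardy_factor p" and ?r = "root_factor p fold_ratio"
    have "Lp_norm p S v \<le> ?r * Lp_norm p R v
      + (norm E * ?h * Lp_norm p S Dv + norm (J E) * ?h * ?r * Lp_norm p R Dv)"
      by (rule trace_estimate[OF p v])
    also have "\<dots> \<le> ?r * Lp_norm p R v + (diameter S * ?h * Lp_norm p S Dv + (onorm J * diameter S) * ?h * ?r * Lp_norm p R Dv)"
      by (intro add_mono mult_right_mono order_refl E nJE Lp_norm_nonneg hardy_factor_nonneg root_factor_nonneg)
    finally show "Lp_norm p S v
      \<le> root_factor p (measure lebesgue S / measure lebesgue R) * Lp_norm p R v
        + C_PF_face p S (S \<inter> R) * Lp_norm p S Dv
        + C_PF_face p S (S \<inter> R) * root_factor p (measure lebesgue S / measure lebesgue R) * onorm ((*v) (matrix J)) * Lp_norm p R Dv"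
      by (simp add: Jm C_PF_face_eq ratio mult_ac)
  qed
qed

lemma union_best_constant:
  fixes S R :: "(real^'n) set"
  assumes S: "S \<in> top_simplices \<T>" and R: "R \<in> top_simplices \<T>" and nb: "face_neighboring S R" and p: "1 \<le> p"
    and v: "W1p p (interior (S \<union> R)) v Dv"
  shows "\<exists>c. Lp_norm p (S \<union> R) (\<lambda>x. v x - c) \<le> C_PF p (S \<union> R) * Lp_norm p (S \<union> R) Dv"
proof -
  let ?U = "S \<union> R"
  note SS = top_simplex_compact_convex[OF S] and RR = top_simplex_compact_convex[OF R]
  have U: "compact ?U" using SS RR by (intro compact_Un)
  have L: "S \<in> sets lebesgue" "R \<in> sets lebesgue" "?U \<in> sets lebesgue"
    using SS RR by (auto simp: lmeasurable_compact fmeasurableD)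
  have sub: "interior S \<subseteq> interior ?U" "interior R \<subseteq> interior ?U" by (simp_all add: interior_mono)
  have Um: "interior ?U \<in> lmeasurable"
    using compact_imp_bounded[OF U] by (intro lmeasurable_open) (auto intro: bounded_subset interior_subset)
  obtain J :: "real^'n^'n" where tr: "\<And>v Dv. W1p p (interior ?U) v Dv \<Longrightarrow> Lp_norm p S v
      \<le> root_factor p (measure lebesgue S / measure lebesgue R) * Lp_norm p R v
        + C_PF_face p S (S \<inter> R) * Lp_norm p S Dv
        + C_PF_face p S (S \<inter> R) * root_factor p (measure lebesgue S / measure lebesgue R) * onorm ((*v) J) * Lp_norm p R Dv"
    using neighbors_trace[OF S R nb p] by blast
  define r a b K where "r = root_factor p (measure lebesgue S / measure lebesgue R)"
    and "a = C_PF_face p S (S \<inter> R)"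
    and "b = C_PF_face p S (S \<inter> R) * root_factor p (measure lebesgue S / measure lebesgue R) * onorm ((*v) J)"
    and "K = diameter R * 2 ^ CARD('n)"
  have d: "0 \<le> diameter S" "0 \<le> diameter R" using SS RR compact_imp_bounded diameter_ge_0 by blast+
  have nn: "0 \<le> r" "0 \<le> a" "0 \<le> b" "0 \<le> K"
    using d by (auto simp: r_def a_def b_def K_def C_PF_face_eq hardy_factor_nonneg root_factor_nonneg
        intro!: mult_nonneg_nonneg onorm_pos_le matrix_vector_mul_bounded_linear)
  show ?thesis
  proof (rule Lp_norm_best_constant[OF p lmeasurable_compact[OF U] _ _ v])
    show "0 < measure lebesgue ?U"
      using U SS(3) sub by (intro measure_pos_of_interior) auto
    show "mem_Lp p ?U v"
      using v by (intro mem_Lp_union p SS RR) (simp add: W1p_def)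
    \<comment> \<open>\<open>K\<close> serves on \<open>R\<close>, and r K + a + b is what
      \<open>neighbors_trace\<close> makes of it on \<open>S\<close>. On the union the two norms are
      simply added.\<close>
    show "0 \<le> r * K + a + b + K" using nn by simp
    fix v Dv assume v: "W1p p (interior ?U) v Dv"
    have D: "mem_Lp p ?U Dv" using v by (intro mem_Lp_union p SS RR) (simp add: W1p_def)
    have DS: "Lp_norm p S Dv \<le> Lp_norm p ?U Dv" and DR: "Lp_norm p R Dv \<le> Lp_norm p ?U Dv"
      by (rule mem_Lp_AE_subset(2)[OF p _ L(3) D]; use L in auto)+
    obtain c where c: "Lp_norm p R (\<lambda>x. v x - c) \<le> K * Lp_norm p R Dv"
      using poincare_convex[OF p RR W1p_subset[OF p open_interior open_interior sub(2) v]] by (auto simp: K_def)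
    have w: "W1p p (interior ?U) (\<lambda>x. v x - c) Dv"
      by (rule W1p_minus_const[OF p open_interior Um v])
    have wU: "mem_Lp p ?U (\<lambda>x. v x - c)" using w by (intro mem_Lp_union p SS RR) (simp add: W1p_def)
    let ?N = "Lp_norm p ?U Dv"
    have R1: "Lp_norm p R (\<lambda>x. v x - c) \<le> K * ?N"
      using c mult_left_mono[OF DR nn(4)] by linarith
    have "Lp_norm p ?U (\<lambda>x. v x - c) \<le> Lp_norm p S (\<lambda>x. v x - c) + Lp_norm p R (\<lambda>x. v x - c)"
      by (rule Lp_norm_union_le[OF p L(1,2) wU])
    also have "\<dots> \<le> (r * Lp_norm p R (\<lambda>x. v x - c) + a * Lp_norm p S Dv + b * Lp_norm p R Dv) + Lp_norm p R (\<lambda>x. v x - c)"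
      using tr[OF w] by (simp add: r_def a_def b_def)
    also have "\<dots> \<le> (r * (K * ?N) + a * ?N + b * ?N) + K * ?N"
      by (intro add_mono mult_left_mono R1 DS DR nn)
    also have "\<dots> = (r * K + a + b + K) * ?N" by (simp add: algebra_simps)
    finally show "\<exists>c. Lp_norm p ?U (\<lambda>x. v x - c) \<le> (r * K + a + b + K) * ?N" by blast
  qed
qed

text \<open>The norm of \<open>c\<close> on \<open>S\<close> is at most C^(1/p) times its norm on
  \<open>R\<close>, which in turn is at most the norm of \<open>w\<close> plus that of w - c. The
  norms of w - c on \<open>S\<close> and on \<open>R\<close> are kept apart until the end, so that
  \<open>dual_factor_bound\<close> can combine them into the norm on the union.\<close>

lemma neighbors_mean_estimate:
  fixes S R :: "(real^'n) set"
  assumes S: "S \<in> top_simplices \<T>" and R: "R \<in> top_simplices \<T>" and nb: "face_neighboring S R"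
    and pq: "1 \<le> p" "1 \<le> q" "1 = 1 / p + 1 / q" and C: "measure lebesgue S / measure lebesgue R \<le> C"
    and w: "W1p p (interior (S \<union> R)) w Dw"
  shows "Lp_norm p S w \<le> root_factor p C * Lp_norm p R w
    + dual_factor p q C * C_PF p (S \<union> R) * Lp_norm p (S \<union> R) Dw"
proof -
  let ?U = "S \<union> R"
  note p = pq(1)
  note SS = top_simplex_compact_convex[OF S] and RR = top_simplex_compact_convex[OF R]
  have U: "compact ?U" using SS RR by (intro compact_Un)
  have lm: "S \<in> lmeasurable" "R \<in> lmeasurable" "?U \<in> lmeasurable"
    using SS RR U by (simp_all add: lmeasurable_compact)
  then have L: "S \<in> sets lebesgue" "R \<in> sets lebesgue" "?U \<in> sets lebesgue" by (simp_all add: fmeasurableD)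
  have mS: "0 < measure lebesgue S" and mR: "0 < measure lebesgue R"
    using SS RR by (simp_all add: measure_pos_of_interior)
  have C0: "0 < C" using C mS mR by (metis divide_pos_pos less_le_trans)
  have wU: "mem_Lp p ?U w" using w by (intro mem_Lp_union p SS RR) (simp add: W1p_def)
  have wS: "mem_Lp p S w" and wR: "mem_Lp p R w"
    by (rule mem_Lp_AE_subset(1)[OF p _ L(3) wU]; use L in auto)+
  obtain c where c: "Lp_norm p ?U (\<lambda>x. w x - c) \<le> C_PF p ?U * Lp_norm p ?U Dw"
    using union_best_constant[OF S R nb p w] by blast
  let ?f = "\<lambda>x. w x - c"
  have fU: "mem_Lp p ?U ?f" by (rule mem_Lp_minus_const(1)[OF p lm(3) wU])
  have fS: "mem_Lp p S ?f" and fR: "mem_Lp p R ?f"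
    by (rule mem_Lp_AE_subset(1)[OF p _ L(3) fU]; use L in auto)+
  have fSU: "Lp_norm p S ?f \<le> Lp_norm p ?U ?f" and fRU: "Lp_norm p R ?f \<le> Lp_norm p ?U ?f"
    by (rule mem_Lp_AE_subset(2)[OF p _ L(3) fU]; use L in auto)+
  have 1: "Lp_norm p S w \<le> Lp_norm p S ?f + \<bar>c\<bar> * root_factor p (measure lebesgue S)"
    using mem_Lp_minus_const(2)[OF p lm(1) fS, of "- c"] by simp
  have 2: "\<bar>c\<bar> * root_factor p (measure lebesgue R) \<le> Lp_norm p R w + Lp_norm p R ?f"
    by (rule Lp_norm_const_le[OF p lm(2) mR wR])
  have rf: "root_factor p (measure lebesgue S) \<le> root_factor p C * root_factor p (measure lebesgue R)"
  proof -
    have "measure lebesgue S \<le> C * measure lebesgue R" using C mR by (simp add: divide_le_eq)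
    then have "root_factor p (measure lebesgue S) \<le> root_factor p (C * measure lebesgue R)"
      using mS by (intro root_factor_mono p) auto
    also have "\<dots> = root_factor p C * root_factor p (measure lebesgue R)"
      by (simp add: root_factor_def powr_mult)
    finally show ?thesis .
  qed
  have "\<bar>c\<bar> * root_factor p (measure lebesgue S) \<le> root_factor p C * (\<bar>c\<bar> * root_factor p (measure lebesgue R))"
    using mult_left_mono[OF rf abs_ge_zero, of c] by (simp add: mult_ac)
  also have "\<dots> \<le> root_factor p C * (Lp_norm p R w + Lp_norm p R ?f)"
    by (intro mult_left_mono 2 root_factor_nonneg)
  finally have 3: "Lp_norm p S w \<le> root_factor p C * Lp_norm p R w + (Lp_norm p S ?f + root_factor p C * Lp_norm p R ?f)"
    using 1 by (simp add: distrib_left)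
  have 4: "Lp_norm p S ?f + root_factor p C * Lp_norm p R ?f \<le> dual_factor p q C * Lp_norm p ?U ?f"
  proof (rule dual_factor_bound[OF pq C0])
    assume "p \<noteq> \<infinity>"
    then show "Lp_norm p S ?f powr enn2real p + Lp_norm p R ?f powr enn2real p \<le> Lp_norm p ?U ?f powr enn2real p"
      by (intro Lp_norm_almost_disjoint p L fU face_neighboring_AE_disjoint[OF SS(2) nb])
  qed (use fSU fRU in \<open>simp_all add: Lp_norm_nonneg\<close>)
  have "0 \<le> dual_factor p q C" by (simp add: dual_factor_def le_max_iff_disj)
  from mult_left_mono[OF c this] show ?thesis using 3 4 by (simp add: mult.assoc)
qed

text \<open>\<open>C_xi\<close> takes the supremum over every admissible \<open>J\<close>, so a
  bound uniform in \<open>J\<close> is required: a ball of radius \<open>e\<close> inside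
  \<open>S\<close> is mapped into \<open>R\<close>, which limits the stretching by the diameter of
  \<open>R\<close> over \<open>e\<close>.\<close>

lemma transition_jacobian_onorm_bounded:
  fixes S R :: "(real^'n) set"
  assumes S: "interior S \<noteq> {}" and R: "bounded R"
  shows "bdd_above {onorm ((*v) J) | J. transition_jacobian S R J}"
proof -
  obtain a e where e: "e > 0" "cball a e \<subseteq> S" using S by (meson ex_in_conv mem_interior_cball)
  have "onorm ((*v) J) \<le> diameter R / e" if J: "transition_jacobian S R J" for J
  proof (rule onorm_le)
    fix v :: "real^'n"
    obtain b where b: "bij_betw (\<lambda>x. J *v x + b) S R" using J by (auto simp: transition_jacobian_def)
    show "norm (J *v v) \<le> diameter R / e * norm v"
    proof (cases "v = 0")
      case False
      define u where "u = (e / norm v) *\<^sub>R v"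
      have "norm u = e" using False e by (simp add: u_def)
      then have "a + u \<in> S" "a \<in> S" using e by (auto simp: subset_iff dist_norm)
      then have "J *v (a + u) + b \<in> R" "J *v a + b \<in> R" using b by (auto simp: bij_betw_def)
      then have "dist (J *v (a + u) + b) (J *v a + b) \<le> diameter R"
        by (rule diameter_bounded_bound[OF R])
      then have "norm (J *v u) \<le> diameter R" by (simp add: dist_norm matrix_vector_right_distrib)
      moreover have "norm (J *v u) = e / norm v * norm (J *v v)"
        using e False by (simp add: u_def matrix_vector_mult_scaleR)
      ultimately show ?thesis using False e by (simp add: field_simps)
    qed simp
  qed
  then show ?thesis by (intro bdd_aboveI[of _ "diameter R / e"]) auto
qed

section \<open>The suprema over neighbouring pairs\<close>

lemma finite_top_simplices:
  assumes "finite_triangulation \<T>" shows "finite (top_simplices \<T>)"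
  using assms by (auto simp: finite_triangulation_def simplicial_complex_def top_simplices_def)

lemma C_rho_ge:
  assumes \<T>: "finite_triangulation \<T>" and "S \<in> top_simplices \<T>" "R \<in> top_simplices \<T>" "face_neighboring S R"
  shows "measure lebesgue S / measure lebesgue R \<le> C_rho \<T>"
  unfolding C_rho_def
proof (rule cSup_upper)
  let ?A = "{measure lebesgue T / measure lebesgue T' | T T'.
     T \<in> top_simplices \<T> \<and> T' \<in> top_simplices \<T> \<and> face_neighboring T T'}"
  have "?A \<subseteq> (\<lambda>(T, T'). measure lebesgue T / measure lebesgue T') ` (top_simplices \<T> \<times> top_simplices \<T>)"
    by auto
  then show "bdd_above ?A"
    using finite_top_simplices[OF \<T>] by (intro bdd_above_finite finite_subset[of ?A]) auto
qed (use assms in blast)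

lemma C_xi_ge:
  fixes \<T> :: "(real^'n) set set"
  assumes \<T>: "finite_triangulation \<T>" and "S \<in> top_simplices \<T>" "R \<in> top_simplices \<T>" "face_neighboring S R"
    and "transition_jacobian S R J"
  shows "onorm ((*v) J) \<le> C_xi \<T>"
  unfolding C_xi_def
proof (rule cSup_upper)
  let ?A = "{onorm ((*v) J) | T T' J. T \<in> top_simplices \<T> \<and> T' \<in> top_simplices \<T>
      \<and> face_neighboring T T' \<and> transition_jacobian T T' J}"
  have "?A \<subseteq> (\<Union>(T, T') \<in> top_simplices \<T> \<times> top_simplices \<T>. {onorm ((*v) J) | J. transition_jacobian T T' J})"
    by blast
  moreover have "bdd_above (\<Union>(T, T') \<in> top_simplices \<T> \<times> top_simplices \<T>. {onorm ((*v) J) | J. transition_jacobian T T' J})"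
    using finite_top_simplices[OF \<T>]
    by (subst bdd_above_UN) (auto intro!: transition_jacobian_onorm_bounded top_simplex_compact_convex compact_imp_bounded)
  ultimately show "bdd_above ?A" by (rule bdd_above_mono[rotated])
qed (use assms in blast)

section \<open>The recursion along face paths\<close>

theorem theorem4p4:
  fixes \<T> :: "(real^'n) set set" and \<Omega> :: "(real^'n) set"
    and p q :: ennreal
    and u :: "real^'n \<Rightarrow> real" and Du :: "real^'n \<Rightarrow> real^'n"
  assumes "finite_triangulation \<T>" and "\<T> \<noteq> {}"
    and "full_dimensional \<T>" and "face_connected \<T>"
    and "\<Omega> = interior (\<Union>\<T>)"
    and "1 \<le> p" and "1 \<le> q" and "1 = 1 / p + 1 / q"
    and "W1p p \<Omega> u Du"
  shows "\<exists>w. W1p p \<Omega> w Du \<and>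
    (\<exists>T0 \<in> top_simplices \<T>.
       Lp_norm p T0 w \<le> C_PF p T0 * Lp_norm p T0 Du \<and>
       (\<forall>TM \<in> top_simplices \<T>. \<exists>M P.
          face_path \<T> M P \<and> P 0 = T0 \<and> P M = TM \<and>
          (\<exists>A B' B'' Bs :: nat \<Rightarrow> real. \<forall>m\<in>{1..M}.
             Lp_norm p (P m) w \<le> A m * Lp_norm p (P (m - 1)) w
                + B' m * Lp_norm p (P m) Du + B'' m * Lp_norm p (P (m - 1)) Du \<and>
             Lp_norm p (P m) w \<le> A m * Lp_norm p (P (m - 1)) w
                + Bs m * Lp_norm p (P m \<union> P (m - 1)) Du \<and>
             A m \<le> root_factor p (C_rho \<T>) \<and>
             B' m \<le> C_PF_face p (P m) (P m \<inter> P (m - 1)) \<and>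
             B'' m \<le> C_PF_face p (P m) (P m \<inter> P (m - 1)) * root_factor p (C_rho \<T>) * C_xi \<T> \<and>
             Bs m \<le> dual_factor p q (C_rho \<T>) * C_PF p (P m \<union> P (m - 1)))))"
proof -
  note \<T> = assms(1) and p = assms(6) and u = assms(9)
  have fin: "finite \<T>" using \<T> by (auto simp: finite_triangulation_def simplicial_complex_def)
  have cpt: "compact T" if "T \<in> \<T>" for T
  proof -
    have "\<exists>n. n simplex T"
      using \<T> that by (auto simp: finite_triangulation_def simplicial_complex_def)
    then show ?thesis by (meson polytope_imp_compact simplex_imp_polytope)
  qed
  have bdd: "bounded (\<Union>\<T>)" using fin cpt compact_imp_bounded by (intro bounded_Union) auto
  have \<Omega>: "open \<Omega>" "\<Omega> \<in> lmeasurable"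
    using bdd assms(5) by (auto intro!: lmeasurable_open intro: bounded_subset interior_subset)
  have sub: "interior X \<subseteq> \<Omega>" if "X \<subseteq> \<Union>\<T>" for X
    using that assms(5) interior_mono by blast
  obtain T0 where T0: "T0 \<in> top_simplices \<T>"
    using assms(2,3) unfolding full_dimensional_def by blast
  note TT0 = top_simplex_compact_convex[OF T0]
  have uT0: "W1p p (interior T0) u Du"
    by (rule W1p_subset[OF p \<Omega>(1) open_interior sub u]) (use T0 in \<open>auto simp: top_simplices_def\<close>)
  obtain c where c: "Lp_norm p T0 (\<lambda>x. u x - c) \<le> C_PF p T0 * Lp_norm p T0 Du"
    using simplex_best_constant[OF p TT0 uT0] by blast
  define w where "w x = u x - c" for x
  have w: "W1p p \<Omega> w Du"
    unfolding w_def by (rule W1p_minus_const[OF p \<Omega> u])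
  let ?A = "root_factor p (C_rho \<T>)"
  \<comment> \<open>Both estimates hold for any ordered pair of neighbours, independently of a path,
    so no induction along the path occurs. \<open>C_rho\<close> and \<open>C_xi\<close> replace the
    ratio and the operator norm of the single pair.\<close>
  have step: "Lp_norm p S w \<le> ?A * Lp_norm p R w + C_PF_face p S (S \<inter> R) * Lp_norm p S Du
      + C_PF_face p S (S \<inter> R) * ?A * C_xi \<T> * Lp_norm p R Du"
    "Lp_norm p S w \<le> ?A * Lp_norm p R w + dual_factor p q (C_rho \<T>) * C_PF p (S \<union> R) * Lp_norm p (S \<union> R) Du"
    if S: "S \<in> top_simplices \<T>" and R: "R \<in> top_simplices \<T>" and nb: "face_neighboring S R" for S R
  proof -
    let ?\<rho> = "measure lebesgue S / measure lebesgue R"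
    have wU: "W1p p (interior (S \<union> R)) w Du"
      by (rule W1p_subset[OF p \<Omega>(1) open_interior sub w]) (use S R in \<open>auto simp: top_simplices_def\<close>)
    have \<rho>: "?\<rho> \<le> C_rho \<T>" by (rule C_rho_ge[OF \<T> S R nb])
    show "Lp_norm p S w \<le> ?A * Lp_norm p R w + dual_factor p q (C_rho \<T>) * C_PF p (S \<union> R) * Lp_norm p (S \<union> R) Du"
      by (rule neighbors_mean_estimate[OF S R nb assms(6-8) \<rho> wU])
    obtain J where J: "transition_jacobian S R J" and le: "Lp_norm p S w
      \<le> root_factor p ?\<rho> * Lp_norm p R w + C_PF_face p S (S \<inter> R) * Lp_norm p S Du
        + C_PF_face p S (S \<inter> R) * root_factor p ?\<rho> * onorm ((*v) J) * Lp_norm p R Du"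
      using neighbors_trace[OF S R nb p] wU by blast
    have "0 \<le> diameter S"
      using top_simplex_compact_convex(1)[OF S] compact_imp_bounded diameter_ge_0 by blast
    then have F: "0 \<le> C_PF_face p S (S \<inter> R)" by (simp add: C_PF_face_eq hardy_factor_nonneg)
    have r: "root_factor p ?\<rho> \<le> ?A" by (rule root_factor_mono[OF p _ \<rho>]) simp
    have "C_PF_face p S (S \<inter> R) * root_factor p ?\<rho> * onorm ((*v) J)
        \<le> C_PF_face p S (S \<inter> R) * ?A * C_xi \<T>"
      by (intro mult_mono F r C_xi_ge[OF \<T> S R nb J] onorm_pos_le matrix_vector_mul_bounded_linear
          mult_nonneg_nonneg root_factor_nonneg order_refl)
    then have "root_factor p ?\<rho> * Lp_norm p R w + C_PF_face p S (S \<inter> R) * Lp_norm p S Du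
        + C_PF_face p S (S \<inter> R) * root_factor p ?\<rho> * onorm ((*v) J) * Lp_norm p R Du
      \<le> ?A * Lp_norm p R w + C_PF_face p S (S \<inter> R) * Lp_norm p S Du
        + C_PF_face p S (S \<inter> R) * ?A * C_xi \<T> * Lp_norm p R Du"
      by (intro add_mono mult_right_mono r order_refl Lp_norm_nonneg)
    with le show "Lp_norm p S w \<le> ?A * Lp_norm p R w + C_PF_face p S (S \<inter> R) * Lp_norm p S Du
      + C_PF_face p S (S \<inter> R) * ?A * C_xi \<T> * Lp_norm p R Du" by linarith
  qed
  show ?thesis
  proof (intro exI[of _ w] conjI w bexI[OF _ T0] ballI)
    show "Lp_norm p T0 w \<le> C_PF p T0 * Lp_norm p T0 Du" using c by (simp add: w_def[abs_def])
    fix TM assume TM: "TM \<in> top_simplices \<T>"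
    from assms(4)[unfolded face_connected_def, rule_format, OF T0 TM]
    obtain M P where P: "face_path \<T> M P" "P 0 = T0" "P M = TM" by blast
    have nb: "P m \<in> top_simplices \<T>" "P (m - 1) \<in> top_simplices \<T>" "face_neighboring (P m) (P (m - 1))"
      if m: "m \<in> {1..M}" for m
    proof -
      \<comment> \<open>Subtraction is truncated, but \<open>m\<close> is at least 1 here. For M = 0
        the range of \<open>m\<close> is empty and the path consists of \<open>T0\<close>
        alone.\<close>
      have "m - 1 < M" "Suc (m - 1) = m" using m by auto
      then have "face_neighboring (P (m - 1)) (P m)" using P(1) unfolding face_path_def by metis
      then show "face_neighboring (P m) (P (m - 1))" by (simp only: face_neighboring_commute)
      show "P m \<in> top_simplices \<T>" "P (m - 1) \<in> top_simplices \<T>"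
        using P(1) m by (auto simp: face_path_def)
    qed
    let ?F = "\<lambda>m. C_PF_face p (P m) (P m \<inter> P (m - 1))"
    show "\<exists>M P. face_path \<T> M P \<and> P 0 = T0 \<and> P M = TM \<and>
          (\<exists>A B' B'' Bs :: nat \<Rightarrow> real. \<forall>m\<in>{1..M}.
             Lp_norm p (P m) w \<le> A m * Lp_norm p (P (m - 1)) w
                + B' m * Lp_norm p (P m) Du + B'' m * Lp_norm p (P (m - 1)) Du \<and>
             Lp_norm p (P m) w \<le> A m * Lp_norm p (P (m - 1)) w
                + Bs m * Lp_norm p (P m \<union> P (m - 1)) Du \<and>
             A m \<le> root_factor p (C_rho \<T>) \<and>
             B' m \<le> C_PF_face p (P m) (P m \<inter> P (m - 1)) \<and>
             B'' m \<le> C_PF_face p (P m) (P m \<inter> P (m - 1)) * root_factor p (C_rho \<T>) * C_xi \<T> \<and>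
             Bs m \<le> dual_factor p q (C_rho \<T>) * C_PF p (P m \<union> P (m - 1)))"
    proof (rule exI[of _ M], rule exI[of _ P], intro conjI P, rule exI[of _ "\<lambda>_. ?A"], rule exI[of _ ?F],
        rule exI[of _ "\<lambda>m. ?F m * ?A * C_xi \<T>"],
        rule exI[of _ "\<lambda>m. dual_factor p q (C_rho \<T>) * C_PF p (P m \<union> P (m - 1))"], rule ballI)
      fix m assume "m \<in> {1..M}"
      note nb = nb[OF this]
      show "Lp_norm p (P m) w \<le> ?A * Lp_norm p (P (m - 1)) w
            + ?F m * Lp_norm p (P m) Du + ?F m * ?A * C_xi \<T> * Lp_norm p (P (m - 1)) Du \<and>
          Lp_norm p (P m) w \<le> ?A * Lp_norm p (P (m - 1)) w
            + dual_factor p q (C_rho \<T>) * C_PF p (P m \<union> P (m - 1)) * Lp_norm p (P m \<union> P (m - 1)) Du \<and>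
          ?A \<le> ?A \<and> ?F m \<le> ?F m \<and> ?F m * ?A * C_xi \<T> \<le> ?F m * ?A * C_xi \<T> \<and>
          dual_factor p q (C_rho \<T>) * C_PF p (P m \<union> P (m - 1))
            \<le> dual_factor p q (C_rho \<T>) * C_PF p (P m \<union> P (m - 1))"
        using step[OF nb] by simp
    qed
  qed
qed

end
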